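(* For a set $S$ of factors of the principal $A$-determinant $E_A$ of $\mathbb{P}^1\times\mathbb{P}^1\times\mathbb{P}^1$, let $\Sigma_S\subset(\mathbb{C}^* )^8$ be the set of $W$ at which the factors in $S$ vanish and all other factors of $E_A$ do not vanish. Then $\Sigma_S$ is nonempty for exactly the following $41$ sets $S$, and $\chi(Y_{W,1})$ is constant on each such $\Sigma_S$ with the indicated value: 0. $S=\varnothing$ ($1$ stratum): $\chi(Y_{W,1})=6$. 1. $S$ consists of exactly one factor ($7$ strata): $\chi(Y_{W,1})=5$. 2. $S$ consists of exactly two factors ($\binom72$ strata): $\chi(Y_{W,1})=4$. 3. $S=\{F_{a\bullet\bullet},F_{\bullet b\bullet},F_{\bullet\bullet c}\}$ for some $(a,b,c)\in\{0,1\}^3$ ($8$ strata): $\chi(Y_{W,1})=3$. 4. $S$ consists of the hyperdeterminant $H$ together with two of the three pairs $\{F_{0\bullet\bullet},F_{1\bullet\bullet}\}$, $\{F_{\bullet0\bullet},F_{\bullet1\bullet}\}$, $\{F_{\bullet\bullet0},F_{\bullet\bullet1}\}$ ($3$ strata): $\chi(Y_{W,1})=2$. 5. $S$ consists of all $7$ factors ($1$ stratum): $\chi(Y_{W,1})=1$.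
   Context: For $W=(w_{ijk})_{i,j,k\in\{0,1\}}\in(\mathbb{C}^* )^8$ put $f_k=w_{00k}+w_{10k}x+w_{01k}y+w_{11k}xy$ ($k=0,1$) and let $Y_{W,1}=\{f_0+zf_1=0\}\subset(\mathbb{C}^* )^3$. $\chi$ is the topological Euler characteristic. Ignoring the monomial factors $w_{ijk}$, the principal $A$-determinant $E_A$ of $\mathbb{P}^1\times\mathbb{P}^1\times\mathbb{P}^1$ has exactly seven factors: the six 2-minors $F_{i\bullet\bullet}=w_{i00}w_{i11}-w_{i10}w_{i01}$, $F_{\bullet j\bullet}=w_{0j0}w_{1j1}-w_{1j0}w_{0j1}$, $F_{\bullet\bullet k}=w_{00k}w_{11k}-w_{01k}w_{10k}$ ($i,j,k\in\{0,1\}$), and the $2\times2\times2$ hyperdeterminant $$H=\big[(w_{000}w_{111}-w_{001}w_{110})-(w_{010}w_{101}-w_{011}w_{100})\big]^2-4F_{0\bullet\bullet}F_{1\bullet\bullet}.$$ *)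

theory Defs
  imports "HOL-Analysis.Analysis" "HOL-Homology.Homology"
begin

text \<open>
  Singular homology is taken from the library (integer coefficients, groups written
  multiplicatively). The \<open>p\<close>-th Betti number is the rank of the \<open>p\<close>-th homology group.
\<close>

definition int_independent :: "('a, 'b) monoid_scheme \<Rightarrow> 'a set \<Rightarrow> bool" where
  "int_independent G B \<longleftrightarrow> finite B \<and> B \<subseteq> carrier G \<and>
     (\<forall>c :: 'a \<Rightarrow> int. (\<Otimes>\<^bsub>G\<^esub>x\<in>B. x [^]\<^bsub>G\<^esub> c x) = \<one>\<^bsub>G\<^esub> \<longrightarrow> (\<forall>x\<in>B. c x = 0))"

definition has_rank :: "('a, 'b) monoid_scheme \<Rightarrow> nat \<Rightarrow> bool" where
  "has_rank G r \<longleftrightarrow> (\<exists>B. int_independent G B \<and> card B = r) \<and>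
     (\<forall>B. int_independent G B \<longrightarrow> card B \<le> r)"

text \<open>
  A relation rather than a function: it also asserts that the Euler characteristic is defined,
  i.e. that all Betti numbers are finite and almost all of them vanish.
\<close>

definition has_euler_characteristic :: "'a topology \<Rightarrow> int \<Rightarrow> bool" where
  "has_euler_characteristic X c \<longleftrightarrow>
     (\<exists>b :: nat \<Rightarrow> nat. (\<forall>p. has_rank (homology_group (int p) X) (b p)) \<and>
        finite {p. b p \<noteq> 0} \<and> c = (\<Sum>p | b p \<noteq> 0. (- 1) ^ p * int (b p)))"

text \<open>
  The index set \<open>{0,1}\<close> is the two-element numeral type \<open>2\<close>, with elements \<open>0\<close> and \<open>1\<close>.
\<close>

type_synonym weights = "2 \<Rightarrow> 2 \<Rightarrow> 2 \<Rightarrow> complex"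

definition weight_torus :: "weights set" where
  "weight_torus = {W. \<forall>i j k. W i j k \<noteq> 0}"

definition f_pol :: "weights \<Rightarrow> 2 \<Rightarrow> complex \<Rightarrow> complex \<Rightarrow> complex" where
  "f_pol W k x y = W 0 0 k + W 1 0 k * x + W 0 1 k * y + W 1 1 k * x * y"

definition Y1 :: "weights \<Rightarrow> (complex \<times> complex \<times> complex) set" where
  "Y1 W = {(x, y, z). x \<noteq> 0 \<and> y \<noteq> 0 \<and> z \<noteq> 0 \<and> f_pol W 0 x y + z * f_pol W 1 x y = 0}"

text \<open>
  The factors are polynomial functions of \<open>W\<close>; \<open>minor1 i\<close>, \<open>minor2 j\<close>, \<open>minor3 k\<close> are
  the 2-minors with the first, second, third index fixed.
\<close>

definition minor1 :: "2 \<Rightarrow> weights \<Rightarrow> complex" where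
  "minor1 i W = W i 0 0 * W i 1 1 - W i 1 0 * W i 0 1"

definition minor2 :: "2 \<Rightarrow> weights \<Rightarrow> complex" where
  "minor2 j W = W 0 j 0 * W 1 j 1 - W 1 j 0 * W 0 j 1"

definition minor3 :: "2 \<Rightarrow> weights \<Rightarrow> complex" where
  "minor3 k W = W 0 0 k * W 1 1 k - W 0 1 k * W 1 0 k"

definition hyperdet :: "weights \<Rightarrow> complex" where
  "hyperdet W =
     ((W 0 0 0 * W 1 1 1 - W 0 0 1 * W 1 1 0) - (W 0 1 0 * W 1 0 1 - W 0 1 1 * W 1 0 0))\<^sup>2
       - 4 * minor1 0 W * minor1 1 W"

text \<open>The monomial factors \<open>W i j k\<close> are left out: they never vanish on \<open>weight_torus\<close>.\<close>

definition EA_factors :: "(weights \<Rightarrow> complex) set" where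
  "EA_factors = {minor1 0, minor1 1, minor2 0, minor2 1, minor3 0, minor3 1, hyperdet}"

definition stratum :: "(weights \<Rightarrow> complex) set \<Rightarrow> weights set" where
  "stratum S = {W \<in> weight_torus. (\<forall>F\<in>S. F W = 0) \<and> (\<forall>F\<in>EA_factors - S. F W \<noteq> 0)}"

definition parallel_pairs :: "(weights \<Rightarrow> complex) set set" where
  "parallel_pairs = {{minor1 0, minor1 1}, {minor2 0, minor2 1}, {minor3 0, minor3 1}}"

definition strata_class :: "nat \<Rightarrow> (weights \<Rightarrow> complex) set set" where
  "strata_class n =
     (if n = 0 then {{}}
      else if n = 1 then {S. S \<subseteq> EA_factors \<and> card S = 1}
      else if n = 2 then {S. S \<subseteq> EA_factors \<and> card S = 2}
      else if n = 3 then {{minor1 a, minor2 b, minor3 c} | a b c. True}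
      else if n = 4 then {insert hyperdet (P \<union> Q) | P Q.
             P \<in> parallel_pairs \<and> Q \<in> parallel_pairs \<and> P \<noteq> Q}
      else if n = 5 then {EA_factors}
      else {})"

end

theory Submission
  imports Defs "HOL-Complex_Analysis.Conformal_Mappings"
begin

text \<open>
  Project the surface to the \<open>x\<close>-axis: the fibre is the curve \<open>(a + b y) + z (c + d y) = 0\<close> with
  \<open>a, b, c, d\<close> linear in \<open>x\<close>. Its discriminant \<open>a d - b c\<close> is a quadratic polynomial in \<open>x\<close> with outer
  coefficients \<open>F\<^sub>0\<^sub>\<bullet>\<^sub>\<bullet>\<close>, \<open>F\<^sub>1\<^sub>\<bullet>\<^sub>\<bullet>\<close> and with discriminant the hyperdeterminant. Away from
  its roots the surface is \<open>B \<times> \<complex>\<^sup>*\<close> with the two disjoint graphs \<open>y = - a / b\<close> and \<open>y = - c / d\<close>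
  removed, and removing a graph subtracts the Euler characteristic of its domain. Near a root at which
  \<open>a, b, c, d\<close> do not vanish, the surface is \<open>v w = s\<^sup>n\<close> in local coordinates, of characteristic \<open>-1\<close>.
  Permuting the coordinates, every stratum has either only such roots, apart from an empty fibre, or
  a surface with a component \<open>x = const\<close>. All gluing is done by Mayer-Vietoris, in the form of excision
  and the long exact sequence of a pair.
\<close>

section \<open>Ranks of abelian groups\<close>

text \<open>Singular Euler characteristics are not additive over a closed set and its complement in
  general. In the two steps where something is removed or filled in, additivity holds because the
  overlap, a family of punctured discs around a graph or the surface over a punctured disc, has
  characteristic 0. As \<open>has_euler_characteristic\<close> also asserts finite ranks, each
  gluing must derive finiteness of the third term of an exact sequence from the other two. Origin of
  6 minus the number of factors: if the quadratic has n nonzero roots, all of them nodes, then each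
  graph is undefined at these and at two further points, and each node costs 1, which gives (n + 2)
  + (n + 2) - n = n + 4. A vanishing outer coefficient or discriminant lowers n from 2 by one. The
  obstacle is a single shared zero, say of \<open>a\<close> and \<open>c\<close>: the fibre y (b + d
  z) = 0 is one punctured line, neither nodal nor empty. Projecting to another coordinate turns such
  a minor into an outer coefficient or combines it with a second one, so that three forms vanish
  together and the fibre is empty.\<close>

definition lincomb :: "('a, 'm) monoid_scheme \<Rightarrow> 'i set \<Rightarrow> ('i \<Rightarrow> 'a) \<Rightarrow> ('i \<Rightarrow> int) \<Rightarrow> 'a" where
  "lincomb G I e c = (\<Otimes>\<^bsub>G\<^esub>i\<in>I. e i [^]\<^bsub>G\<^esub> c i)"

text \<open>Families rather than sets: the image of a set under a homomorphism may have repetitions,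
  and injectivity becomes a consequence of independence.\<close>

definition indep_family :: "('a, 'm) monoid_scheme \<Rightarrow> 'i set \<Rightarrow> ('i \<Rightarrow> 'a) \<Rightarrow> bool" where
  "indep_family G I e \<longleftrightarrow> finite I \<and> e \<in> I \<rightarrow> carrier G \<and>
     (\<forall>c. lincomb G I e c = \<one>\<^bsub>G\<^esub> \<longrightarrow> (\<forall>i\<in>I. c i = 0))"

text \<open>Kernels and images stay subsets of the ambient group, so the terms of an exact sequence
  are compared without forming subgroups.\<close>

definition rank_on :: "('a, 'm) monoid_scheme \<Rightarrow> 'a set \<Rightarrow> nat \<Rightarrow> bool" where
  "rank_on G S r \<longleftrightarrow> (\<exists>B\<subseteq>S. int_independent G B \<and> card B = r) \<and>
     (\<forall>B\<subseteq>S. int_independent G B \<longrightarrow> card B \<le> r)"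

lemma int_independent_iff_indep_family: "int_independent G B \<longleftrightarrow> indep_family G B id"
  by (auto simp: int_independent_def indep_family_def lincomb_def)

lemma indep_familyD:
  "indep_family G I e \<Longrightarrow> lincomb G I e c = \<one>\<^bsub>G\<^esub> \<Longrightarrow> i \<in> I \<Longrightarrow> c i = 0"
  unfolding indep_family_def by blast

lemma has_rank_iff_rank_on: "has_rank G r \<longleftrightarrow> rank_on G (carrier G) r"
  by (auto simp: has_rank_def rank_on_def int_independent_def)

context comm_group
begin

lemma lincomb_closed [simp]: "e \<in> I \<rightarrow> carrier G \<Longrightarrow> lincomb G I e c \<in> carrier G"
  unfolding lincomb_def by (intro finprod_closed) auto

lemma lincomb_add:
  "e \<in> I \<rightarrow> carrier G \<Longrightarrow>
   lincomb G I e (\<lambda>i. c i + d i) = lincomb G I e c \<otimes> lincomb G I e d"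
  unfolding lincomb_def
  by (subst finprod_multf [symmetric]) (auto intro!: finprod_cong' int_pow_mult)

lemma lincomb_pow:
  assumes "e \<in> I \<rightarrow> carrier G"
  shows "lincomb G I e c [^] (m::int) = lincomb G I e (\<lambda>i. c i * m)"
proof (cases "finite I")
  case True
  then show ?thesis using assms unfolding lincomb_def
  proof (induction I)
    case (insert i I)
    then have "(\<lambda>i. e i [^] c i) \<in> I \<rightarrow> carrier G" "(\<lambda>i. e i [^] (c i * m)) \<in> I \<rightarrow> carrier G"
      by (auto simp: Pi_iff)
    with insert show ?case
      by (simp add: int_pow_distrib int_pow_pow Pi_iff)
  qed simp
qed (simp add: lincomb_def)

lemma lincomb_lincomb:
  assumes "finite J" and e: "e \<in> I \<rightarrow> carrier G"
  shows "lincomb G J (\<lambda>j. lincomb G I e (C j)) m = lincomb G I e (\<lambda>i. \<Sum>j\<in>J. C j i * m j)"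
  using assms(1)
proof (induction J)
  case empty
  then show ?case by (simp add: lincomb_def)
next
  case (insert j J)
  have "lincomb G (insert j J) (\<lambda>j. lincomb G I e (C j)) m =
      lincomb G I e (C j) [^] m j \<otimes> lincomb G J (\<lambda>j. lincomb G I e (C j)) m"
    using insert e unfolding lincomb_def[where I = "insert j J"] lincomb_def[where I = J]
    by (intro finprod_insert) auto
  also have "\<dots> = lincomb G I e (\<lambda>i. \<Sum>j\<in>insert j J. C j i * m j)"
    using insert e by (simp add: lincomb_pow lincomb_add)
  finally show ?case .
qed

lemma lincomb_mono_neutral:
  assumes "finite I" "J \<subseteq> I" "e \<in> I \<rightarrow> carrier G" "\<And>i. i \<in> I - J \<Longrightarrow> c i = 0"
  shows "lincomb G I e c = lincomb G J e c"
  unfolding lincomb_def using assms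
  by (intro finprod_mono_neutral_cong_right) auto

lemma lincomb_single:
  assumes "finite I" "i \<in> I" "e \<in> I \<rightarrow> carrier G"
  shows "lincomb G I e (\<lambda>j. if j = i then m else 0) = e i [^] m"
proof -
  have "lincomb G I e (\<lambda>j. if j = i then m else 0) = lincomb G {i} e (\<lambda>j. if j = i then m else 0)"
    using assms by (intro lincomb_mono_neutral) auto
  also have "\<dots> = e i [^] m"
    using assms by (simp add: lincomb_def Pi_iff)
  finally show ?thesis .
qed

lemma lincomb_Plus:
  assumes "finite I" "finite J" "e \<in> I \<rightarrow> carrier G" "f \<in> J \<rightarrow> carrier G"
  shows "lincomb G (I <+> J) (case_sum e f) c
    = lincomb G I e (c \<circ> Inl) \<otimes> lincomb G J f (c \<circ> Inr)"
proof -
  have "lincomb G (I <+> J) (case_sum e f) c =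
      lincomb G (Inl ` I) (case_sum e f) c \<otimes> lincomb G (Inr ` J) (case_sum e f) c"
    unfolding lincomb_def Plus_def using assms by (intro finprod_Un_disjoint) (auto simp: Pi_iff)
  moreover have "lincomb G (Inl ` I) (case_sum e f) c = lincomb G I e (c \<circ> Inl)"
    unfolding lincomb_def using assms by (subst finprod_reindex) (auto simp: Pi_iff)
  moreover have "lincomb G (Inr ` J) (case_sum e f) c = lincomb G J f (c \<circ> Inr)"
    unfolding lincomb_def using assms by (subst finprod_reindex) (auto simp: Pi_iff)
  ultimately show ?thesis by simp
qed

lemma indep_family_inj_on:
  assumes "indep_family G I e"
  shows "inj_on e I"
proof (rule inj_onI, rule ccontr)
  fix i j assume ij: "i \<in> I" "j \<in> I" "e i = e j" "i \<noteq> j"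
  have I: "finite I" and e: "e \<in> I \<rightarrow> carrier G"
    using assms by (auto simp: indep_family_def)
  \<comment> \<open>Coefficients 1 at \<open>i\<close> and -1 at \<open>j\<close> give a relation
    once \<open>e i = e j\<close>.\<close>
  have "lincomb G I e (\<lambda>k. (if k = i then 1 else 0) + (if k = j then -1 else 0)) =
     e i [^] (1::int) \<otimes> e j [^] (-1::int)"
    by (simp only: lincomb_add[OF e] lincomb_single[OF I _ e] ij(1,2))
  also have "\<dots> = \<one>"
    using e ij by (simp add: int_pow_neg Pi_iff)
  finally have "lincomb G I e (\<lambda>k. (if k = i then 1 else 0) + (if k = j then -1 else 0)) = \<one>" .
  from indep_familyD[OF assms this ij(1)] ij(4) show False by simp
qed

lemma indep_family_image:
  assumes "indep_family G I e"
  shows "int_independent G (e ` I)" "card (e ` I) = card I"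
proof -
  note inj = indep_family_inj_on[OF assms]
  show "card (e ` I) = card I" using inj by (rule card_image)
  have I: "finite I" and e: "e \<in> I \<rightarrow> carrier G"
    using assms by (auto simp: indep_family_def)
  show "int_independent G (e ` I)"
    unfolding int_independent_def
  proof (intro conjI allI impI)
    fix c :: "'a \<Rightarrow> int"
    assume "(\<Otimes>x\<in>e ` I. x [^] c x) = \<one>"
    then have "lincomb G I e (c \<circ> e) = \<one>"
      unfolding lincomb_def using e by (subst (asm) finprod_reindex[OF _ inj]) auto
    then show "\<forall>x\<in>e ` I. c x = 0"
      using assms by (fastforce simp: indep_family_def)
  qed (use I e in auto)
qed

lemma rank_on_unique: "rank_on G S r \<Longrightarrow> rank_on G S s \<Longrightarrow> r = s"
  unfolding rank_on_def by (meson order_antisym)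

text \<open>The empty set is independent and a bounded nonempty set of cardinalities has a
  maximum.\<close>

lemma rank_on_exists_of_bounded:
  assumes "\<And>B. B \<subseteq> S \<Longrightarrow> int_independent G B \<Longrightarrow> card B \<le> n"
  shows "\<exists>r\<le>n. rank_on G S r"
proof -
  define P where "P k \<longleftrightarrow> (\<exists>B\<subseteq>S. int_independent G B \<and> card B = k)" for k
  have "P 0" unfolding P_def
    by (intro exI[of _ "{}"]) (auto simp: int_independent_def)
  moreover have bd: "\<And>k. P k \<Longrightarrow> k \<le> n" unfolding P_def using assms by auto
  ultimately have "P (GREATEST k. P k)" "\<And>k. P k \<Longrightarrow> k \<le> (GREATEST k. P k)"
    by (auto intro: GreatestI_nat Greatest_le_nat)
  then have "rank_on G S (GREATEST k. P k)"
    unfolding rank_on_def P_def by blast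
  then show ?thesis using \<open>P (GREATEST k. P k)\<close> bd by blast
qed

end

lemma rank_on_subset:
  assumes "comm_group G" "rank_on G T r" "S \<subseteq> T"
  shows "\<exists>s\<le>r. rank_on G S s"
  using assms by (intro comm_group.rank_on_exists_of_bounded) (auto simp: rank_on_def)

lemma rank_on_singleton_one:
  assumes "comm_group G"
  shows "rank_on G {\<one>\<^bsub>G\<^esub>} 0"
proof -
  interpret comm_group G by fact
  have "\<not> int_independent G {\<one>\<^bsub>G\<^esub>}"
  proof
    assume "int_independent G {\<one>\<^bsub>G\<^esub>}"
    then have "\<And>c :: 'a \<Rightarrow> int. (\<Otimes>\<^bsub>G\<^esub>x\<in>{\<one>\<^bsub>G\<^esub>}. x [^]\<^bsub>G\<^esub> c x) = \<one>\<^bsub>G\<^esub> \<Longrightarrow> c \<one>\<^bsub>G\<^esub> = 0"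
      unfolding int_independent_def by simp
    from this[of "\<lambda>_. 1"] show False by simp
  qed
  then have "\<And>B. B \<subseteq> {\<one>\<^bsub>G\<^esub>} \<Longrightarrow> int_independent G B \<Longrightarrow> B = {}"
    by (metis subset_singletonD)
  moreover have "int_independent G {}"
    by (simp add: int_independent_def)
  ultimately show ?thesis
    unfolding rank_on_def by (metis card.empty empty_subsetI order_refl)
qed

section \<open>Rank-nullity for homomorphisms of abelian groups\<close>

locale comm_group_hom = G: comm_group G + H: comm_group H for G (structure) and H (structure) +
  fixes f
  assumes f_hom: "f \<in> hom G H"
begin

sublocale group_hom G H f
  by unfold_locales (rule f_hom)

lemma hom_lincomb:
  assumes "e \<in> I \<rightarrow> carrier G"
  shows "f (lincomb G I e c) = lincomb H I (f \<circ> e) c"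
proof (cases "finite I")
  case True
  then show ?thesis using assms unfolding lincomb_def
  proof (induction I)
    case (insert i I)
    then have "(\<lambda>i. e i [^] c i) \<in> I \<rightarrow> carrier G" "(\<lambda>i. f (e i) [^]\<^bsub>H\<^esub> c i) \<in> I \<rightarrow> carrier H"
      by (auto simp: Pi_iff)
    with insert show ?case
      by (simp add: Pi_iff hom_int_pow)
  qed simp
qed (simp add: lincomb_def)

text \<open>Applying \<open>f\<close> to a relation kills the \<open>I\<close> part, so the
  \<open>J\<close> coefficients vanish; what remains is a relation among the
  \<open>e i\<close>.\<close>

lemma indep_family_lift:
  assumes "indep_family G I e" "\<And>i. i \<in> I \<Longrightarrow> f (e i) = \<one>\<^bsub>H\<^esub>"
    and "indep_family H J (f \<circ> l)" "l \<in> J \<rightarrow> carrier G"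
  shows "indep_family G (I <+> J) (case_sum e l)"
  unfolding indep_family_def
proof (intro conjI allI impI)
  have I: "finite I" and e: "e \<in> I \<rightarrow> carrier G" and J: "finite J"
    using assms by (auto simp: indep_family_def)
  then show "finite (I <+> J)" "case_sum e l \<in> I <+> J \<rightarrow> carrier G"
    using assms(4) by auto
  fix c assume "lincomb G (I <+> J) (case_sum e l) c = \<one>"
  then have eq: "lincomb G I e (c \<circ> Inl) \<otimes> lincomb G J l (c \<circ> Inr) = \<one>"
    using I J e assms(4) by (simp add: G.lincomb_Plus)
  have "f (lincomb G I e (c \<circ> Inl)) = \<one>\<^bsub>H\<^esub>"
    using e assms(2) unfolding hom_lincomb[OF e] unfolding lincomb_def
    by (intro H.finprod_one_eqI) auto
  then have "lincomb H J (f \<circ> l) (c \<circ> Inr) = \<one>\<^bsub>H\<^esub>"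
    using arg_cong[OF eq, of f] e assms(4) by (simp add: hom_lincomb Pi_iff)
  then have r: "\<forall>j\<in>J. (c \<circ> Inr) j = 0"
    using assms(3) by (auto simp: indep_family_def)
  then have "lincomb G J l (c \<circ> Inr) = \<one>"
    unfolding lincomb_def by (intro G.finprod_one_eqI) auto
  then have "lincomb G I e (c \<circ> Inl) = \<one>" using eq e by simp
  then have "\<forall>i\<in>I. (c \<circ> Inl) i = 0"
    using assms(1) unfolding indep_family_def by blast
  with r show "\<forall>i\<in>I <+> J. c i = 0" by auto
qed

text \<open>Lower half of rank-nullity: preimages of \<open>C\<close> are added to \<open>A\<close>.
  The sum type keeps the two kinds of index apart, and injectivity of independent families turns the
  result back into a set.\<close>

lemma rank_lower:
  assumes "A \<subseteq> kernel G H f" "int_independent G A" "C \<subseteq> f ` carrier G" "int_independent H C"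
  shows "\<exists>B. int_independent G B \<and> card B = card A + card C"
proof -
  define l where "l = inv_into (carrier G) f"
  have l: "l c \<in> carrier G" "f (l c) = c" if "c \<in> C" for c
    using that assms(3) by (auto simp: l_def inv_into_into f_inv_into_f)
  have "indep_family G (A <+> C) (case_sum id l)"
  proof (rule indep_family_lift)
    have "lincomb H C (f \<circ> l) c = lincomb H C id c" for c
      using l assms(4) unfolding lincomb_def int_independent_def
      by (intro H.finprod_cong') auto
    then show "indep_family H C (f \<circ> l)"
      using assms(4) l by (auto simp: int_independent_iff_indep_family indep_family_def)
  qed (use assms l in \<open>auto simp: int_independent_iff_indep_family kernel_def\<close>)
  from G.indep_family_image[OF this]
  have "int_independent G (case_sum id l ` (A <+> C))"
    "card (case_sum id l ` (A <+> C)) = card A + card C"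
    using assms by (auto simp: card_Plus int_independent_def)
  then show ?thesis by blast
qed

text \<open>
  Choose \<open>B' \<subseteq> B\<close> maximal with independent image. Every remaining \<open>b \<in> B\<close> then has a nontrivial
  relation with \<open>B'\<close> modulo the kernel, and the resulting kernel elements are independent.
\<close>

lemma rank_upper:
  assumes B: "int_independent G B"
  shows "\<exists>A C. A \<subseteq> kernel G H f \<and> int_independent G A \<and> C \<subseteq> f ` carrier G \<and>
    int_independent H C \<and> card B = card A + card C"
proof -
  have finB: "finite B" and BG: "B \<subseteq> carrier G"
    using B by (auto simp: int_independent_def)
  define P where "P M \<longleftrightarrow> M \<subseteq> B \<and> indep_family H M f" for M
  have "P {}" by (auto simp: P_def indep_family_def)
  moreover have "\<And>M. P M \<Longrightarrow> card M \<le> card B" using finB by (auto simp: P_def card_mono)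
  ultimately obtain M where M: "P M" and Mmax: "\<And>M'. P M' \<Longrightarrow> card M' \<le> card M"
    using ex_has_greatest_nat[of P "{}" card "Suc (card B)"] by (metis le_imp_less_Suc)
  have MB: "M \<subseteq> B" and Mi: "indep_family H M f" and finM: "finite M"
    using M by (auto simp: P_def indep_family_def)
  have "\<exists>c. c b \<noteq> 0 \<and> (\<forall>x\<in>B - insert b M. c x = 0) \<and> f (lincomb G B id c) = \<one>\<^bsub>H\<^esub>"
    if b: "b \<in> B - M" for b
  proof -
    have "\<not> P (insert b M)"
    proof
      assume "P (insert b M)"
      from Mmax[OF this] show False using b finM by simp
    qed
    then obtain c i where c: "lincomb H (insert b M) f c = \<one>\<^bsub>H\<^esub>" "i \<in> insert b M" "c i \<noteq> 0"
      using b finM MB BG by (auto simp: P_def indep_family_def Pi_iff)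
    have fc: "f \<in> insert b M \<rightarrow> carrier H" "id \<in> B \<rightarrow> carrier G" using b MB BG by auto
    \<comment> \<open>Otherwise the relation would involve only \<open>M\<close>, whose image is
      independent.\<close>
    have "c b \<noteq> 0"
    proof
      assume "c b = 0"
      then have "lincomb H (insert b M) f c = lincomb H M f c"
        using finM fc by (intro H.lincomb_mono_neutral) auto
      then have "\<forall>i\<in>M. c i = 0" using c Mi by (auto simp: indep_family_def)
      with c \<open>c b = 0\<close> show False by auto
    qed
    \<comment> \<open>Extension by 0 makes the relation a combination over all of \<open>B\<close>,
      where the independence of \<open>B\<close> can be applied.\<close>
    define d where "d x = (if x \<in> insert b M then c x else 0)" for x
    have "f (lincomb G B id d) = lincomb H B f d"
      using hom_lincomb[OF fc(2), of d] by simp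
    also have "\<dots> = lincomb H (insert b M) f d"
      using finB b MB BG by (intro H.lincomb_mono_neutral) (auto simp: d_def)
    also have "\<dots> = lincomb H (insert b M) f c"
      unfolding lincomb_def using fc by (intro H.finprod_cong') (auto simp: d_def)
    finally show ?thesis
      using c \<open>c b \<noteq> 0\<close> by (intro exI[of _ d]) (auto simp: d_def)
  qed
  then obtain C where C: "\<And>b. b \<in> B - M \<Longrightarrow> C b b \<noteq> 0"
      "\<And>b x. b \<in> B - M \<Longrightarrow> x \<in> B - insert b M \<Longrightarrow> C b x = 0"
      "\<And>b. b \<in> B - M \<Longrightarrow> f (lincomb G B id (C b)) = \<one>\<^bsub>H\<^esub>"
    by metis
  have idB: "id \<in> B \<rightarrow> carrier G" using BG by auto
  have "indep_family G (B - M) (\<lambda>b. lincomb G B id (C b))"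
    unfolding indep_family_def
  proof (intro conjI allI impI ballI)
    fix m b
    assume "lincomb G (B - M) (\<lambda>b. lincomb G B id (C b)) m = \<one>" and b: "b \<in> B - M"
    then have "lincomb G B id (\<lambda>x. \<Sum>b\<in>B - M. C b x * m b) = \<one>"
      using finB idB by (simp add: G.lincomb_lincomb)
    then have "(\<Sum>a\<in>B - M. C a b * m a) = 0"
      using B b by (auto simp: int_independent_iff_indep_family indep_family_def)
    \<comment> \<open>Restricted to \<open>B - M\<close>, the coefficients \<open>C a\<close> are
      supported at \<open>a\<close> alone: the matrix is diagonal there, with nonzero
      entries.\<close>
    moreover have "(\<Sum>a\<in>B - M. C a b * m a) = (\<Sum>a\<in>{b}. C a b * m a)"
      using finB b C(2) by (intro sum.mono_neutral_right) auto
    ultimately show "m b = 0" using C(1)[OF b] by simp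
  qed (use finB idB in auto)
  note * = G.indep_family_image[OF this]
  note ** = H.indep_family_image[OF Mi]
  show ?thesis
  proof (intro exI conjI)
    show "(\<lambda>b. lincomb G B id (C b)) ` (B - M) \<subseteq> kernel G H f"
      using C(3) idB by (auto simp: kernel_def)
    show "f ` M \<subseteq> f ` carrier G" using MB BG by auto
    show "card B = card ((\<lambda>b. lincomb G B id (C b)) ` (B - M)) + card (f ` M)"
      using * ** finM MB finB by (simp add: card_Diff_subset card_mono)
  qed (use * ** in auto)
qed

lemma rank_nullity:
  assumes "rank_on G (kernel G H f) k" "rank_on H (f ` carrier G) i"
  shows "rank_on G (carrier G) (k + i)"
  unfolding rank_on_def
proof (intro conjI allI impI)
  obtain A C where "A \<subseteq> kernel G H f" "int_independent G A" "card A = k"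
    "C \<subseteq> f ` carrier G" "int_independent H C" "card C = i"
    using assms by (auto simp: rank_on_def)
  with rank_lower[of A C] show "\<exists>B\<subseteq>carrier G. int_independent G B \<and> card B = k + i"
    by (metis int_independent_def)
next
  fix B assume "int_independent G B"
  from rank_upper[OF this] assms show "card B \<le> k + i"
    unfolding rank_on_def by (metis add_mono)
qed

text \<open>Finiteness passes from \<open>G\<close> to kernel and image: independent subsets of the
  image lift to \<open>G\<close>, so the rank of \<open>G\<close> bounds them.\<close>

lemma rank_nullity_ex:
  assumes "rank_on G (carrier G) r"
  shows "\<exists>k i. rank_on G (kernel G H f) k \<and> rank_on H (f ` carrier G) i \<and> r = k + i"
proof -
  have "\<exists>i\<le>r. rank_on H (f ` carrier G) i"
  proof (rule H.rank_on_exists_of_bounded)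
    fix C assume "C \<subseteq> f ` carrier G" "int_independent H C"
    from rank_lower[OF _ _ this, of "{}"] obtain B where "int_independent G B" "card B = card C"
      by (auto simp: int_independent_def)
    then show "card C \<le> r" using assms by (metis rank_on_def int_independent_def)
  qed
  moreover have "\<exists>k\<le>r. rank_on G (kernel G H f) k"
    using assms by (intro rank_on_subset[OF G.comm_group_axioms]) (auto simp: kernel_def)
  ultimately show ?thesis
    using rank_nullity G.rank_on_unique[OF assms] by blast
qed

end

lemma has_rank_iso:
  assumes "comm_group G" "comm_group H" "f \<in> iso G H" "has_rank G r"
  shows "has_rank H r"
proof -
  interpret comm_group_hom G H f
    using assms by (auto simp: comm_group_hom_def comm_group_hom_axioms_def iso_def)
  have "kernel G H f = {\<one>\<^bsub>G\<^esub>}" "f ` carrier G = carrier H"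
    using assms(3) by (auto simp: iso_def bij_betw_def iso_iff inj_iff_trivial_ker)
  with rank_nullity_ex[of r] assms(4) rank_on_singleton_one[OF assms(1)] show ?thesis
    by (metis G.rank_on_unique add_0 has_rank_iff_rank_on)
qed

section \<open>Long exact sequences and excision\<close>

definition graded_euler :: "(nat \<Rightarrow> ('a, 'm) monoid_scheme) \<Rightarrow> int \<Rightarrow> bool" where
  "graded_euler G c \<longleftrightarrow>
     (\<exists>b :: nat \<Rightarrow> nat. (\<forall>p. has_rank (G p) (b p)) \<and>
        finite {p. b p \<noteq> 0} \<and> c = (\<Sum>p | b p \<noteq> 0. (- 1) ^ p * int (b p)))"

text \<open>An initial segment replaces the support of the ranks, so that several sequences of ranks
  can be summed over a common range.\<close>

lemma graded_eulerI:
  assumes "\<And>p. has_rank (G p) (b p)" "\<And>p. p \<ge> N \<Longrightarrow> b p = 0"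
  shows "graded_euler G (\<Sum>p<N. (- 1) ^ p * int (b p))"
proof -
  have sub: "{p. b p \<noteq> 0} \<subseteq> {..<N}"
    using assms(2) linorder_not_less by blast
  have "(\<Sum>p | b p \<noteq> 0. (- 1) ^ p * int (b p)) = (\<Sum>p<N. (- 1) ^ p * int (b p))"
    using sub by (intro sum.mono_neutral_left) auto
  then show ?thesis
    unfolding graded_euler_def using assms(1) sub finite_subset[OF sub] by (intro exI[of _ b]) auto
qed

lemma graded_eulerE:
  assumes "graded_euler G c"
  obtains b N where "\<And>p. has_rank (G p) (b p)" "\<And>p. p \<ge> N \<Longrightarrow> b p = 0"
    "c = (\<Sum>p<N. (- 1) ^ p * int (b p))"
proof -
  from assms obtain b where b: "\<And>p. has_rank (G p) (b p)" "finite {p. b p \<noteq> 0}"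
    "c = (\<Sum>p | b p \<noteq> 0. (- 1) ^ p * int (b p))"
    by (auto simp: graded_euler_def)
  from b(2) obtain N where N: "{p. b p \<noteq> 0} \<subseteq> {..<N}"
    using finite_nat_iff_bounded by blast
  have "c = (\<Sum>p<N. (- 1) ^ p * int (b p))"
    unfolding b(3) using N by (intro sum.mono_neutral_left) auto
  moreover have "\<And>p. p \<ge> N \<Longrightarrow> b p = 0" using N by (auto simp: subset_iff not_less[symmetric])
  ultimately show ?thesis using b(1) that by blast
qed

lemma graded_euler_unique:
  assumes "\<And>p. comm_group (G p)" "graded_euler G c" "graded_euler G d"
  shows "c = d"
proof -
  obtain b b' where b: "\<And>p. has_rank (G p) (b p)" "c = (\<Sum>p | b p \<noteq> 0. (- 1) ^ p * int (b p))"
    and b': "\<And>p. has_rank (G p) (b' p)" "d = (\<Sum>p | b' p \<noteq> 0. (- 1) ^ p * int (b' p))"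
    using assms by (auto simp: graded_euler_def)
  have "b = b'"
    using comm_group.rank_on_unique[OF assms(1)] b b' by (fastforce simp: has_rank_iff_rank_on)
  with b b' show ?thesis by simp
qed

lemma graded_euler_iso:
  assumes "\<And>p. comm_group (G p)" "\<And>p. comm_group (H p)" "\<And>p. f p \<in> iso (G p) (H p)"
    and "graded_euler G c"
  shows "graded_euler H c"
  using assms(4) has_rank_iso[OF assms(1-3)] unfolding graded_euler_def by blast

text \<open>Degrees are natural numbers; \<open>exact_0\<close> stands for the zero group in degree
  -1.\<close>

locale long_exact_sequence =
  fixes A X R :: "nat \<Rightarrow> 'g monoid" and i j d
  assumes comm: "\<And>p. comm_group (A p)" "\<And>p. comm_group (X p)" "\<And>p. comm_group (R p)"
    and hom: "\<And>p. i p \<in> hom (A p) (X p)" "\<And>p. j p \<in> hom (X p) (R p)"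
      "\<And>p. d p \<in> hom (R (Suc p)) (A p)"
    and exact_A: "\<And>p. kernel (A p) (X p) (i p) = d p ` carrier (R (Suc p))"
    and exact_X: "\<And>p. kernel (X p) (R p) (j p) = i p ` carrier (A p)"
    and exact_R: "\<And>p. kernel (R (Suc p)) (A p) (d p) = j (Suc p) ` carrier (X (Suc p))"
    and exact_0: "j 0 ` carrier (X 0) = carrier (R 0)"
begin

lemma connecting_homs: "comm_group_hom (A p) (X p) (i p)" "comm_group_hom (X p) (R p) (j p)"
  "comm_group_hom (R (Suc p)) (A p) (d p)"
  using comm hom by (auto simp: comm_group_hom_def comm_group_hom_axioms_def)

definition im_ranks :: "(nat \<Rightarrow> nat) \<Rightarrow> (nat \<Rightarrow> nat) \<Rightarrow> (nat \<Rightarrow> nat) \<Rightarrow> bool" where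
  "im_ranks dd ii jj \<longleftrightarrow> (\<forall>p. rank_on (A p) (d p ` carrier (R (Suc p))) (dd p) \<and>
     rank_on (X p) (i p ` carrier (A p)) (ii p) \<and> rank_on (R p) (j p ` carrier (X p)) (jj p))"

text \<open>By rank-nullity each image rank occurs in two neighbouring groups, so the alternating
  sums telescope. The values \<open>a\<close> and \<open>r\<close> are existential because the
  callers identify them by uniqueness.\<close>

lemma euler_sum:
  assumes "im_ranks dd ii jj" "\<forall>p\<ge>N. dd p = 0 \<and> ii p = 0 \<and> jj p = 0"
  shows "\<exists>a r. graded_euler A a \<and> graded_euler R r \<and> graded_euler X (a + r)"
proof -
  define r where "r p = jj p + (case p of 0 \<Rightarrow> 0 | Suc q \<Rightarrow> dd q)" for p
  have A: "has_rank (A p) (dd p + ii p)" for p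
    using comm_group_hom.rank_nullity[OF connecting_homs(1), of p] assms(1)
    by (simp add: has_rank_iff_rank_on exact_A im_ranks_def)
  have X: "has_rank (X p) (ii p + jj p)" for p
    using comm_group_hom.rank_nullity[OF connecting_homs(2), of p] assms(1)
    by (simp add: has_rank_iff_rank_on exact_X im_ranks_def)
  have R: "has_rank (R p) (r p)" for p
  proof (cases p)
    case 0
    then show ?thesis using assms(1)
      by (auto simp: has_rank_iff_rank_on im_ranks_def r_def simp flip: exact_0)
  next
    case (Suc q)
    then show ?thesis using comm_group_hom.rank_nullity[OF connecting_homs(3), of q] assms(1)
      by (simp add: has_rank_iff_rank_on exact_R im_ranks_def r_def)
  qed
  \<comment> \<open>Cutting off at degree \<open>n\<close> leaves the image of \<open>d n\<close>,
    counted in \<open>A n\<close> but not yet in \<open>R (Suc n)\<close>.\<close>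
  have tele: "(\<Sum>p<Suc n. (-1) ^ p * int (ii p + jj p)) =
      (\<Sum>p<Suc n. (-1) ^ p * int (dd p + ii p)) + (\<Sum>p<Suc n. (-1) ^ p * int (r p))
      - (-1) ^ n * int (dd n)" for n
    by (induction n) (simp_all add: r_def algebra_simps)
  have z: "\<And>p. p \<ge> Suc N \<Longrightarrow> r p = 0"
    using assms(2) by (auto simp: r_def split: nat.split)
  have e: "(\<Sum>p<Suc N. (-1) ^ p * int (ii p + jj p)) =
      (\<Sum>p<Suc N. (-1) ^ p * int (dd p + ii p)) + (\<Sum>p<Suc N. (-1) ^ p * int (r p))"
    using tele[of N] assms(2) by simp
  have "graded_euler A (\<Sum>p<Suc N. (-1) ^ p * int (dd p + ii p))"
    using A assms(2) by (intro graded_eulerI) auto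
  moreover have "graded_euler R (\<Sum>p<Suc N. (-1) ^ p * int (r p))"
    using R z by (intro graded_eulerI) auto
  moreover have "graded_euler X (\<Sum>p<Suc N. (-1) ^ p * int (ii p + jj p))"
    using X assms(2) by (intro graded_eulerI) auto
  ultimately show ?thesis unfolding e by blast
qed

lemma ranks_A:
  assumes "\<And>p. has_rank (A p) (a p)"
  shows "\<exists>dd ii. \<forall>p. rank_on (A p) (d p ` carrier (R (Suc p))) (dd p) \<and>
    rank_on (X p) (i p ` carrier (A p)) (ii p) \<and> a p = dd p + ii p"
proof -
  have "\<exists>dd ii. rank_on (A p) (d p ` carrier (R (Suc p))) dd \<and>
    rank_on (X p) (i p ` carrier (A p)) ii \<and> a p = dd + ii" for p
    using comm_group_hom.rank_nullity_ex[OF connecting_homs(1)] assms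
    by (simp add: has_rank_iff_rank_on exact_A)
  then show ?thesis by metis
qed

lemma ranks_X:
  assumes "\<And>p. has_rank (X p) (x p)"
  shows "\<exists>ii jj. \<forall>p. rank_on (X p) (i p ` carrier (A p)) (ii p) \<and>
    rank_on (R p) (j p ` carrier (X p)) (jj p) \<and> x p = ii p + jj p"
proof -
  have "\<exists>ii jj. rank_on (X p) (i p ` carrier (A p)) ii \<and>
    rank_on (R p) (j p ` carrier (X p)) jj \<and> x p = ii + jj" for p
    using comm_group_hom.rank_nullity_ex[OF connecting_homs(2)] assms
    by (simp add: has_rank_iff_rank_on exact_X)
  then show ?thesis by metis
qed

lemma ranks_R:
  assumes "\<And>p. has_rank (R p) (r p)"
  shows "\<exists>jj dd. \<forall>p. rank_on (R p) (j p ` carrier (X p)) (jj p) \<and>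
    rank_on (A p) (d p ` carrier (R (Suc p))) (dd p) \<and> r (Suc p) = jj (Suc p) + dd p"
proof -
  have "\<exists>jj dd. rank_on (R (Suc p)) (j (Suc p) ` carrier (X (Suc p))) jj \<and>
    rank_on (A p) (d p ` carrier (R (Suc p))) dd \<and> r (Suc p) = jj + dd" for p
    using comm_group_hom.rank_nullity_ex[OF connecting_homs(3)] assms
    by (simp add: has_rank_iff_rank_on exact_R)
  then obtain jj dd where *: "\<And>p. rank_on (R (Suc p)) (j (Suc p) ` carrier (X (Suc p))) (jj p) \<and>
    rank_on (A p) (d p ` carrier (R (Suc p))) (dd p) \<and> r (Suc p) = jj p + dd p" by metis
  \<comment> \<open>In degree 0 the image of \<open>j\<close> is all of \<open>R 0\<close>, of rank
    \<open>r 0\<close>; the positive degrees come from the choice above.\<close>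
  have "rank_on (R p) (j p ` carrier (X p)) (case p of 0 \<Rightarrow> r 0 | Suc q \<Rightarrow> jj q)" for p
    using * assms[of 0] by (cases p) (auto simp: has_rank_iff_rank_on exact_0)
  with * show ?thesis
    by (intro exI[of _ "\<lambda>p. case p of 0 \<Rightarrow> r 0 | Suc q \<Rightarrow> jj q"] exI[of _ dd]) auto
qed

text \<open>Two terms determine the third, finiteness included: \<open>A\<close> bounds the images
  of \<open>d\<close> and \<open>i\<close>, and \<open>X\<close> bounds that of
  \<open>j\<close>.\<close>

lemma euler_R:
  assumes "graded_euler A a" "graded_euler X x"
  shows "graded_euler R (x - a)"
proof -
  obtain ra N where ra: "\<And>p. has_rank (A p) (ra p)" "\<And>p. p \<ge> N \<Longrightarrow> ra p = 0"
    using assms(1) by (elim graded_eulerE) blast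
  obtain rx M where rx: "\<And>p. has_rank (X p) (rx p)" "\<And>p. p \<ge> M \<Longrightarrow> rx p = 0"
    using assms(2) by (elim graded_eulerE) blast
  obtain dd ii where 1: "\<And>p. rank_on (A p) (d p ` carrier (R (Suc p))) (dd p)"
    "\<And>p. rank_on (X p) (i p ` carrier (A p)) (ii p)" "\<And>p. ra p = dd p + ii p"
    using ranks_A[of ra, OF ra(1)] by auto
  obtain jj ii' where 2: "\<And>p. rank_on (R p) (j p ` carrier (X p)) (jj p)"
    "\<And>p. rx p = ii' p + jj p"
    using ranks_X[of rx, OF rx(1)] by auto
  have "dd p = 0 \<and> ii p = 0 \<and> jj p = 0" if "p \<ge> max N M" for p
    using that ra(2)[of p] rx(2)[of p] 1(3)[of p] 2(2)[of p] by auto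
  then obtain a' r where "graded_euler A a'" "graded_euler R r" "graded_euler X (a' + r)"
    using euler_sum[of dd ii jj "max N M"] 1 2 by (auto simp: im_ranks_def)
  with graded_euler_unique[OF comm(1) assms(1)] graded_euler_unique[OF comm(2) assms(2)]
  show ?thesis by fastforce
qed

lemma euler_X:
  assumes "graded_euler A a" "graded_euler R r"
  shows "graded_euler X (a + r)"
proof -
  obtain ra N where ra: "\<And>p. has_rank (A p) (ra p)" "\<And>p. p \<ge> N \<Longrightarrow> ra p = 0"
    using assms(1) by (elim graded_eulerE) blast
  obtain rr M where rr: "\<And>p. has_rank (R p) (rr p)" "\<And>p. p \<ge> M \<Longrightarrow> rr p = 0"
    using assms(2) by (elim graded_eulerE) blast
  obtain dd ii where 1: "\<And>p. rank_on (A p) (d p ` carrier (R (Suc p))) (dd p)"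
    "\<And>p. rank_on (X p) (i p ` carrier (A p)) (ii p)" "\<And>p. ra p = dd p + ii p"
    using ranks_A[of ra, OF ra(1)] by auto
  obtain jj dd' where 2: "\<And>p. rank_on (R p) (j p ` carrier (X p)) (jj p)"
    "\<And>p. rr (Suc p) = jj (Suc p) + dd' p"
    using ranks_R[of rr, OF rr(1)] by auto
  \<comment> \<open>\<open>Suc M\<close> makes \<open>p\<close> positive: \<open>2(2)\<close> splits
    the rank of \<open>R\<close> only in degrees of the form \<open>Suc q\<close>.\<close>
  have "dd p = 0 \<and> ii p = 0 \<and> jj p = 0" if "p \<ge> max N (Suc M)" for p
    using that ra(2)[of p] rr(2)[of p] 1(3)[of p] 2(2)[of "p - 1"] by auto
  then obtain a' r' where "graded_euler A a'" "graded_euler R r'" "graded_euler X (a' + r')"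
    using euler_sum[of dd ii jj "max N (Suc M)"] 1 2 by (auto simp: im_ranks_def)
  with graded_euler_unique[OF comm(1) assms(1)] graded_euler_unique[OF comm(3) assms(2)]
  show ?thesis by fastforce
qed

lemma euler_A:
  assumes "graded_euler X x" "graded_euler R r"
  shows "graded_euler A (x - r)"
proof -
  obtain rx N where rx: "\<And>p. has_rank (X p) (rx p)" "\<And>p. p \<ge> N \<Longrightarrow> rx p = 0"
    using assms(1) by (elim graded_eulerE) blast
  obtain rr M where rr: "\<And>p. has_rank (R p) (rr p)" "\<And>p. p \<ge> M \<Longrightarrow> rr p = 0"
    using assms(2) by (elim graded_eulerE) blast
  obtain ii jj where 1: "\<And>p. rank_on (X p) (i p ` carrier (A p)) (ii p)"
    "\<And>p. rank_on (R p) (j p ` carrier (X p)) (jj p)" "\<And>p. rx p = ii p + jj p"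
    using ranks_X[of rx, OF rx(1)] by auto
  obtain jj' dd where 2: "\<And>p. rank_on (A p) (d p ` carrier (R (Suc p))) (dd p)"
    "\<And>p. rr (Suc p) = jj' (Suc p) + dd p"
    using ranks_R[of rr, OF rr(1)] by auto
  have "dd p = 0 \<and> ii p = 0 \<and> jj p = 0" if "p \<ge> max N M" for p
    using that rx(2)[of p] rr(2)[of "Suc p"] 1(3)[of p] 2(2)[of p] by auto
  then obtain a' r' where "graded_euler A a'" "graded_euler R r'" "graded_euler X (a' + r')"
    using euler_sum[of dd ii jj "max N M"] 1 2 by (auto simp: im_ranks_def)
  with graded_euler_unique[OF comm(2) assms(1)] graded_euler_unique[OF comm(3) assms(2)]
  show ?thesis by fastforce
qed

end

section \<open>Singular homology of pairs and open covers\<close>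

lemma has_euler_iff_graded:
  "has_euler_characteristic X = graded_euler (\<lambda>p. homology_group (int p) X)"
  by (intro ext) (simp add: has_euler_characteristic_def graded_euler_def)

lemma long_exact_sequence_pair:
  "long_exact_sequence (\<lambda>p. homology_group (int p) (subtopology X S))
     (\<lambda>p. homology_group (int p) X) (\<lambda>p. relative_homology_group (int p) X S)
     (\<lambda>p. hom_induced p (subtopology X S) {} X {} id) (\<lambda>p. hom_induced p X {} X S id)
     (\<lambda>p. hom_boundary (int (Suc p)) X S)"
proof (unfold long_exact_sequence_def, intro conjI allI)
  fix p :: nat
  show "comm_group (homology_group (int p) (subtopology X S))"
    "comm_group (homology_group (int p) X)" "comm_group (relative_homology_group (int p) X S)"
    by (simp_all)
  show "hom_induced p (subtopology X S) {} X {} id \<in>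
      hom (homology_group (int p) (subtopology X S)) (homology_group (int p) X)"
    "hom_induced p X {} X S id \<in>
      hom (homology_group (int p) X) (relative_homology_group (int p) X S)"
    by (rule hom_induced_hom)+
  show "hom_boundary (int (Suc p)) X S \<in>
      hom (relative_homology_group (int (Suc p)) X S) (homology_group (int p) (subtopology X S))"
    using hom_boundary_hom[of "int (Suc p)" X S] by simp
  show "kernel (homology_group (int p) (subtopology X S)) (homology_group (int p) X)
      (hom_induced p (subtopology X S) {} X {} id) =
      hom_boundary (int (Suc p)) X S ` carrier (relative_homology_group (int (Suc p)) X S)"
    using homology_exactness_axiom_2[of "int (Suc p)" X S] by simp
  show "kernel (homology_group (int p) X) (relative_homology_group (int p) X S)
      (hom_induced p X {} X S id) =
      hom_induced p (subtopology X S) {} X {} id ` carrier (homology_group (int p) (subtopology X S))"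
    using homology_exactness_axiom_3[of "int p" X S] by simp
  show "kernel (relative_homology_group (int (Suc p)) X S) (homology_group (int p) (subtopology X S))
      (hom_boundary (int (Suc p)) X S) =
      hom_induced (int (Suc p)) X {} X S id ` carrier (homology_group (int (Suc p)) X)"
    using homology_exactness_axiom_1[of "int (Suc p)" X S] by simp
next
  \<comment> \<open>Homology in degree -1 is trivial, so the boundary map out of degree 0 is zero
    and its kernel is everything.\<close>
  have "kernel (relative_homology_group 0 X S) (homology_group (-1) (subtopology X S)) (hom_boundary 0 X S) =
    hom_induced 0 X {} X S id ` carrier (homology_group 0 X)"
    using homology_exactness_axiom_1[of 0 X S] by simp
  moreover have "kernel (relative_homology_group 0 X S) (homology_group (-1) (subtopology X S)) (hom_boundary 0 X S)
     = carrier (relative_homology_group 0 X S)"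
    using hom_boundary_hom[of 0 X S] by (fastforce simp: kernel_def hom_def Pi_iff singleton_group_def relative_homology_group_def)
  ultimately show "hom_induced (int 0) X {} X S id ` carrier (homology_group (int 0) X)
    = carrier (relative_homology_group (int 0) X S)" by simp
qed

definition relative_euler :: "'a topology \<Rightarrow> 'a set \<Rightarrow> int \<Rightarrow> bool" where
  "relative_euler X S = graded_euler (\<lambda>p. relative_homology_group (int p) X S)"

lemma relative_eulerI:
  assumes "has_euler_characteristic (subtopology X S) a" "has_euler_characteristic X x"
  shows "relative_euler X S (x - a)"
  using assms long_exact_sequence.euler_R[OF long_exact_sequence_pair]
  unfolding relative_euler_def has_euler_iff_graded by blast

lemma euler_of_relative:
  assumes "has_euler_characteristic (subtopology X S) a" "relative_euler X S r"
  shows "has_euler_characteristic X (a + r)"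
  using assms long_exact_sequence.euler_X[OF long_exact_sequence_pair]
  unfolding relative_euler_def has_euler_iff_graded by blast

lemma euler_subspace_of_relative:
  assumes "has_euler_characteristic X x" "relative_euler X S r"
  shows "has_euler_characteristic (subtopology X S) (x - r)"
  using assms long_exact_sequence.euler_A[OF long_exact_sequence_pair]
  unfolding relative_euler_def has_euler_iff_graded by blast

text \<open>The complement of \<open>V\<close> is excised. It is closed and, as \<open>U\<close> and
  \<open>V\<close> cover the space, lies in the open set \<open>U\<close>; this is the closure
  condition of excision.\<close>

lemma relative_euler_excision:
  assumes "openin X U" "openin X V" "U \<union> V = topspace X"
    and "relative_euler (subtopology X V) (U \<inter> V) r"
  shows "relative_euler X U r"
proof -
  let ?Z = "topspace X - V"
  have sub: "V \<subseteq> topspace X" "U \<subseteq> topspace X" using assms(1,2) openin_subset by auto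
  have "closedin X ?Z" using assms(2) by blast
  then have "X closure_of ?Z \<subseteq> X interior_of U"
    using assms by (auto simp: closure_of_closedin interior_of_openin)
  then have iso: "hom_induced p (subtopology X (topspace X - ?Z)) (U - ?Z) (subtopology X (topspace X)) U id
    \<in> iso (relative_homology_group p (subtopology X (topspace X - ?Z)) (U - ?Z))
          (relative_homology_group p (subtopology X (topspace X)) U)" for p
    by (rule homology_excision_axiom[OF _ sub(2)])
  have eq: "topspace X - ?Z = V" "U - ?Z = U \<inter> V" using sub by auto
  show ?thesis
    using graded_euler_iso[OF _ _ iso, of int r] assms(4)
    by (simp add: relative_euler_def eq)
qed

text \<open>Excision turns the two pairs \<open>(X, U)\<close> and \<open>(V, U \<inter> V)\<close> into one relative term.\<close>

theorem euler_union:
  assumes "openin X U" "openin X V" "U \<union> V = topspace X"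
    and "has_euler_characteristic (subtopology X U) u"
    and "has_euler_characteristic (subtopology X V) v"
    and "has_euler_characteristic (subtopology X (U \<inter> V)) w"
  shows "has_euler_characteristic X (u + v - w)"
proof -
  have "has_euler_characteristic (subtopology (subtopology X V) (U \<inter> V)) w"
    using assms(6) by (simp add: subtopology_subtopology Int_commute Int_left_commute)
  from relative_eulerI[OF this assms(5)] relative_euler_excision[OF assms(1-3)]
  have "relative_euler X U (v - w)" by blast
  from euler_of_relative[OF assms(4) this] show ?thesis by (simp add: algebra_simps)
qed

text \<open>The same relative term, now solved for the open set \<open>U\<close> instead of the
  whole space. This is how a closed subset is removed.\<close>

theorem euler_cover_piece:
  assumes "openin X U" "openin X V" "U \<union> V = topspace X"
    and "has_euler_characteristic X x"
    and "has_euler_characteristic (subtopology X V) v"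
    and "has_euler_characteristic (subtopology X (U \<inter> V)) w"
  shows "has_euler_characteristic (subtopology X U) (x + w - v)"
proof -
  have "has_euler_characteristic (subtopology (subtopology X V) (U \<inter> V)) w"
    using assms(6) by (simp add: subtopology_subtopology Int_commute Int_left_commute)
  from relative_eulerI[OF this assms(5)] relative_euler_excision[OF assms(1-3)]
  have "relative_euler X U (v - w)" by blast
  from euler_subspace_of_relative[OF assms(4) this] show ?thesis by (simp add: algebra_simps)
qed

lemma has_euler_homotopy_equivalent:
  assumes "X homotopy_equivalent_space Y" "has_euler_characteristic X c"
  shows "has_euler_characteristic Y c"
proof -
  have "\<exists>f. f \<in> iso (homology_group (int p) X) (homology_group (int p) Y)" for p
    using homotopy_equivalent_space_imp_isomorphic_homology_groups[OF assms(1), of "int p"]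
    by (auto simp: is_iso_def)
  then obtain f where "\<And>p. f p \<in> iso (homology_group (int p) X) (homology_group (int p) Y)"
    by metis
  then show ?thesis
    using graded_euler_iso[of _ _ f] assms(2) unfolding has_euler_iff_graded
    by (smt (verit) abelian_homology_group)
qed

section \<open>Euler characteristics of sets\<close>

abbreviation euler :: "'a::topological_space set \<Rightarrow> int \<Rightarrow> bool" where
  "euler S c \<equiv> has_euler_characteristic (top_of_set S) c"

lemma euler_homeomorphism:
  assumes "homeomorphism S T f g" "euler S c"
  shows "euler T c"
proof -
  have "homeomorphic_maps (top_of_set S) (top_of_set T) f g"
    using assms(1) by (auto simp: homeomorphic_maps_def homeomorphism_def)
  then have "top_of_set S homeomorphic_space top_of_set T"
    by (auto simp: homeomorphic_space_def)
  then show ?thesis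
    using assms(2) has_euler_homotopy_equivalent homeomorphic_imp_homotopy_equivalent_space by blast
qed

lemma euler_homeomorphism_iff:
  "homeomorphism S T f g \<Longrightarrow> euler S c \<longleftrightarrow> euler T c"
  using euler_homeomorphism homeomorphism_symD by metis

lemma euler_deformation_retract:
  assumes "T \<subseteq> S" and cont: "continuous_on ({0..1::real} \<times> S) (\<lambda>p. h (fst p) (snd p))"
    and "\<And>t x. t \<in> {0..1} \<Longrightarrow> x \<in> S \<Longrightarrow> h t x \<in> S"
    and "\<And>x. x \<in> S \<Longrightarrow> h 0 x = x" "\<And>x. x \<in> S \<Longrightarrow> h 1 x \<in> T" "\<And>x. x \<in> T \<Longrightarrow> h 1 x = x"
  shows "euler S c \<longleftrightarrow> euler T c"
proof -
  have "continuous_on S (\<lambda>x. h (fst (1::real, x)) (snd (1::real, x)))"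
    by (rule continuous_on_compose2[OF cont]) (auto intro!: continuous_intros)
  then have r: "continuous_on S (h 1)" by simp
  have "homotopic_with (\<lambda>x. True) (top_of_set S) (top_of_set S) id (h 1)"
    using cont assms(3,4)
    by (subst homotopic_with) (auto intro!: exI[of _ "\<lambda>p. h (fst p) (snd p)"] simp: image_subset_iff)
  moreover have "retraction_maps (top_of_set S) (top_of_set T) (h 1) id"
    using r assms by (auto simp: retraction_maps_def)
  ultimately have "top_of_set S homotopy_equivalent_space top_of_set T"
    using deformation_retract_imp_homotopy_equivalent_space homotopic_with_sym by blast
  then show ?thesis
    using has_euler_homotopy_equivalent homotopy_equivalent_space_sym by blast
qed

lemma euler_Un_open:
  assumes "openin (top_of_set X) U" "openin (top_of_set X) V" "U \<union> V = X"
    and "euler U u" "euler V v" "euler (U \<inter> V) w"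
  shows "euler X (u + v - w)"
proof -
  have "subtopology (top_of_set X) U = top_of_set U" "subtopology (top_of_set X) V = top_of_set V"
    "subtopology (top_of_set X) (U \<inter> V) = top_of_set (U \<inter> V)"
    using assms(3) by (auto simp: subtopology_subtopology intro!: arg_cong[of _ _ top_of_set])
  then show ?thesis using euler_union[OF assms(1,2)] assms(3-) by simp
qed

lemma euler_open_piece:
  assumes "openin (top_of_set X) U" "openin (top_of_set X) V" "U \<union> V = X"
    and "euler X x" "euler V v" "euler (U \<inter> V) w"
  shows "euler U (x + w - v)"
proof -
  have "subtopology (top_of_set X) U = top_of_set U" "subtopology (top_of_set X) V = top_of_set V"
    "subtopology (top_of_set X) (U \<inter> V) = top_of_set (U \<inter> V)"
    using assms(3) by (auto simp: subtopology_subtopology intro!: arg_cong[of _ _ top_of_set])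
  then show ?thesis using euler_cover_piece[OF assms(1,2)] assms(3-) by simp
qed

section \<open>Points, products with star-shaped sets, annuli\<close>

lemma has_rank_trivial_group:
  assumes "comm_group G" "trivial_group G"
  shows "has_rank G 0"
  using assms rank_on_singleton_one[OF assms(1)]
  by (simp add: has_rank_iff_rank_on trivial_group_def)

lemma has_rank_integer_group: "has_rank integer_group 1"
  unfolding has_rank_def
proof (intro conjI allI impI)
  interpret comm_group integer_group by (rule abelian_integer_group)
  show "\<exists>B. int_independent integer_group B \<and> card B = 1"
    by (intro exI[of _ "{1::int}"]) (auto simp: int_independent_def)
  fix B assume B: "int_independent integer_group B"
  then have i: "indep_family integer_group B id" by (simp add: int_independent_iff_indep_family)
  have fin: "finite B" using B by (auto simp: int_independent_def)
  show "card B \<le> 1"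
  proof (rule ccontr)
    assume "\<not> card B \<le> 1"
    then obtain a b where ab: "a \<in> B" "b \<in> B" "a \<noteq> b"
      using fin by (metis One_nat_def card_le_Suc0_iff_eq)
    have idc: "id \<in> B \<rightarrow> carrier integer_group" by simp
    \<comment> \<open>The relation b a - a b = 0 has coefficients \<open>b\<close> and
      \<open>- a\<close>; independence makes both 0, so \<open>a\<close> and \<open>b\<close> would
      coincide.\<close>
    have "lincomb integer_group B id (\<lambda>x. (if x = a then b else 0) + (if x = b then - a else 0)) =
       id a [^]\<^bsub>integer_group\<^esub> b \<otimes>\<^bsub>integer_group\<^esub> id b [^]\<^bsub>integer_group\<^esub> (- a)"
      by (simp only: lincomb_add[OF idc] lincomb_single[OF fin _ idc] ab(1,2))
    then have "lincomb integer_group B id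
        (\<lambda>x. (if x = a then b else 0) + (if x = b then - a else 0)) = \<one>\<^bsub>integer_group\<^esub>"
      by (simp add: algebra_simps)
    from indep_familyD[OF i this ab(1)] indep_familyD[OF i this ab(2)] ab(3) show False
      by simp
  qed
qed

lemma euler_singleton: "euler {a} 1"
proof -
  let ?X = "top_of_set {a}"
  have "path_connected_space ?X" by (simp add: contractible_imp_path_connected_space)
  from isomorphic_integer_zeroth_homology_group[OF this] obtain f
    where f: "f \<in> iso (homology_group 0 ?X) integer_group" by (auto simp: is_iso_def)
  have "inv_into (carrier (homology_group 0 ?X)) f \<in> iso integer_group (homology_group 0 ?X)"
    by (intro group.iso_set_sym f) simp
  from has_rank_iso[OF abelian_integer_group abelian_homology_group this has_rank_integer_group]
  have 0: "has_rank (homology_group 0 ?X) 1" .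
  have 1: "has_rank (homology_group (int (Suc p)) ?X) 0" for p
    using homology_dimension_axiom[of ?X a "int (Suc p)"]
    by (intro has_rank_trivial_group) simp_all
  have "has_rank (homology_group (int p) ?X) (if p = 0 then 1 else 0)" for p
    using 0 1[of "p - 1"] by (cases p) auto
  with graded_eulerI[of "\<lambda>p. homology_group (int p) ?X" "\<lambda>p. if p = 0 then 1 else 0" 1]
  show ?thesis by (simp add: has_euler_iff_graded)
qed

lemma euler_empty: "euler {} 0"
proof -
  have "has_rank (homology_group (int p) (top_of_set {})) 0" for p
    using trivial_homology_group_empty[of "top_of_set {}" "int p"]
    by (intro has_rank_trivial_group) simp_all
  from graded_eulerI[OF this, of 0] show ?thesis
    by (simp add: has_euler_iff_graded)
qed

lemma euler_disjoint_open:
  assumes "openin (top_of_set X) U" "openin (top_of_set X) V" "U \<union> V = X" "U \<inter> V = {}"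
    and "euler U u" "euler V v"
  shows "euler X (u + v)"
  using euler_Un_open[OF assms(1-3,5,6), of 0] assms(4) euler_empty by simp

lemma euler_Times_singleton: "euler (S \<times> {a}) c \<longleftrightarrow> euler S c"
proof -
  have "homeomorphism (S \<times> {a}) S fst (\<lambda>x. (x, a))"
    by (intro homeomorphismI) (auto intro!: continuous_intros)
  then show ?thesis by (rule euler_homeomorphism_iff)
qed

lemma euler_singleton_Times: "euler ({a} \<times> S) c \<longleftrightarrow> euler S c"
proof -
  have "homeomorphism ({a} \<times> S) S snd (\<lambda>x. (a, x))"
    by (intro homeomorphismI) (auto intro!: continuous_intros)
  then show ?thesis by (rule euler_homeomorphism_iff)
qed

text \<open>The second factor is contracted linearly to \<open>a\<close>. Star-shaped sets are
  allowed because slit planes are not convex.\<close>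

lemma euler_Times_starlike:
  fixes K :: "'b::real_normed_vector set"
  assumes "a \<in> K" "\<And>x. x \<in> K \<Longrightarrow> closed_segment a x \<subseteq> K" "euler S c"
  shows "euler (S \<times> K) c"
proof -
  have "euler (S \<times> K) c \<longleftrightarrow> euler (S \<times> {a}) c"
  proof (rule euler_deformation_retract[where h = "\<lambda>t p. (fst p, (1 - t) *\<^sub>R snd p + t *\<^sub>R a)"])
    fix t :: real and p assume t: "t \<in> {0..1}" and p: "p \<in> S \<times> K"
    then have "(1 - t) *\<^sub>R snd p + t *\<^sub>R a \<in> closed_segment (snd p) a"
      by (auto simp: in_segment)
    moreover have "closed_segment (snd p) a \<subseteq> K"
      using assms(2)[of "snd p"] p by (simp add: closed_segment_commute[of "snd p" a] mem_Times_iff)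
    ultimately show "(fst p, (1 - t) *\<^sub>R snd p + t *\<^sub>R a) \<in> S \<times> K"
      using p by (auto simp: mem_Times_iff)
  qed (use assms(1) in \<open>auto intro!: continuous_intros\<close>)
  then show ?thesis using assms(3) euler_Times_singleton by blast
qed

lemma euler_Times_convex:
  fixes K :: "'b::real_normed_vector set"
  assumes "convex K" "K \<noteq> {}" "euler S c"
  shows "euler (S \<times> K) c"
proof -
  from assms(2) obtain a where "a \<in> K" by blast
  with assms(1,3) show ?thesis
    by (intro euler_Times_starlike[of a] closed_segment_subset)
qed

lemma euler_convex:
  fixes K :: "'b::real_normed_vector set"
  assumes "convex K" "K \<noteq> {}"
  shows "euler K 1"
  using euler_Times_convex[OF assms euler_singleton[of "0::real"]] euler_singleton_Times by blast

text \<open>The plane slit along the ray opposite to \<open>s\<close> is star-shaped about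
  \<open>s\<close>; the sign covers both slit planes at once.\<close>

lemma segment_avoids_ray:
  fixes v :: complex and s :: real
  assumes v: "v \<notin> {w. Im w = 0 \<and> s * Re w \<le> 0}" and s: "s = 1 \<or> s = -1"
    and x: "x \<in> closed_segment (of_real s) v"
  shows "x \<notin> {w. Im w = 0 \<and> s * Re w \<le> 0}"
proof
  from x obtain u where u: "0 \<le> u" "u \<le> 1" "x = (1 - u) *\<^sub>R of_real s + u *\<^sub>R v"
    by (auto simp: in_segment)
  assume "x \<in> {w. Im w = 0 \<and> s * Re w \<le> 0}"
  then have "u * Im v = 0" "s * ((1 - u) * s + u * Re v) \<le> 0" using u by auto
  moreover have "s * ((1 - u) * s + u * Re v) = (1 - u) + u * (s * Re v)"
    using s by (auto simp: algebra_simps)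
  ultimately have "u * Im v = 0" "(1 - u) + u * (s * Re v) \<le> 0" by auto
  moreover from this have "u \<noteq> 0" by auto
  ultimately have "Im v = 0" "u * (s * Re v) \<le> 0" using u by auto
  then show False using v \<open>u \<noteq> 0\<close> u by (auto simp: mult_le_0_iff)
qed

text \<open>Two slit planes cover the punctured plane and meet in two half planes, which gives c + c
  - (c + c). This is the vanishing characteristic of a circle factor.\<close>

lemma euler_Times_punctured_plane:
  assumes "euler S c"
  shows "euler (S \<times> (UNIV - {0::complex})) 0"
proof -
  define R where "R s = {w. Im w = 0 \<and> s * Re w \<le> 0}" for s :: real
  have cl: "closed (R s)" for s
    unfolding R_def Collect_conj_eq
    by (intro closed_Int closed_Collect_eq closed_Collect_le continuous_intros)
  have 0: "0 \<in> R s" for s by (simp add: R_def)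
  have oo: "openin (top_of_set (S \<times> U)) (S \<times> V)" if "open V" "V \<subseteq> U" for U V :: "complex set"
    using that by (intro openin_Times) (auto simp: openin_open)
  have e: "euler (S \<times> - R s) c" if "s = 1 \<or> s = -1" for s
    using that segment_avoids_ray[of _ s] assms
    by (intro euler_Times_starlike[of "of_real s"]) (auto simp: R_def)
  have "S \<times> - R 1 \<inter> S \<times> - R (-1) = S \<times> {w. Im w \<noteq> 0}"
    by (auto simp: R_def)
  moreover have "euler (S \<times> {w. Im w \<noteq> 0}) (c + c)"
  proof (rule euler_disjoint_open[of _ "S \<times> {w. Im w > 0}" "S \<times> {w. Im w < 0}"])
    have "\<i> \<in> {w. Im w > 0}" "- \<i> \<in> {w. Im w < 0}" by simp_all
    then show "euler (S \<times> {w. Im w > 0}) c" "euler (S \<times> {w. Im w < 0}) c"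
      using assms by (blast intro: euler_Times_convex convex_halfspace_Im_gt convex_halfspace_Im_lt)+
  qed (auto intro!: oo open_halfspace_Im_gt open_halfspace_Im_lt)
  ultimately have "euler (S \<times> - R 1 \<inter> S \<times> - R (-1)) (c + c)" by simp
  note int = this
  have un: "S \<times> - R 1 \<union> S \<times> - R (-1) = S \<times> (UNIV - {0})"
    by (auto simp: R_def complex_eq_iff)
  have "openin (top_of_set (S \<times> (UNIV - {0}))) (S \<times> - R s)" for s
    using 0 cl by (intro oo) auto
  from euler_Un_open[OF this this un e e int] show ?thesis by simp
qed

text \<open>Every such annulus retracts to the circle of radius \<open>r\<close>, and so does the
  punctured plane, where the value is known.\<close>

lemma euler_Times_annulus:
  assumes I: "I \<subseteq> {0<..}" "is_interval I" "I \<noteq> {}" and S: "euler S c"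
  shows "euler (S \<times> {v::complex. norm v \<in> I}) 0"
proof -
  obtain r where r: "r \<in> I" "r > 0" using I by auto
  have *: "euler (S \<times> {v::complex. norm v \<in> J}) e \<longleftrightarrow> euler (S \<times> {v::complex. norm v = r}) e"
    if J: "J \<subseteq> {0<..}" "is_interval J" "r \<in> J" for J e
  proof (rule euler_deformation_retract[where h =
      "\<lambda>t p. (fst p, ((1 - t) + t * r / norm (snd p)) *\<^sub>R snd p)"])
    fix t :: real and p :: "'a \<times> complex"
    assume t: "t \<in> {0..1}" and p: "p \<in> S \<times> {v::complex. norm v \<in> J}"
    then have pos: "norm (snd p) > 0" "norm (snd p) \<in> J" using J by auto
    \<comment> \<open>The homotopy moves the norm linearly from \<open>norm (snd p)\<close> to
      \<open>r\<close>, hence within the interval.\<close>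
    have "norm (((1 - t) + t * r / norm (snd p)) *\<^sub>R snd p) =
       \<bar>(1 - t) + t * r / norm (snd p)\<bar> * norm (snd p)"
      by (rule norm_scaleR)
    also have "\<dots> = ((1 - t) + t * r / norm (snd p)) * norm (snd p)"
      using t r pos by simp
    also have "\<dots> = (1 - t) *\<^sub>R norm (snd p) + t *\<^sub>R r"
      using pos by (simp add: field_simps)
    also have "\<dots> \<in> J"
      using J(2) t pos J(3) by (intro convexD_alt) (auto simp: is_interval_convex_1)
    finally show "(fst p, ((1 - t) + t * r / norm (snd p)) *\<^sub>R snd p) \<in> S \<times> {v. norm v \<in> J}"
      using p by auto
  next
    show "continuous_on ({0..1} \<times> S \<times> {v. norm v \<in> J})
      (\<lambda>p. (fst (snd p), ((1 - fst p) + fst p * r / norm (snd (snd p))) *\<^sub>R snd (snd p)))"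
      using J by (intro continuous_intros) auto
  next
    fix p assume "p \<in> S \<times> {v::complex. norm v \<in> J}"
    then have "fst p \<in> S" "norm (snd p) > 0" using J by auto
    then show "(fst p, ((1 - 1) + 1 * r / norm (snd p)) *\<^sub>R snd p) \<in> S \<times> {v. norm v = r}"
      using r by (simp add: norm_mult)
  qed (use J r in auto)
  have "{v::complex. norm v \<in> {0<..}} = UNIV - {0}" by auto
  with *[of "{0<..}" 0] *[OF I(1,2) r(1), of 0] euler_Times_punctured_plane[OF S] r
  show ?thesis by (simp add: is_interval_convex_1)
qed

lemma euler_annulus:
  assumes "I \<subseteq> {0<..}" "is_interval I" "I \<noteq> {}"
  shows "euler {v::complex. norm v \<in> I} 0"
  using euler_Times_annulus[OF assms euler_singleton[of "0::real"]] euler_singleton_Times by blast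

text \<open>
  A graph of complex codimension one has a product neighbourhood whose complement of the graph is
  a bundle of punctured discs, of Euler characteristic zero.
\<close>

lemma euler_remove_graph:
  fixes g :: "'a::metric_space \<Rightarrow> complex"
  assumes X: "openin (top_of_set (T \<times> UNIV)) X" and D: "openin (top_of_set T) D"
    and g: "continuous_on D g" and gX: "\<And>t. t \<in> D \<Longrightarrow> (t, g t) \<in> X"
    and cl: "closedin (top_of_set X) ((\<lambda>t. (t, g t)) ` D)"
    and eX: "euler X x" and eD: "euler D d"
  shows "euler (X - (\<lambda>t. (t, g t)) ` D) (x - d)"
proof -
  obtain W where W: "open W" "X = (T \<times> UNIV) \<inter> W" using X by (auto simp: openin_open)
  \<comment> \<open>Radius of a fibre disc around the graph that stays in \<open>X\<close>. As
    \<open>infdist\<close> to the empty set is 0, the case of \<open>W\<close> being everything gets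
    the value 1.\<close>
  define \<epsilon> where "\<epsilon> t = (if W = UNIV then 1 else infdist (t, g t) (- W))" for t
  have pos: "\<epsilon> t > 0" if "t \<in> D" for t
  proof (cases "W = UNIV")
    case False
    have "(t, g t) \<notin> - W" using gX[OF that] W by auto
    with False W(1) have "infdist (t, g t) (- W) > 0"
      by (intro infdist_pos_not_in_closed) auto
    with False show ?thesis by (simp add: \<epsilon>_def)
  qed (simp add: \<epsilon>_def)
  have c\<epsilon>: "continuous_on D \<epsilon>"
    unfolding \<epsilon>_def using g by (cases "W = UNIV") (auto intro!: continuous_intros)
  have inW: "(t, u) \<in> W" if "dist u (g t) < \<epsilon> t" for t u
  proof (rule ccontr)
    assume nW: "(t, u) \<notin> W"
    then have "\<epsilon> t = infdist (t, g t) (- W)" by (auto simp: \<epsilon>_def)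
    also have "\<dots> \<le> dist (t, g t) (t, u)" using nW by (intro infdist_le) auto
    also have "\<dots> = dist u (g t)" by (simp add: dist_Pair_Pair dist_commute)
    finally show False using that by simp
  qed
  define N where "N = {p \<in> D \<times> UNIV. \<epsilon> (fst p) - dist (snd p) (g (fst p)) \<in> {0<..}}"
  have DT: "D \<subseteq> T" using D openin_imp_subset by blast
  have NX: "N \<subseteq> X" using DT inW by (auto simp: N_def W)
  have "openin (top_of_set (D \<times> UNIV)) N"
  proof -
    have "continuous_on (D \<times> UNIV) (\<lambda>p. \<epsilon> (fst p) - dist (snd p) (g (fst p)))"
      by (intro continuous_intros continuous_on_compose2[OF c\<epsilon>] continuous_on_compose2[OF g]) auto
    moreover have "N = (D \<times> UNIV) \<inter> (\<lambda>p. \<epsilon> (fst p) - dist (snd p) (g (fst p))) -` {0<..}"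
      unfolding N_def by auto
    ultimately show ?thesis using continuous_openin_preimage_gen[OF _ open_greaterThan] by metis
  qed
  moreover have "openin (top_of_set (T \<times> UNIV)) (D \<times> (UNIV::complex set))"
    using D by (intro openin_Times) auto
  ultimately have "openin (top_of_set (T \<times> UNIV)) N" using openin_trans by blast
  then have oN: "openin (top_of_set X) N"
    by (rule openin_subset_trans[OF _ NX openin_imp_subset[OF X]])
  let ?G = "(\<lambda>t. (t, g t)) ` D"
  \<comment> \<open>Dividing by the radius straightens \<open>N\<close> to \<open>D\<close> times
    the unit disc and sends the graph to the zero section.\<close>
  let ?f = "\<lambda>p. (fst p, g (fst p) + of_real (\<epsilon> (fst p)) * snd p)"
  let ?k = "\<lambda>p. (fst p, (snd p - g (fst p)) / of_real (\<epsilon> (fst p)))"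
  have cf: "continuous_on (D \<times> A) ?f" for A
    by (intro continuous_intros continuous_on_compose2[OF c\<epsilon>] continuous_on_compose2[OF g]) auto
  have ck: "continuous_on N ?k"
    using pos by (intro continuous_intros continuous_on_compose2[OF c\<epsilon>] continuous_on_compose2[OF g])
      (auto simp: N_def)
  have fN: "?f p \<in> N" if "p \<in> D \<times> ball 0 1" for p
    using that pos[of "fst p"] by (auto simp: N_def dist_norm norm_mult)
  have kN: "?k p \<in> D \<times> ball 0 1" if "p \<in> N" for p
    using that pos[of "fst p"] by (auto simp: N_def dist_norm norm_divide)
  have kf: "?k (?f p) = p" if "p \<in> D \<times> ball 0 1" for p
    using that pos[of "fst p"] by (auto simp: prod_eq_iff)
  have fk: "?f (?k p) = p" if "p \<in> N" for p
    using that pos[of "fst p"] by (auto simp: prod_eq_iff N_def)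
  have "homeomorphism (D \<times> ball 0 1) N ?f ?k"
  proof (intro homeomorphismI cf ck)
    show "?f ` (D \<times> ball 0 1) \<subseteq> N" using fN by (rule image_subsetI)
    show "?k ` N \<subseteq> D \<times> ball 0 1" using kN by (rule image_subsetI)
  qed (fact kf fk)+
  moreover have "euler (D \<times> ball (0::complex) 1) d"
    using eD by (intro euler_Times_convex) auto
  ultimately have eN: "euler N d" using euler_homeomorphism by blast
  have "homeomorphism (D \<times> {v. norm v \<in> {0<..<1}}) (N - ?G) ?f ?k"
  proof (intro homeomorphismI cf)
    show "continuous_on (N - ?G) ?k" using ck continuous_on_subset by blast
    show "?f ` (D \<times> {v. norm v \<in> {0<..<1}}) \<subseteq> N - ?G"
    proof (rule image_subsetI)
      fix p :: "'a \<times> complex" assume p: "p \<in> D \<times> {v. norm v \<in> {0<..<1}}"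
      then have "?f p \<in> N" by (intro fN) auto
      moreover have "snd (?f p) \<noteq> g (fst (?f p))" using p pos[of "fst p"] by auto
      ultimately show "?f p \<in> N - ?G" by auto
    qed
    show "?k ` (N - ?G) \<subseteq> D \<times> {v. norm v \<in> {0<..<1}}"
    proof (rule image_subsetI)
      fix p assume p: "p \<in> N - ?G"
      then have "?k p \<in> D \<times> ball 0 1" by (intro kN) auto
      moreover have "snd p \<noteq> g (fst p)" using p by (auto simp: N_def image_iff prod_eq_iff)
      ultimately show "?k p \<in> D \<times> {v. norm v \<in> {0<..<1}}"
        using pos[of "fst p"] by auto
    qed
    show "?k (?f p) = p" if "p \<in> D \<times> {v. norm v \<in> {0<..<1}}" for p
      using that by (intro kf) auto
    show "?f (?k p) = p" if "p \<in> N - ?G" for p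
      using that by (intro fk) auto
  qed
  moreover have "euler (D \<times> {v::complex. norm v \<in> {0<..<1}}) 0"
    using eD by (intro euler_Times_annulus) (auto simp: is_interval_convex_1)
  ultimately have eNG: "euler (N - ?G) 0" using euler_homeomorphism by blast
  have "?G \<subseteq> N" using pos by (auto simp: N_def)
  then have "(X - ?G) \<union> N = X" "(X - ?G) \<inter> N = N - ?G" using NX by auto
  moreover have "openin (top_of_set X) (X - ?G)" using cl by (simp add: openin_diff)
  ultimately show ?thesis using euler_open_piece[OF _ oN _ eX eN, of "X - ?G" 0] eNG by simp
qed

lemma euler_Times_remove_point:
  fixes S :: "'a::metric_space set"
  assumes "open U" "a \<in> U" "euler (S \<times> U) x" "euler S c"
  shows "euler (S \<times> (U - {a::complex})) (x - c)"
proof -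
  have "(\<lambda>t. (t, a)) ` S = S \<times> {a}" by auto
  moreover have "closedin (top_of_set (S \<times> U)) (S \<times> {a})"
    using assms(2) by (intro closedin_Times) auto
  moreover have "openin (top_of_set (S \<times> UNIV)) (S \<times> U)"
    using assms(1) by (intro openin_Times) auto
  ultimately have "euler (S \<times> U - S \<times> {a}) (x - c)"
    using euler_remove_graph[of S "S \<times> U" S "\<lambda>_. a" x c] assms by auto
  moreover have "S \<times> U - S \<times> {a} = S \<times> (U - {a})" by auto
  ultimately show ?thesis by simp
qed

lemma euler_Times_Diff_finite:
  fixes S :: "'a::metric_space set"
  assumes "finite F" "euler S c"
  shows "euler (S \<times> (UNIV - F :: complex set)) ((1 - int (card F)) * c)"
  using assms(1)
proof (induction F)
  case empty
  show ?case using euler_Times_convex[OF convex_UNIV _ assms(2)] by simp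
next
  case (insert a F)
  have "euler (S \<times> (UNIV - F - {a})) ((1 - int (card F)) * c - c)"
    using insert assms by (intro euler_Times_remove_point) (auto simp: open_Diff finite_imp_closed)
  moreover have "(UNIV - F - {a}) = UNIV - insert a F" by auto
  ultimately show ?case using insert by (simp add: algebra_simps)
qed

lemma euler_Diff_finite: "finite F \<Longrightarrow> euler (UNIV - F :: complex set) (1 - int (card F))"
  using euler_Times_Diff_finite[OF _ euler_singleton[of "0::real"]] euler_singleton_Times by fastforce

section \<open>The singularity of a simple or multiple root\<close>

lemma euler_Un_disjoint_open:
  assumes "openin (top_of_set X) U" "openin (top_of_set X) V" "U \<inter> V = {}" "euler U u" "euler V v"
  shows "euler (U \<union> V) (u + v)"
proof (rule euler_disjoint_open)
  have "U \<subseteq> X" "V \<subseteq> X" using assms(1,2) openin_imp_subset by blast+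
  then show "openin (top_of_set (U \<union> V)) U" "openin (top_of_set (U \<union> V)) V"
    using assms(1,2) openin_subset_trans[of X] by (metis Un_least Un_upper1 Un_upper2)+
qed (use assms in auto)

text \<open>Near a zero of order \<open>n\<close>, \<open>f\<close> is the \<open>n\<close>-th power
  of (w - \<xi>) g(w) with \<open>g\<close> nonvanishing, and this base is a local coordinate.
  Condition \<open>nz\<close> makes the order finite.\<close>

lemma holomorphic_local_power_coordinate:
  assumes holf: "f holomorphic_on S" and S: "open S" "\<xi> \<in> S" and f0: "f \<xi> = 0"
    and nz: "\<And>r. r > 0 \<Longrightarrow> \<exists>w\<in>ball \<xi> r \<inter> S. f w \<noteq> 0" and e: "e > 0"
  obtains T s t n \<epsilon> where "open T" "\<xi> \<in> T" "T \<subseteq> S" "0 < \<epsilon>" "\<epsilon> \<le> e" "n > 0"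
    "homeomorphism T (ball 0 \<epsilon>) s t" "s \<xi> = 0" "\<And>w. w \<in> T \<Longrightarrow> f w = s w ^ n"
proof -
  obtain r where r: "r > 0" "ball \<xi> r \<subseteq> S" using S openE by blast
  have hol': "f holomorphic_on ball \<xi> r" using holf r holomorphic_on_subset by blast
  have "\<exists>n>0. (deriv ^^ n) f \<xi> \<noteq> 0"
  proof (rule ccontr)
    assume "\<not> ?thesis"
    then have "\<And>n. 0 < n \<Longrightarrow> (deriv ^^ n) f \<xi> = 0" by blast
    then have "f w = f \<xi>" if "w \<in> ball \<xi> r" for w
      using holomorphic_fun_eq_const_on_connected[OF hol' open_ball connected_ball, of \<xi> w] that r
      by auto
    with nz[OF r(1)] f0 show False by auto
  qed
  then obtain n0 where n0: "n0 > 0 \<and> (deriv ^^ n0) f \<xi> \<noteq> 0" by blast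
  define n where "n = (LEAST n. n > 0 \<and> (deriv ^^ n) f \<xi> \<noteq> 0)"
  have n: "n > 0" "(deriv ^^ n) f \<xi> \<noteq> 0"
    using LeastI[of "\<lambda>n. n > 0 \<and> (deriv ^^ n) f \<xi> \<noteq> 0", OF n0] by (auto simp: n_def)
  have nmin: "(deriv ^^ k) f \<xi> = 0" if "0 < k" "k < n" for k
    using not_less_Least[of k "\<lambda>n. n > 0 \<and> (deriv ^^ n) f \<xi> \<noteq> 0"] that by (auto simp: n_def)
  obtain g \<delta> where g: "0 < \<delta>" "g holomorphic_on ball \<xi> \<delta>"
    "\<And>w. w \<in> ball \<xi> \<delta> \<Longrightarrow> f w - f \<xi> = ((w - \<xi>) * g w) ^ n"
    "\<And>w. w \<in> ball \<xi> \<delta> \<Longrightarrow> g w \<noteq> 0"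
    by (blast intro: nmin holomorphic_factor_order_of_zero_strong[OF holf S n(1,2)])
  define s where "s w = (w - \<xi>) * g w" for w
  define \<rho> where "\<rho> = min r \<delta>"
  have \<rho>: "\<rho> > 0" "ball \<xi> \<rho> \<subseteq> ball \<xi> \<delta>" "ball \<xi> \<rho> \<subseteq> S"
    using r g(1) by (auto simp: \<rho>_def)
  have hols: "s holomorphic_on ball \<xi> \<rho>"
    unfolding s_def using g(2) \<rho>(2) holomorphic_on_subset by (intro holomorphic_intros) blast
  have "(g has_field_derivative deriv g \<xi>) (at \<xi>)"
    using g(1,2) by (intro holomorphic_derivI[OF _ open_ball]) auto
  \<comment> \<open>At the centre the derivative is \<open>g \<xi>\<close>, which is nonzero, so
    \<open>s\<close> is locally invertible.\<close>
  then have "(s has_field_derivative ((\<xi> - \<xi>) * deriv g \<xi> + 1 * g \<xi>)) (at \<xi>)"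
    unfolding s_def by (auto intro!: derivative_eq_intros)
  then have "deriv s \<xi> \<noteq> 0" using g(4)[of \<xi>] g(1) by (auto dest: DERIV_imp_deriv)
  then obtain r' where r': "r' > 0" "ball \<xi> r' \<subseteq> ball \<xi> \<rho>" "open (s ` ball \<xi> r')"
      "inj_on s (ball \<xi> r')"
    using has_complex_derivative_locally_invertible[OF hols, of \<xi>] \<rho> by auto
  have cs: "continuous_on (ball \<xi> r') s"
    using hols r'(2) holomorphic_on_imp_continuous_on holomorphic_on_subset by blast
  obtain t where t: "homeomorphism (ball \<xi> r') (s ` ball \<xi> r') s t"
    using invariance_of_domain_homeomorphism[OF open_ball cs] r'(4) by auto
  have s0: "s \<xi> = 0" by (simp add: s_def)
  then have "0 \<in> s ` ball \<xi> r'" using r'(1) by (auto intro!: image_eqI[of _ _ \<xi>])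
  then obtain \<epsilon>' where \<epsilon>': "\<epsilon>' > 0" "ball 0 \<epsilon>' \<subseteq> s ` ball \<xi> r'" using r'(3) openE by blast
  define \<epsilon> where "\<epsilon> = min \<epsilon>' e"
  have \<epsilon>: "0 < \<epsilon>" "\<epsilon> \<le> e" "ball 0 \<epsilon> \<subseteq> s ` ball \<xi> r'" using \<epsilon>' e by (auto simp: \<epsilon>_def)
  \<comment> \<open>Taking the preimage of a round disc identifies \<open>T\<close> with the base of
    \<open>power_cone\<close>.\<close>
  define T where "T = ball \<xi> r' \<inter> s -` ball 0 \<epsilon>"
  show ?thesis
  proof (rule that)
    show "open T" unfolding T_def using cs by (intro continuous_open_preimage) auto
    show "\<xi> \<in> T" using s0 \<epsilon> r' by (auto simp: T_def)
    show "T \<subseteq> S" using r' \<rho> by (auto simp: T_def)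
    show "homeomorphism T (ball 0 \<epsilon>) s t"
    proof (rule homeomorphism_of_subsets[OF t])
      show "s ` T = ball 0 \<epsilon>" using \<epsilon>(3) by (auto simp: T_def)
    qed (use \<epsilon>(3) in \<open>auto simp: T_def\<close>)
    show "f w = s w ^ n" if "w \<in> T" for w
    proof -
      have "w \<in> ball \<xi> \<delta>" using that r'(2) \<rho>(2) unfolding T_def by blast
      from g(3)[OF this] f0 show ?thesis by (simp add: s_def)
    qed
  qed (use \<epsilon> n s0 in auto)
qed

text \<open>The surface singularity v w = s^n over a disc. In the coordinates used later, v = -1 and
  w = 1 correspond to y = 0 and z = 0, which the torus excludes.\<close>

definition power_cone :: "nat \<Rightarrow> real \<Rightarrow> (complex \<times> complex \<times> complex) set" where
  "power_cone n \<epsilon> =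
     {(s, v, w). norm s < \<epsilon> \<and> v * w = s ^ n \<and> v \<noteq> -1 \<and> w \<noteq> 1}"

context
  fixes n :: nat and \<epsilon> :: real
  assumes n: "n > 0" and \<epsilon>: "0 < \<epsilon>" "\<epsilon> \<le> 1 / 16"
begin

text \<open>The bound 1/16 is the square of 1/4: since \<open>v * w = s ^ n\<close>, the norms of v
  and w cannot both reach 1/4.\<close>

lemma norm_power_small: "norm s < \<epsilon> \<Longrightarrow> norm (s ^ n) < 1 / 16" for s :: complex
proof -
  assume s: "norm s < \<epsilon>"
  have "norm (s ^ n) = norm s ^ n" by (rule norm_power)
  also have "\<dots> \<le> norm s ^ 1"
    using s \<epsilon> n by (intro power_decreasing) auto
  finally show ?thesis using s \<epsilon> by simp
qed

text \<open>Away from v = 0 the coordinate w is a function of s and v, so small that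
  \<open>w \<noteq> 1\<close> is automatic.\<close>

lemma power_cone_chart:
  assumes K: "\<And>v. v \<in> K \<Longrightarrow> norm v > 1 / 4" "-1 \<notin> K"
  shows "homeomorphism (ball 0 \<epsilon> \<times> K) {(s, v, w) \<in> power_cone n \<epsilon>. v \<in> K}
    (\<lambda>p. (fst p, snd p, fst p ^ n / snd p)) (\<lambda>p. (fst p, fst (snd p)))"
proof (intro homeomorphismI)
  have nz: "v \<noteq> 0" if "v \<in> K" for v using K(1)[OF that] by auto
  show "continuous_on (ball 0 \<epsilon> \<times> K) (\<lambda>p. (fst p, snd p, fst p ^ n / snd p))"
    using nz by (intro continuous_intros) auto
  have "norm (s ^ n / v) < 1 / 4" if "norm s < \<epsilon>" "v \<in> K" for s v
    using norm_power_small[OF that(1)] K(1)[OF that(2)] by (simp add: norm_divide divide_simps)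
  then have "s ^ n / v \<noteq> 1" if "norm s < \<epsilon>" "v \<in> K" for s v
    using that by fastforce
  then show "(\<lambda>p. (fst p, snd p, fst p ^ n / snd p)) ` (ball 0 \<epsilon> \<times> K)
      \<subseteq> {(s, v, w) \<in> power_cone n \<epsilon>. v \<in> K}"
    using nz K(2) by (auto simp: power_cone_def)
  show "(fst (fst p, fst (snd p)), snd (fst p, fst (snd p)), fst (fst p, fst (snd p)) ^ n / snd (fst p, fst (snd p))) = p" if "p \<in> {(s, v, w) \<in> power_cone n \<epsilon>. v \<in> K}" for p
    using that nz[of "fst (snd p)"] by (auto simp: power_cone_def nonzero_divide_eq_eq mult.commute)
qed (auto simp: power_cone_def intro!: continuous_intros)

lemma norm_small_of_large:
  assumes "(s, v, w) \<in> power_cone n \<epsilon>" "norm v > 1 / 4"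
  shows "norm w < 1 / 4"
proof (rule ccontr)
  assume "\<not> norm w < 1 / 4"
  then have "1 / 4 * (1 / 4) \<le> norm v * norm w" using assms by (intro mult_mono) auto
  also have "\<dots> = norm (s ^ n)" using assms by (simp add: power_cone_def flip: norm_mult)
  finally show False using norm_power_small[of s] assms by (simp add: power_cone_def)
qed

text \<open>In the chart this is a disc times an annulus with the point -1 removed: 0 - 1.\<close>

lemma euler_power_cone_large: "euler {(s, v, w) \<in> power_cone n \<epsilon>. norm v > 1 / 4} (-1)"
proof -
  have "euler (ball (0::complex) \<epsilon> \<times> {v::complex. norm v \<in> {1/4<..}}) 0"
    by (intro euler_Times_annulus[where c = 1] euler_convex)
      (use \<epsilon> in \<open>auto simp: is_interval_convex_1\<close>)
  moreover have "{v::complex. norm v \<in> {1/4<..}} = {v. norm v > 1 / 4}" by auto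
  ultimately have "euler (ball (0::complex) \<epsilon> \<times> ({v::complex. norm v > 1 / 4} - {-1})) (0 - 1)"
    by (intro euler_Times_remove_point euler_convex)
      (use \<epsilon> in \<open>auto intro!: open_Collect_less continuous_intros\<close>)
  moreover have "homeomorphism (ball 0 \<epsilon> \<times> ({v::complex. norm v > 1 / 4} - {-1}))
      {(s, v, w) \<in> power_cone n \<epsilon>. v \<in> {v. norm v > 1 / 4} - {-1}}
      (\<lambda>p. (fst p, snd p, fst p ^ n / snd p)) (\<lambda>p. (fst p, fst (snd p)))"
    by (rule power_cone_chart) auto
  moreover have "{(s, v, w) \<in> power_cone n \<epsilon>. v \<in> {v. norm v > 1 / 4} - {-1}} =
      {(s, v, w) \<in> power_cone n \<epsilon>. norm v > 1 / 4}"
    by (auto simp: power_cone_def)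
  ultimately show ?thesis using euler_homeomorphism by fastforce
qed

lemma euler_power_cone_medium:
  "euler {(s, v, w) \<in> power_cone n \<epsilon>. norm v > 1 / 4 \<and> norm v < 1 / 2} 0"
proof -
  have "euler (ball (0::complex) \<epsilon> \<times> {v::complex. norm v \<in> {1/4<..<1/2}}) 0"
    by (intro euler_Times_annulus[where c = 1] euler_convex)
      (use \<epsilon> in \<open>auto simp: is_interval_convex_1\<close>)
  moreover have "homeomorphism (ball 0 \<epsilon> \<times> {v::complex. norm v \<in> {1/4<..<1/2}})
      {(s, v, w) \<in> power_cone n \<epsilon>. v \<in> {v. norm v \<in> {1/4<..<1/2}}}
      (\<lambda>p. (fst p, snd p, fst p ^ n / snd p)) (\<lambda>p. (fst p, fst (snd p)))"
    by (rule power_cone_chart) auto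
  ultimately show ?thesis using euler_homeomorphism by fastforce
qed

text \<open>Exchanging and negating v and w preserves their product and interchanges the conditions
  \<open>v \<noteq> -1\<close> and \<open>w \<noteq> 1\<close>.\<close>

lemma power_cone_swap:
  "homeomorphism {(s, v, w) \<in> power_cone n \<epsilon>. P v w} {(s, v, w) \<in> power_cone n \<epsilon>. P (- w) (- v)}
    (\<lambda>p. (fst p, - snd (snd p), - fst (snd p))) (\<lambda>p. (fst p, - snd (snd p), - fst (snd p)))"
  by (intro homeomorphismI)
     (auto simp: power_cone_def mult.commute minus_equation_iff[of _ 1] equation_minus_iff[of _ 1] intro!: continuous_intros)

text \<open>\<open>A\<close> and \<open>A'\<close> are the ends along the two branches, each of
  characteristic -1. \<open>C\<close> is a contractible neighbourhood of the singular point and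
  meets them in sets of characteristic 0, whence -1 - 1 + 1.\<close>

lemma euler_power_cone: "euler (power_cone n \<epsilon>) (-1)"
proof -
  let ?M = "power_cone n \<epsilon>"
  define A where "A = {(s, v, w) \<in> ?M. norm v > 1 / 4}"
  define A' where "A' = {(s, v, w) \<in> ?M. norm w > 1 / 4}"
  define C where "C = {(s, v, w) \<in> ?M. norm v < 1 / 2 \<and> norm w < 1 / 2}"
  have op: "openin (top_of_set ?M) {p \<in> ?M. f p \<in> {0<..}}" if "continuous_on ?M f" for f :: "_ \<Rightarrow> real"
  proof -
    have "{p \<in> ?M. f p \<in> {0<..}} = ?M \<inter> f -` {0<..}" by auto
    then show ?thesis using continuous_openin_preimage_gen[OF that open_greaterThan] by metis
  qed
  have "A = {p \<in> ?M. norm (fst (snd p)) - 1 / 4 \<in> {0<..}}"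
    by (auto simp: A_def)
  moreover have "openin (top_of_set ?M) \<dots>"
    by (intro op continuous_intros)
  ultimately have oA: "openin (top_of_set ?M) A" by simp
  have "A' = {p \<in> ?M. norm (snd (snd p)) - 1 / 4 \<in> {0<..}}"
    by (auto simp: A'_def)
  moreover have "openin (top_of_set ?M) \<dots>"
    by (intro op continuous_intros)
  ultimately have oA': "openin (top_of_set ?M) A'" by simp
  have "C = {p \<in> ?M. min (1 / 2 - norm (fst (snd p))) (1 / 2 - norm (snd (snd p))) \<in> {0<..}}"
    by (auto simp: C_def)
  moreover have "openin (top_of_set ?M) \<dots>"
    by (intro op continuous_intros)
  ultimately have oC: "openin (top_of_set ?M) C" by simp
  have AA': "A \<inter> A' = {}" using norm_small_of_large by (fastforce simp: A_def A'_def)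
  have eA: "euler A (-1)" unfolding A_def by (rule euler_power_cone_large)
  have eA': "euler A' (-1)"
    using euler_homeomorphism[OF power_cone_swap euler_power_cone_large] by (simp add: A'_def)
  have "A \<inter> C = {(s, v, w) \<in> ?M. norm v > 1 / 4 \<and> norm v < 1 / 2}"
    using norm_small_of_large by (fastforce simp: A_def C_def)
  then have eAC: "euler (A \<inter> C) 0" using euler_power_cone_medium by simp
  have sw: "(s, - w, - v) \<in> ?M" if "(s, v, w) \<in> ?M" for s v w
    using that by (auto simp: power_cone_def mult.commute minus_equation_iff[of _ 1])
  have small': "norm v < 1 / 4" if "(s, v, w) \<in> ?M" "norm w > 1 / 4" for s v w
    using norm_small_of_large[OF sw[OF that(1)]] that(2) by simp
  have "A' \<inter> C = {(s, v, w) \<in> ?M. norm (- w) > 1 / 4 \<and> norm (- w) < 1 / 2}"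
    using small' by (fastforce simp: A'_def C_def)
  then have eA'C: "euler (A' \<inter> C) 0"
    using euler_homeomorphism[OF power_cone_swap euler_power_cone_medium] by simp
  \<comment> \<open>Weighted scaling: v w and s^n are both multiplied by (1 - t)^(2n). Inside
    \<open>C\<close> the excluded values -1 and 1 are out of reach.\<close>
  have "euler C 1 \<longleftrightarrow> euler {(0::complex, 0::complex, 0::complex)} 1"
  proof (rule euler_deformation_retract[where h = "\<lambda>t p. (of_real ((1 - t)\<^sup>2) * fst p,
      of_real ((1 - t) ^ n) * fst (snd p), of_real ((1 - t) ^ n) * snd (snd p))"])
    fix t :: real and p assume t: "t \<in> {0..1}" and p: "p \<in> C"
    obtain s v w where svw: "p = (s, v, w)" by (cases p) auto
    have le: "(1 - t) ^ k \<le> 1" "(1 - t) ^ k \<ge> 0" for k using t by (auto intro: power_le_one)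
    have m: "norm (of_real ((1 - t) ^ k) * u) \<le> norm u" for k and u :: complex
      using le[of k] by (simp only: norm_mult norm_of_real) (simp add: mult_left_le_one_le)
    have "of_real ((1 - t) ^ n) * v * (of_real ((1 - t) ^ n) * w) = of_real ((1 - t) ^ n) ^ 2 * (v * w)"
      by (simp add: power2_eq_square)
    also have "\<dots> = (of_real ((1 - t)\<^sup>2) * s) ^ n"
      using p by (simp add: C_def svw power_cone_def power_mult_distrib power_mult[symmetric] mult.commute)
    finally have eq: "of_real ((1 - t) ^ n) * v * (of_real ((1 - t) ^ n) * w) = (of_real ((1 - t)\<^sup>2) * s) ^ n" .
    have "norm (of_real ((1 - t) ^ n) * v) < 1 / 2" "norm (of_real ((1 - t) ^ n) * w) < 1 / 2"
      "norm (of_real ((1 - t)\<^sup>2) * s) < \<epsilon>"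
      using m[of n v] m[of n w] m[of 2 s] p by (auto simp: C_def svw power_cone_def simp del: norm_mult of_real_power)
    moreover from this have "of_real ((1 - t) ^ n) * v \<noteq> -1" "of_real ((1 - t) ^ n) * w \<noteq> 1"
      by (metis norm_minus_cancel norm_one less_asym' less_divide_eq_1 not_less_iff_gr_or_eq one_less_numeral_iff semiring_norm(76) zero_less_numeral divide_less_eq_1_pos)+
    ultimately show "(of_real ((1 - t)\<^sup>2) * fst p,
      of_real ((1 - t) ^ n) * fst (snd p), of_real ((1 - t) ^ n) * snd (snd p)) \<in> C"
      using eq by (simp only: svw C_def power_cone_def) auto
  qed (use n \<epsilon> in \<open>auto simp: C_def power_cone_def zero_power intro!: continuous_intros\<close>)
  then have eC: "euler C 1" using euler_singleton by blast
  have "euler (A \<union> A') (-1 + -1)"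
    by (rule euler_Un_disjoint_open[OF oA oA' AA' eA eA'])
  moreover have "euler (A \<inter> C \<union> A' \<inter> C) (0 + 0)"
    using AA' by (intro euler_Un_disjoint_open[OF openin_Int[OF oA oC] openin_Int[OF oA' oC] _ eAC eA'C]) auto
  then have "euler ((A \<union> A') \<inter> C) 0" by (simp add: Int_Un_distrib2)
  moreover have "(A \<union> A') \<union> C = ?M"
    by (auto simp: A_def A'_def C_def)
  ultimately show ?thesis
    using euler_Un_open[OF openin_Un[OF oA oA'] oC _ _ eC, of "-2" 0] by simp
qed

end

section \<open>Families of curves in the torus\<close>

locale curve_family =
  fixes a b c d :: "complex \<Rightarrow> complex"
  assumes hol: "a holomorphic_on UNIV" "b holomorphic_on UNIV"
    "c holomorphic_on UNIV" "d holomorphic_on UNIV"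
begin

definition total :: "complex set \<Rightarrow> (complex \<times> complex \<times> complex) set" where
  "total B = {(x, y, z). x \<in> B \<and> y \<noteq> 0 \<and> z \<noteq> 0 \<and> a x + b x * y + z * (c x + d x * y) = 0}"

definition disc :: "complex \<Rightarrow> complex" where
  "disc x = a x * d x - b x * c x"

lemma cont: "continuous_on S a" "continuous_on S b" "continuous_on S c" "continuous_on S d"
  using hol holomorphic_on_imp_continuous_on holomorphic_on_subset subset_UNIV by metis+

lemma openin_total: "open A \<Longrightarrow> A \<subseteq> B \<Longrightarrow> openin (top_of_set (total B)) (total A)"
proof -
  assume A: "open A" "A \<subseteq> B"
  have "total A = total B \<inter> (A \<times> UNIV)" using A(2) by (auto simp: total_def)
  moreover have "open (A \<times> (UNIV :: (complex \<times> complex) set))" using A(1) by (intro open_Times) auto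
  ultimately show ?thesis by auto
qed

lemma euler_total_Un:
  assumes "open A" "open B" "euler (total A) u" "euler (total B) v" "euler (total (A \<inter> B)) w"
  shows "euler (total (A \<union> B)) (u + v - w)"
proof -
  have "total A \<union> total B = total (A \<union> B)" "total A \<inter> total B = total (A \<inter> B)"
    by (auto simp: total_def)
  then show ?thesis
    using euler_Un_open[OF openin_total openin_total _ assms(3,4)] assms by auto
qed

lemma euler_unramified:
  assumes B: "open B" and nz: "\<And>x. x \<in> B \<Longrightarrow> disc x \<noteq> 0"
    and e: "euler B \<beta>" "euler {x \<in> B. a x \<noteq> 0 \<and> b x \<noteq> 0} \<beta>1" "euler {x \<in> B. c x \<noteq> 0 \<and> d x \<noteq> 0} \<beta>2"
  shows "euler (total B) (- \<beta>1 - \<beta>2)"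
proof -
  define D1 where "D1 = {x \<in> B. a x \<noteq> 0 \<and> b x \<noteq> 0}"
  define D2 where "D2 = {x \<in> B. c x \<noteq> 0 \<and> d x \<noteq> 0}"
  define X0 where "X0 = B \<times> (UNIV - {0::complex})"
  define G1 where "G1 = (\<lambda>x. (x, - a x / b x)) ` D1"
  define G2 where "G2 = (\<lambda>x. (x, - c x / d x)) ` D2"
  have oD1: "open D1" and oD2: "open D2"
    using B unfolding D1_def D2_def Collect_conj_eq
    by (auto intro!: open_Int open_Collect_neq cont simp: Collect_mem_eq)
  have oX0: "open X0" unfolding X0_def using B by (intro open_Times) auto
  have e0: "euler X0 0" unfolding X0_def by (rule euler_Times_punctured_plane[OF e(1)])
  have G1: "G1 = {p \<in> X0. a (fst p) + b (fst p) * snd p = 0}"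
  proof (intro subset_antisym subsetI)
    fix p assume p: "p \<in> {p \<in> X0. a (fst p) + b (fst p) * snd p = 0}"
    \<comment> \<open>If \<open>b\<close> vanished so would \<open>a\<close>, and the discriminant
      would be 0.\<close>
    then have "b (fst p) \<noteq> 0"
      using nz[of "fst p"] by (auto simp: X0_def disc_def)
    moreover from this have "a (fst p) \<noteq> 0" "snd p = - a (fst p) / b (fst p)"
      using p by (auto simp: X0_def field_simps eq_neg_iff_add_eq_0)
    ultimately show "p \<in> G1" using p by (auto simp: G1_def D1_def X0_def image_iff prod_eq_iff)
  qed (auto simp: G1_def D1_def X0_def)
  have cX: "continuous_on S (\<lambda>p. a (fst p) + b (fst p) * snd p)"
      "continuous_on S (\<lambda>p. c (fst p) + d (fst p) * snd p)" for S
    by (intro continuous_intros continuous_on_compose2[OF cont(1)[of UNIV]]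
      continuous_on_compose2[OF cont(2)[of UNIV]] continuous_on_compose2[OF cont(3)[of UNIV]]
      continuous_on_compose2[OF cont(4)[of UNIV]] subset_UNIV)+
  have cl1: "closedin (top_of_set X0) G1"
    unfolding G1 by (rule continuous_closedin_preimage_constant[OF cX(1)])
  have e1: "euler (X0 - G1) (0 - \<beta>1)"
    unfolding G1_def
  proof (rule euler_remove_graph[where T = UNIV])
    show "continuous_on D1 (\<lambda>x. - a x / b x)"
      by (intro continuous_intros cont) (auto simp: D1_def)
    show "closedin (top_of_set X0) ((\<lambda>x. (x, - a x / b x)) ` D1)" using cl1 by (simp only: G1_def)
    show "euler D1 \<beta>1" using e(2) by (simp only: D1_def)
  qed (use oX0 oD1 e0 in simp_all, auto simp: X0_def D1_def)
  have X1: "X0 - G1 = {p \<in> X0. a (fst p) + b (fst p) * snd p \<noteq> 0}" unfolding G1 by auto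
  have "openin (top_of_set X0) (X0 - G1)" using cl1 by (simp add: openin_diff)
  then have oX1: "open (X0 - G1)" using oX0 openin_open_eq by blast
  have G2: "G2 = {p \<in> X0 - G1. c (fst p) + d (fst p) * snd p = 0}"
  proof (intro subset_antisym subsetI)
    fix p assume p: "p \<in> {p \<in> X0 - G1. c (fst p) + d (fst p) * snd p = 0}"
    then have "d (fst p) \<noteq> 0"
      using nz[of "fst p"] by (auto simp: X0_def disc_def)
    moreover from this have "c (fst p) \<noteq> 0" "snd p = - c (fst p) / d (fst p)"
      using p by (auto simp: X0_def field_simps eq_neg_iff_add_eq_0)
    ultimately show "p \<in> G2" using p by (auto simp: G2_def D2_def X0_def image_iff prod_eq_iff)
  next
    fix p assume "p \<in> G2"
    then obtain x where x: "x \<in> B" "c x \<noteq> 0" "d x \<noteq> 0" "p = (x, - c x / d x)"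
      by (auto simp: G2_def D2_def)
    \<comment> \<open>The left side is the discriminant divided by \<open>d x\<close>; hence the two
      graphs are disjoint.\<close>
    have "a x + b x * (- c x / d x) \<noteq> 0"
      using nz[OF x(1)] x(3) by (auto simp: disc_def field_simps)
    then show "p \<in> {p \<in> X0 - G1. c (fst p) + d (fst p) * snd p = 0}"
      using x unfolding X1 by (auto simp: X0_def)
  qed
  have cl2: "closedin (top_of_set (X0 - G1)) G2"
    unfolding G2 by (rule continuous_closedin_preimage_constant[OF cX(2)])
  have "G2 \<subseteq> X0 - G1" unfolding G2 by blast
  then have G2X: "(x, - c x / d x) \<in> X0 - G1" if "x \<in> D2" for x
    using that unfolding G2_def by blast
  have e2: "euler (X0 - G1 - G2) (0 - \<beta>1 - \<beta>2)"
    unfolding G2_def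
  proof (rule euler_remove_graph[where T = UNIV])
    show "continuous_on D2 (\<lambda>x. - c x / d x)"
      by (intro continuous_intros cont) (auto simp: D2_def)
    show "closedin (top_of_set (X0 - G1)) ((\<lambda>x. (x, - c x / d x)) ` D2)" using cl2 by (simp only: G2_def)
    show "euler D2 \<beta>2" using e(3) by (simp only: D2_def)
  qed (use oX1 oD2 e1 G2X in simp_all)
  have X2: "X0 - G1 - G2 = {(x, y). x \<in> B \<and> y \<noteq> 0 \<and> a x + b x * y \<noteq> 0 \<and> c x + d x * y \<noteq> 0}"
    unfolding G2 X1 by (auto simp: X0_def)
  have "homeomorphism (X0 - G1 - G2) (total B)
    (\<lambda>p. (fst p, snd p, - (a (fst p) + b (fst p) * snd p) / (c (fst p) + d (fst p) * snd p)))
    (\<lambda>p. (fst p, fst (snd p)))"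
  proof (intro homeomorphismI)
    \<comment> \<open>A nonzero discriminant excludes a common zero of the two linear forms in y, so
      z is determined by x and y.\<close>
    have den: "c x + d x * y \<noteq> 0" if "(x, y, z) \<in> total B" for x y z
    proof
      assume 0: "c x + d x * y = 0"
      then have "a x + b x * y = 0" using that by (auto simp: total_def)
      with 0 have "a x = - (b x * y)" "c x = - (d x * y)" by (simp_all add: eq_neg_iff_add_eq_0)
      then have "a x * d x - b x * c x = 0" by simp
      then show False using nz[of x] that by (auto simp: disc_def total_def)
    qed
    show "(\<lambda>p. (fst p, fst (snd p))) ` total B \<subseteq> X0 - G1 - G2"
      unfolding X2
    proof (rule image_subsetI)
      fix p assume p: "p \<in> total B"
      obtain x y z where xyz: "p = (x, y, z)" by (cases p) auto
      have "a x + b x * y \<noteq> 0" using p den[of x y z] by (auto simp: xyz total_def)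
      then show "(fst p, fst (snd p)) \<in>
          {(x, y). x \<in> B \<and> y \<noteq> 0 \<and> a x + b x * y \<noteq> 0 \<and> c x + d x * y \<noteq> 0}"
        using p den[of x y z] by (simp add: xyz total_def)
    qed
    show "(\<lambda>p. (fst p, snd p, - (a (fst p) + b (fst p) * snd p) / (c (fst p) + d (fst p) * snd p)))
       (fst p, fst (snd p)) = p" if "p \<in> total B" for p
    proof -
      obtain x y z where p: "p = (x, y, z)" by (cases p) auto
      have "a x + b x * y = - (z * (c x + d x * y))"
        using that by (auto simp: total_def p eq_neg_iff_add_eq_0)
      then show ?thesis using den[of x y z] that by (simp add: p)
    qed
    show "continuous_on (X0 - G1 - G2)
      (\<lambda>p. (fst p, snd p, - (a (fst p) + b (fst p) * snd p) / (c (fst p) + d (fst p) * snd p)))"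
      unfolding X2 by (intro continuous_on_Pair continuous_on_divide continuous_on_minus cX
        continuous_on_fst continuous_on_snd continuous_on_id) auto
    show "(\<lambda>p. (fst p, snd p, - (a (fst p) + b (fst p) * snd p) / (c (fst p) + d (fst p) * snd p))) `
        (X0 - G1 - G2) \<subseteq> total B"
      unfolding X2 by (auto simp: total_def simp del: minus_add_distrib)
  qed (auto simp: X2 intro!: continuous_intros)
  from euler_homeomorphism[OF this e2] show ?thesis by simp
qed

text \<open>Multiplying the equation by \<open>d\<close> completes the product: (c + d y) (b + d z)
  = b c - a d. Normalising the two factors to v = -(c + d y) / c and w = (b + d z) / b gives v w =
  disc / (b c), and the right side is a power of a local coordinate.\<close>

lemma euler_node_neighbourhood:
  assumes B: "open B" "x0 \<in> B" and nz0: "a x0 \<noteq> 0" "b x0 \<noteq> 0" "c x0 \<noteq> 0" "d x0 \<noteq> 0"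
    and root: "disc x0 = 0" and iso: "\<And>x. x \<in> B \<Longrightarrow> x \<noteq> x0 \<Longrightarrow> disc x \<noteq> 0"
  obtains T where "open T" "x0 \<in> T" "T \<subseteq> B" "euler (T - {x0}) 0"
    "\<And>x. x \<in> T \<Longrightarrow> a x \<noteq> 0 \<and> b x \<noteq> 0 \<and> c x \<noteq> 0 \<and> d x \<noteq> 0" "euler (total T) (-1)"
proof -
  define S where "S = {x \<in> B. (a x \<noteq> 0 \<and> b x \<noteq> 0) \<and> (c x \<noteq> 0 \<and> d x \<noteq> 0)}"
  have S: "open S" "x0 \<in> S"
    using B nz0 unfolding S_def Collect_conj_eq
    by (auto intro!: open_Int open_Collect_neq cont simp: Collect_mem_eq)
  define f where "f x = disc x / (b x * c x)" for x
  have "f holomorphic_on S"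
    unfolding f_def disc_def using hol holomorphic_on_subset[OF _ subset_UNIV]
    by (intro holomorphic_intros) (auto simp: S_def)
  moreover have "f x0 = 0" using root by (simp add: f_def)
  \<comment> \<open>A nonempty open set is not a single point, and at every point other than
    \<open>x0\<close> the discriminant is nonzero.\<close>
  moreover have "\<exists>w\<in>ball x0 r \<inter> S. f w \<noteq> 0" if "r > 0" for r
  proof -
    have "open (ball x0 r \<inter> S)" "x0 \<in> ball x0 r \<inter> S" using S that by auto
    then have "ball x0 r \<inter> S \<noteq> {x0}" by (metis not_open_singleton)
    then obtain w where w: "w \<in> ball x0 r \<inter> S" "w \<noteq> x0" using \<open>x0 \<in> ball x0 r \<inter> S\<close> by blast
    then have "disc w \<noteq> 0" by (intro iso) (auto simp: S_def)
    with w show ?thesis by (intro bexI[of _ w]) (auto simp: f_def S_def)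
  qed
  ultimately obtain T s t n \<epsilon> where T: "open T" "x0 \<in> T" "T \<subseteq> S" "0 < \<epsilon>" "\<epsilon> \<le> 1 / 16" "n > 0"
    and hom: "homeomorphism T (ball 0 \<epsilon>) s t" and s0: "s x0 = 0" and fs: "\<And>w. w \<in> T \<Longrightarrow> f w = s w ^ n"
    using holomorphic_local_power_coordinate[OF _ S, of f "1/16"] by (metis zero_less_divide_1_iff zero_less_numeral)
  have TS: "a x \<noteq> 0 \<and> b x \<noteq> 0 \<and> c x \<noteq> 0 \<and> d x \<noteq> 0" if "x \<in> T" for x
    using that T(3) by (auto simp: S_def)
  have cs: "continuous_on T s" and ct: "continuous_on (ball 0 \<epsilon>) t"
    and ts: "\<And>x. x \<in> T \<Longrightarrow> t (s x) = x" and st: "\<And>u. norm u < \<epsilon> \<Longrightarrow> s (t u) = u"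
    and sT: "\<And>x. x \<in> T \<Longrightarrow> norm (s x) < \<epsilon>" and tT: "\<And>u. norm u < \<epsilon> \<Longrightarrow> t u \<in> T"
    using hom by (auto simp: homeomorphism_def image_subset_iff set_eq_iff)
  have punct: "homeomorphism {u. norm u \<in> {0<..<\<epsilon>}} (T - {x0}) t s"
  proof (intro homeomorphismI)
    show "continuous_on {u. norm u \<in> {0<..<\<epsilon>}} t" "continuous_on (T - {x0}) s"
      using cs ct by (auto elim: continuous_on_subset)
    show "t ` {u. norm u \<in> {0<..<\<epsilon>}} \<subseteq> T - {x0}" using st tT s0 by force
    have "s x \<noteq> 0" if "x \<in> T - {x0}" for x
      using ts[of x] ts[OF T(2)] s0 that by auto
    then show "s ` (T - {x0}) \<subseteq> {u. norm u \<in> {0<..<\<epsilon>}}" using sT by auto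
  qed (use ts st in auto)
  have "euler {u::complex. norm u \<in> {0<..<\<epsilon>}} 0"
    using T(4) by (intro euler_annulus) (auto simp: is_interval_convex_1)
  with punct have e0: "euler (T - {x0}) 0" by (rule euler_homeomorphism)
  have eq_iff: "a x + b x * y + z * (c x + d x * y) = 0 \<longleftrightarrow>
      (- d x * y / c x - 1) * (1 + z * d x / b x) = f x" if "x \<in> T" for x y z
  proof -
    have "((- d x * y / c x - 1) * (1 + z * d x / b x) - f x) * (b x * c x) =
        - d x * (a x + b x * y + z * (c x + d x * y))"
      using TS[OF that] by (simp add: f_def disc_def field_simps)
    then show ?thesis using TS[OF that]
      by (metis eq_iff_diff_eq_0 mult_eq_0_iff neg_equal_0_iff_equal)
  qed
  have tne: "t u \<in> T" "b (t u) \<noteq> 0" "c (t u) \<noteq> 0" "d (t u) \<noteq> 0" if "norm u < \<epsilon>" for u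
    using tT[OF that] TS by auto
  have cb: "continuous_on (power_cone n \<epsilon>) (\<lambda>p. g (t (fst p)))" if "continuous_on UNIV g" for g :: "complex \<Rightarrow> complex"
    by (rule continuous_on_compose2[OF that]) (auto intro!: continuous_on_compose2[OF ct] continuous_intros simp: power_cone_def)
  have cc: "continuous_on (total T) (\<lambda>p. g (fst p))" if "continuous_on UNIV g" for g :: "complex \<Rightarrow> complex"
    by (rule continuous_on_compose2[OF that]) (auto intro!: continuous_intros)
  have "homeomorphism (power_cone n \<epsilon>) (total T)
    (\<lambda>p. (t (fst p), - c (t (fst p)) * (1 + fst (snd p)) / d (t (fst p)),
       (snd (snd p) - 1) * b (t (fst p)) / d (t (fst p))))
    (\<lambda>p. (s (fst p), - d (fst p) * fst (snd p) / c (fst p) - 1, 1 + snd (snd p) * d (fst p) / b (fst p)))"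
    (is "homeomorphism _ _ ?F ?G")
  proof (intro homeomorphismI)
    show "continuous_on (power_cone n \<epsilon>) ?F"
      by (intro continuous_intros cb cont continuous_on_compose2[OF ct])
        (auto simp: power_cone_def tne)
    show "continuous_on (total T) ?G"
      by (intro continuous_intros cc cont continuous_on_compose2[OF cs])
        (auto simp: total_def TS)
    show GF: "?G (?F p) = p" if "p \<in> power_cone n \<epsilon>" for p
      using that tne[of "fst p"] st[of "fst p"] by (auto simp: power_cone_def)
    show FG: "?F (?G p) = p" if "p \<in> total T" for p
      using that ts[of "fst p"] TS[of "fst p"] by (auto simp: total_def)
    show "?F ` power_cone n \<epsilon> \<subseteq> total T"
    proof (rule image_subsetI)
      fix p assume p: "p \<in> power_cone n \<epsilon>"
      obtain u v w where uvw: "p = (u, v, w)" by (cases p) auto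
      have u: "norm u < \<epsilon>" "v * w = u ^ n" "v \<noteq> -1" "w \<noteq> 1" using p by (auto simp: uvw power_cone_def)
      have "- d (t u) * (- c (t u) * (1 + v) / d (t u)) / c (t u) - 1 = v"
        "1 + ((w - 1) * b (t u) / d (t u)) * d (t u) / b (t u) = w"
        using tne[OF u(1)] by auto
      then have "a (t u) + b (t u) * (- c (t u) * (1 + v) / d (t u)) +
         ((w - 1) * b (t u) / d (t u)) * (c (t u) + d (t u) * (- c (t u) * (1 + v) / d (t u))) = 0"
        by (subst eq_iff[OF tne(1)[OF u(1)]]) (simp only: u fs[OF tne(1)[OF u(1)]] st)
      moreover have "1 + v \<noteq> 0" using u(3) by (metis add.commute add_eq_0_iff)
      ultimately show "?F p \<in> total T"
        using tne[OF u(1)] u(4) by (simp add: uvw total_def)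
    qed
    show "?G ` total T \<subseteq> power_cone n \<epsilon>"
    proof (rule image_subsetI)
      fix p assume p: "p \<in> total T"
      obtain x y z where xyz: "p = (x, y, z)" by (cases p) auto
      have x: "x \<in> T" "y \<noteq> 0" "z \<noteq> 0" "a x + b x * y + z * (c x + d x * y) = 0"
        using p by (auto simp: xyz total_def)
      show "?G p \<in> power_cone n \<epsilon>"
        using x(2,3) x(4)[unfolded eq_iff[OF x(1)]] TS[OF x(1)] sT[OF x(1)] fs[OF x(1)]
        by (simp add: xyz power_cone_def)
    qed
  qed
  from euler_homeomorphism[OF this euler_power_cone[OF T(6,4,5)]] have "euler (total T) (-1)" .
  moreover have "T \<subseteq> B" using T(3) by (auto simp: S_def)
  ultimately show ?thesis using that T(1,2) e0 TS by blast
qed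

text \<open>
  The fibre over a root is two punctured lines meeting in a point, of characteristic \<open>-1\<close>; it
  contributes \<open>-1\<close> since the surface over a punctured disc has characteristic zero.
\<close>

lemma euler_add_node:
  assumes B: "open B" "x0 \<in> B" and nz0: "a x0 \<noteq> 0" "b x0 \<noteq> 0" "c x0 \<noteq> 0" "d x0 \<noteq> 0"
    and root: "disc x0 = 0"
    and iso: "open V" "x0 \<in> V" "\<And>x. x \<in> V \<Longrightarrow> x \<noteq> x0 \<Longrightarrow> disc x \<noteq> 0"
    and e: "euler (total (B - {x0})) k"
  shows "euler (total B) (k - 1)"
proof -
  have "open (B \<inter> V)" "x0 \<in> B \<inter> V" using B iso by auto
  from euler_node_neighbourhood[OF this nz0 root iso(3)] obtain T where
    T: "open T" "x0 \<in> T" "T \<subseteq> B \<inter> V" "euler (T - {x0}) 0"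
    "\<And>x. x \<in> T \<Longrightarrow> a x \<noteq> 0 \<and> b x \<noteq> 0 \<and> c x \<noteq> 0 \<and> d x \<noteq> 0" "euler (total T) (-1)"
    by blast
  \<comment> \<open>No coefficient vanishes on \<open>T\<close>, so both graph domains are the whole
    punctured neighbourhood, of characteristic 0.\<close>
  have eq: "{x \<in> T - {x0}. a x \<noteq> 0 \<and> b x \<noteq> 0} = T - {x0}" "{x \<in> T - {x0}. c x \<noteq> 0 \<and> d x \<noteq> 0} = T - {x0}"
    using T(5) by blast+
  have "euler (total (T - {x0})) (- 0 - 0)"
  proof (intro euler_unramified[where \<beta> = 0])
    show "open (T - {x0})" using T(1) by (simp add: open_delete)
    show "disc x \<noteq> 0" if "x \<in> T - {x0}" for x using that T(3) iso(3) by blast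
  qed (simp_all only: eq T(4))
  moreover have "(B - {x0}) \<inter> T = T - {x0}" "(B - {x0}) \<union> T = B" using T B by auto
  ultimately show ?thesis
    using euler_total_Un[of "B - {x0}" T k "-1" 0] B T e by (simp add: open_delete)
qed

end

section \<open>The surface as a family of curves\<close>

context curve_family
begin

text \<open>Nodes are filled in one at a time. The finite set \<open>R\<close> containing all roots
  supplies, for each node, a neighbourhood free of other roots.\<close>

lemma euler_add_nodes:
  assumes "finite N" "N \<subseteq> B" "open B"
    and "\<And>x. x \<in> N \<Longrightarrow> a x \<noteq> 0 \<and> b x \<noteq> 0 \<and> c x \<noteq> 0 \<and> d x \<noteq> 0 \<and> disc x = 0"
    and "finite R" "\<And>x. disc x = 0 \<Longrightarrow> x \<in> R"
    and "euler (total (B - N)) k"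
  shows "euler (total B) (k - int (card N))"
  using assms(1,2,4,7)
proof (induction N arbitrary: k)
  case (insert x N)
  have "B - insert x N = B - N - {x}" by auto
  with insert.prems have e: "euler (total (B - N - {x})) k" by simp
  have "open (B - N)" using assms(3) insert.hyps by (simp add: finite_imp_closed open_Diff)
  moreover have "open (- (R - {x}))"
    using assms(5) by (intro open_Compl finite_imp_closed finite_Diff)
  ultimately have "euler (total (B - N)) (k - 1)"
    using insert e assms(6) by (intro euler_add_node[of _ x "- (R - {x})"]) auto
  from insert.IH[OF _ _ this] insert show ?case by (simp add: algebra_simps)
qed simp

text \<open>Outside the roots the graphs live over the plane without 0 and
  \<open>R \<union> Z1\<close>, respectively \<open>R \<union> Z2\<close>; subtracting these
  negative characteristics gives the two positive terms. Each node then costs 1, while a root with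
  empty fibre leaves the surface unchanged.\<close>

lemma euler_total_punctured_plane:
  assumes R: "R = {x. x \<noteq> 0 \<and> disc x = 0}" "finite R"
    and Z1: "Z1 = {x. x \<noteq> 0 \<and> (a x = 0 \<or> b x = 0)}" "finite Z1"
    and Z2: "Z2 = {x. x \<noteq> 0 \<and> (c x = 0 \<or> d x = 0)}" "finite Z2"
    and N: "N \<subseteq> R" "\<And>x. x \<in> N \<Longrightarrow> a x \<noteq> 0 \<and> b x \<noteq> 0 \<and> c x \<noteq> 0 \<and> d x \<noteq> 0"
    and empty: "\<And>x. x \<in> R - N \<Longrightarrow> total {x} = {}"
  shows "euler (total (UNIV - {0})) (int (card (R \<union> Z1)) + int (card (R \<union> Z2)) - int (card N))"
proof -
  have cD: "euler (UNIV - insert 0 F) (- int (card F))" if "finite F" "0 \<notin> F" for F :: "complex set"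
    using euler_Diff_finite[of "insert 0 F"] that by simp
  have "euler (total (UNIV - insert 0 R)) (- (- int (card (R \<union> Z1))) - (- int (card (R \<union> Z2))))"
  proof (rule euler_unramified)
    show "open (UNIV - insert 0 R)" using R(2) by (simp add: finite_imp_closed open_Diff)
    show "euler (UNIV - insert 0 R) (- int (card R))" using R by (intro cD) auto
    have "{x \<in> UNIV - insert 0 R. a x \<noteq> 0 \<and> b x \<noteq> 0} = UNIV - insert 0 (R \<union> Z1)"
      by (auto simp: Z1(1))
    then show "euler {x \<in> UNIV - insert 0 R. a x \<noteq> 0 \<and> b x \<noteq> 0} (- int (card (R \<union> Z1)))"
      using cD[of "R \<union> Z1"] R Z1 by auto
    have "{x \<in> UNIV - insert 0 R. c x \<noteq> 0 \<and> d x \<noteq> 0} = UNIV - insert 0 (R \<union> Z2)"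
      by (auto simp: Z2(1))
    then show "euler {x \<in> UNIV - insert 0 R. c x \<noteq> 0 \<and> d x \<noteq> 0} (- int (card (R \<union> Z2)))"
      using cD[of "R \<union> Z2"] R Z2 by auto
  qed (use R in auto)
  moreover have "total (UNIV - insert 0 R) = total ((UNIV - {0}) - N)"
  proof (intro subset_antisym subsetI)
    fix p assume p: "p \<in> total (UNIV - {0} - N)"
    obtain x y z where xyz: "p = (x, y, z)" by (cases p) auto
    have "p \<in> total {x}" using p by (auto simp: xyz total_def)
    then have "x \<notin> R - N" using empty by blast
    then show "p \<in> total (UNIV - insert 0 R)" using p by (auto simp: xyz total_def)
  qed (use N(1) in \<open>auto simp: total_def\<close>)
  ultimately have e: "euler (total ((UNIV - {0}) - N)) (int (card (R \<union> Z1)) + int (card (R \<union> Z2)))"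
    by simp
  show ?thesis
  proof (rule euler_add_nodes[OF _ _ _ _ _ _ e])
    show "finite N" using N(1) R(2) by (rule finite_subset)
    show "finite (insert 0 R)" using R(2) by simp
    show "open (UNIV - {0::complex})" by (simp add: open_delete)
  qed (use N R(1) in auto)
qed

end

section \<open>The quadratic discriminant for weights in the torus\<close>

lemma UNIV_2: "(UNIV :: 2 set) = {0, 1}"
proof -
  have "card {0, 1 :: 2} = card (UNIV :: 2 set)" by simp
  then show ?thesis by (metis card_subset_eq finite_class.finite_UNIV subset_UNIV)
qed

lemma two_cases: "(i :: 2) = 0 \<or> i = 1"
  using UNIV_2 by auto

locale torus_weights =
  fixes W :: weights
  assumes W: "W \<in> weight_torus"
begin

definition "fa x = W 0 0 0 + W 1 0 0 * x"
definition "fb x = W 0 1 0 + W 1 1 0 * x"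
definition "fc x = W 0 0 1 + W 1 0 1 * x"
definition "fd x = W 0 1 1 + W 1 1 1 * x"

sublocale curve_family fa fb fc fd
  by unfold_locales (auto simp: fa_def[abs_def] fb_def[abs_def] fc_def[abs_def] fd_def[abs_def]
    intro!: holomorphic_intros)

lemma W_nz [simp]: "W i j k \<noteq> 0"
  using W by (simp add: weight_torus_def)

lemma Y1_eq: "Y1 W = total (UNIV - {0})"
  by (auto simp: Y1_def total_def f_pol_def fa_def fb_def fc_def fd_def algebra_simps)

definition "mid = W 0 0 0 * W 1 1 1 + W 1 0 0 * W 0 1 1 - W 0 1 0 * W 1 0 1 - W 1 1 0 * W 0 0 1"

lemma disc_eq: "disc x = minor1 0 W + mid * x + minor1 1 W * x\<^sup>2"
  by (simp add: disc_def fa_def fb_def fc_def fd_def mid_def minor1_def algebra_simps power2_eq_square)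

lemma hyperdet_eq: "hyperdet W = mid\<^sup>2 - 4 * minor1 0 W * minor1 1 W"
  by (simp add: hyperdet_def mid_def minor1_def algebra_simps power2_eq_square)

definition "roots = {x. x \<noteq> 0 \<and> disc x = 0}"

text \<open>Of the two roots, one leaves the punctured plane when the constant term vanishes, one
  goes to infinity with the leading term, and two merge with the discriminant. The excluded case is
  the zero polynomial.\<close>

lemma card_roots:
  assumes "\<not> (minor1 0 W = 0 \<and> minor1 1 W = 0 \<and> hyperdet W = 0)"
  shows "finite roots"
    "int (card roots) = 2 - of_bool (minor1 0 W = 0) - of_bool (minor1 1 W = 0) - of_bool (hyperdet W = 0)"
proof -
  let ?p = "minor1 0 W" and ?q = "minor1 1 W"
  have "finite roots \<and>
    int (card roots) = 2 - of_bool (?p = 0) - of_bool (?q = 0) - of_bool (hyperdet W = 0)"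
  proof (cases "?q = 0")
    case q: True
    show ?thesis
    proof (cases "mid = 0")
      case True
      \<comment> \<open>The polynomial is a nonzero constant: no roots, and two of the three
        conditions hold.\<close>
      then have "roots = {}" "?p \<noteq> 0" "hyperdet W = 0"
        using assms q by (auto simp: roots_def disc_eq hyperdet_eq)
      then show ?thesis using q by simp
    next
      case False
      then have H: "hyperdet W \<noteq> 0" using q by (simp add: hyperdet_eq)
      have "x \<in> roots \<longleftrightarrow> x \<noteq> 0 \<and> x = - ?p / mid" for x
      proof -
        have "x = - ?p / mid \<longleftrightarrow> ?p + mid * x = 0"
          using False by (subst nonzero_eq_divide_eq) (auto simp: eq_neg_iff_add_eq_0 ac_simps)
        then show ?thesis using q by (simp add: roots_def disc_eq)
      qed
      note mem = this
      have "roots = (if ?p = 0 then {} else {- ?p / mid})"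
      proof (rule Set.set_eqI)
        fix x show "x \<in> roots \<longleftrightarrow> x \<in> (if ?p = 0 then {} else {- ?p / mid})"
          using mem[of x] False by (cases "?p = 0") auto
      qed
      then show ?thesis using q H by simp
    qed
  next
    case q: False
    define s where "s = csqrt (hyperdet W)"
    have s: "s\<^sup>2 = hyperdet W" by (simp add: s_def)
    define u where "u = (- mid + s) / (2 * ?q)"
    define v where "v = (- mid - s) / (2 * ?q)"
    have uv: "u + v = - mid / ?q" "u * v = ?p / ?q"
    proof -
      show "u + v = - mid / ?q" using q by (simp add: u_def v_def field_simps)
      have "u * v = (mid\<^sup>2 - s\<^sup>2) / (4 * ?q\<^sup>2)"
        using q by (simp add: u_def v_def field_simps power2_eq_square)
      also have "\<dots> = ?p / ?q"
        unfolding s hyperdet_eq using q by (simp add: field_simps power2_eq_square)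
      finally show "u * v = ?p / ?q" .
    qed
    have "disc x = ?q * (x\<^sup>2 - (u + v) * x + u * v)" for x
      unfolding uv disc_eq using q by (simp add: field_simps)
    note D = this
    have "disc x = ?q * ((x - u) * (x - v))" for x
      using D[of x] by (simp add: algebra_simps power2_eq_square)
    then have roots: "roots = {u, v} - {0}" using q by (auto simp: roots_def)
    have ueq: "u = v \<longleftrightarrow> hyperdet W = 0"
    proof -
      have "u - v = s / ?q" using q by (simp add: u_def v_def field_simps)
      then have "u = v \<longleftrightarrow> s = 0" using q by (metis divide_eq_0_iff right_minus_eq)
      then show ?thesis by (simp add: s_def)
    qed
    have p0: "?p = 0 \<longleftrightarrow> u = 0 \<or> v = 0" using uv(2) q by (metis divide_eq_0_iff mult_eq_0_iff)
    show ?thesis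
    proof (cases "u = 0 \<or> v = 0")
      case True
      then have "roots = (if u = v then {} else {if u = 0 then v else u})" unfolding roots by auto
      then show ?thesis using True p0 ueq q by (cases "u = v") auto
    next
      case False
      then have "roots = {u, v}" unfolding roots by auto
      then show ?thesis using False p0 ueq q by (cases "u = v") auto
    qed
  qed
  then show "finite roots"
    "int (card roots) = 2 - of_bool (?p = 0) - of_bool (?q = 0) - of_bool (hyperdet W = 0)"
    by auto
qed

definition "ra = - W 0 0 0 / W 1 0 0"
definition "rb = - W 0 1 0 / W 1 1 0"
definition "rc = - W 0 0 1 / W 1 0 1"
definition "rd = - W 0 1 1 / W 1 1 1"

lemma zero_iff: "fa x = 0 \<longleftrightarrow> x = ra" "fb x = 0 \<longleftrightarrow> x = rb" "fc x = 0 \<longleftrightarrow> x = rc" "fd x = 0 \<longleftrightarrow> x = rd"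
  by (auto simp: fa_def fb_def fc_def fd_def ra_def rb_def rc_def rd_def field_simps eq_neg_iff_add_eq_0)

lemma r_nz: "ra \<noteq> 0" "rb \<noteq> 0" "rc \<noteq> 0" "rd \<noteq> 0"
  by (simp_all add: ra_def rb_def rc_def rd_def)

text \<open>Four of the six coincidences among the zeros of the linear forms are minors;
  \<open>ra = rd\<close> and \<open>rb = rc\<close> correspond to no factor.\<close>

lemma r_eq_iff: "ra = rb \<longleftrightarrow> minor3 0 W = 0" "rc = rd \<longleftrightarrow> minor3 1 W = 0"
  "ra = rc \<longleftrightarrow> minor2 0 W = 0" "rb = rd \<longleftrightarrow> minor2 1 W = 0"
  by (auto simp: ra_def rb_def rc_def rd_def minor2_def minor3_def field_simps)

lemma Z_eq: "{x. x \<noteq> 0 \<and> (fa x = 0 \<or> fb x = 0)} = {ra, rb}" "{x. x \<noteq> 0 \<and> (fc x = 0 \<or> fd x = 0)} = {rc, rd}"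
  using r_nz by (auto simp: zero_iff)

lemma disc_zero_iff: "disc x = 0 \<longleftrightarrow> fa x * fd x = fb x * fc x"
  by (simp add: disc_def)

theorem euler_Y1_nodal_fibres:
  assumes nz: "minor2 0 W \<noteq> 0" "minor2 1 W \<noteq> 0" "minor3 0 W \<noteq> 0" "minor3 1 W \<noteq> 0"
    and "\<not> (minor1 0 W = 0 \<and> minor1 1 W = 0 \<and> hyperdet W = 0)"
  shows "euler (Y1 W) (6 - of_bool (minor1 0 W = 0) - of_bool (minor1 1 W = 0) - of_bool (hyperdet W = 0))"
proof -
  have ne: "ra \<noteq> rb" "rc \<noteq> rd" "ra \<noteq> rc" "rb \<noteq> rd" using nz r_eq_iff by auto
  \<comment> \<open>If a form vanished at a root, a d = b c would make a form of the other product
    vanish there too, and the common zero would be one of the four excluded coincidences.\<close>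
  have node: "fa x \<noteq> 0 \<and> fb x \<noteq> 0 \<and> fc x \<noteq> 0 \<and> fd x \<noteq> 0" if "x \<in> roots" for x
    using that ne unfolding roots_def disc_zero_iff mem_Collect_eq zero_iff
    by (metis mult_eq_0_iff zero_iff)
  then have "roots \<inter> {ra, rb} = {}" "roots \<inter> {rc, rd} = {}"
    by (auto simp: zero_iff)
  then have "int (card (roots \<union> {ra, rb})) = int (card roots) + 2"
    "int (card (roots \<union> {rc, rd})) = int (card roots) + 2"
    using card_roots(1)[OF assms(5)] ne by (simp_all add: card_Un_disjoint)
  moreover have "euler (total (UNIV - {0})) (int (card (roots \<union> {ra, rb})) +
      int (card (roots \<union> {rc, rd})) - int (card roots))"
    using card_roots(1)[OF assms(5)] node
    by (intro euler_total_punctured_plane) (auto simp: roots_def Z_eq)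
  moreover have "int (card roots) + 2 + (int (card roots) + 2) - int (card roots) =
      6 - of_bool (minor1 0 W = 0) - of_bool (minor1 1 W = 0) - of_bool (hyperdet W = 0)"
    unfolding card_roots(2)[OF assms(5)] by simp
  ultimately show ?thesis unfolding Y1_eq by metis
qed

text \<open>Three forms vanish at \<open>ra\<close>, where the equation becomes a nonzero multiple
  of y z and the fibre is empty. The other roots are nodes, so n roots give n + (n + 1) - (n - 1) =
  n + 2.\<close>

theorem euler_Y1_empty_fibre:
  assumes z: "minor2 0 W = 0" "minor2 1 W \<noteq> 0" "minor3 0 W = 0" "minor3 1 W \<noteq> 0"
    and "\<not> (minor1 0 W = 0 \<and> minor1 1 W = 0 \<and> hyperdet W = 0)"
  shows "euler (Y1 W) (4 - of_bool (minor1 0 W = 0) - of_bool (minor1 1 W = 0) - of_bool (hyperdet W = 0))"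
proof -
  have eq: "rb = ra" "rc = ra" "rd \<noteq> ra" using z r_eq_iff by auto
  have fin: "finite roots" by (rule card_roots(1)[OF assms(5)])
  have ra: "ra \<in> roots"
    using r_nz by (auto simp: roots_def disc_zero_iff zero_iff[THEN iffD2] eq)
  have rd: "rd \<notin> roots"
    using eq zero_iff[of rd] by (auto simp: roots_def disc_zero_iff)
  have node: "fa x \<noteq> 0 \<and> fb x \<noteq> 0 \<and> fc x \<noteq> 0 \<and> fd x \<noteq> 0" if "x \<in> roots - {ra}" for x
    using that rd unfolding zero_iff eq by auto
  have "roots \<union> {ra, rb} = roots" "roots \<union> {rc, rd} = insert rd roots"
    using ra by (auto simp: eq)
  then have "int (card (roots \<union> {ra, rb})) = int (card roots)"
    "int (card (roots \<union> {rc, rd})) = int (card roots) + 1"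
    using fin rd by simp_all
  moreover have "int (card (roots - {ra})) = int (card roots) - 1"
    using ra fin by (metis card_Suc_Diff1 diff_add_cancel int_ops(4) add.commute add_diff_cancel_left')
  moreover have "euler (total (UNIV - {0})) (int (card (roots \<union> {ra, rb})) +
      int (card (roots \<union> {rc, rd})) - int (card (roots - {ra})))"
  proof (rule euler_total_punctured_plane)
    fix x assume "x \<in> roots - (roots - {ra})"
    then have "x = ra" by auto
    moreover have "fa ra = 0" "fb ra = 0" "fc ra = 0" "fd ra \<noteq> 0" using eq by (simp_all add: zero_iff)
    ultimately show "total {x} = {}" by (auto simp: total_def)
  qed (use fin node in \<open>auto simp: roots_def Z_eq\<close>)
  moreover have "int (card roots) + (int (card roots) + 1) - (int (card roots) - 1) =
      4 - of_bool (minor1 0 W = 0) - of_bool (minor1 1 W = 0) - of_bool (hyperdet W = 0)"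
    unfolding card_roots(2)[OF assms(5)] by simp
  ultimately show ?thesis unfolding Y1_eq by metis
qed

end

text \<open>The set is \<open>Q\<close> at v = 0 together with \<open>C\<close> times the plane
  without \<open>p\<close>, meeting along \<open>C\<close> at v = 0. The part off v = 0 is
  \<open>C\<close> times a twice punctured plane and contributes -c.\<close>

lemma euler_two_components:
  fixes Q C :: "'a::metric_space set"
  assumes "C \<subseteq> Q" "p \<noteq> 0" "euler Q q" "euler C c"
  shows "euler {(y, v::complex). y \<in> Q \<and> v \<noteq> p \<and> (v = 0 \<or> y \<in> C)} (q - c)"
proof -
  define X where "X = {(y, v::complex). y \<in> Q \<and> v \<noteq> p \<and> (v = 0 \<or> y \<in> C)}"
  have op: "openin (top_of_set X) (X \<inter> (UNIV \<times> V))" if "open V" for V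
    using that by (intro openin_open_Int open_Times) auto
  define U where "U = X \<inter> (UNIV \<times> (- {0}))"
  \<comment> \<open>Radius \<open>norm p\<close> keeps the puncture out, so \<open>V\<close>
    contracts to v = 0.\<close>
  define V where "V = X \<inter> (UNIV \<times> ball 0 (norm p))"
  have oU: "openin (top_of_set X) U" and oV: "openin (top_of_set X) V"
    unfolding U_def V_def by (simp_all add: op open_Compl)
  have "U = C \<times> (UNIV - {0, p})" using assms(1) by (auto simp: U_def X_def)
  then have eU: "euler U (- c)"
    using euler_Times_Diff_finite[OF _ assms(4), of "{0, p}"] assms(2) by simp
  have "U \<inter> V = C \<times> {v. norm v \<in> {0<..<norm p}}"
    using assms(1) by (auto simp: U_def V_def X_def)
  moreover have "euler (C \<times> {v::complex. norm v \<in> {0<..<norm p}}) 0"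
    using assms(2) by (intro euler_Times_annulus[OF _ _ _ assms(4)]) (auto simp: is_interval_convex_1)
  ultimately have eUV: "euler (U \<inter> V) 0" by simp
  have "euler V q \<longleftrightarrow> euler (Q \<times> {0::complex}) q"
  proof (rule euler_deformation_retract[where h = "\<lambda>t x. (fst x, (1 - t) *\<^sub>R snd x)"])
    fix t :: real and x assume t: "t \<in> {0..1}" and x: "x \<in> V"
    then have "norm ((1 - t) *\<^sub>R snd x) \<le> norm (snd x)" by (simp add: mult_left_le_one_le)
    then have "norm ((1 - t) *\<^sub>R snd x) < norm p" using x by (auto simp: V_def)
    then show "(fst x, (1 - t) *\<^sub>R snd x) \<in> V"
      using x by (auto simp: V_def X_def)
  qed (use assms(2) in \<open>auto simp: V_def X_def intro!: continuous_intros\<close>)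
  then have eV: "euler V q" using assms(3) euler_Times_singleton by blast
  have "U \<union> V = X" using assms(2) by (auto simp: U_def V_def X_def)
  from euler_Un_open[OF oU oV this eU eV eUV] show ?thesis
    by (simp add: X_def)
qed

text \<open>If the determinant vanishes, the equation factors into y = y0 and z = z0, two punctured
  lines crossing once. Otherwise z is a function of y on the plane without the three points 0, -a /
  b and -c / d.\<close>

lemma euler_bilinear_curve:
  fixes a b c d :: complex
  assumes nz: "a \<noteq> 0" "b \<noteq> 0" "c \<noteq> 0" "d \<noteq> 0"
  shows "euler {(y, z). y \<noteq> 0 \<and> z \<noteq> 0 \<and> a + b * y + z * (c + d * y) = 0}
    (if a * d = b * c then -1 else -2)"
proof (cases "a * d = b * c")
  case True
  define y0 where "y0 = - a / b"
  define z0 where "z0 = - b / d"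
  have "a + b * y + z * (c + d * y) = d * (y - y0) * (z - z0)" for y z
  proof -
    have "d * (y - y0) * (z - z0) = a * d * z / b + a + d * y * z + b * y"
      using nz by (simp add: y0_def z0_def field_simps)
    also have "a * d * z / b = c * z" using nz True by (simp add: field_simps)
    finally show ?thesis by (simp add: algebra_simps)
  qed
  then have eq: "{(y, z). y \<noteq> 0 \<and> z \<noteq> 0 \<and> a + b * y + z * (c + d * y) = 0} =
      {(y, z). y \<noteq> 0 \<and> z \<noteq> 0 \<and> (y = y0 \<or> z = z0)}" using nz by auto
  have "euler {(y, v::complex). y \<in> UNIV - {0::complex} \<and> v \<noteq> - z0 \<and> (v = 0 \<or> y \<in> {y0})} (0 - 1)"
    using euler_Diff_finite[of "{0}"] nz
    by (intro euler_two_components euler_singleton) (auto simp: y0_def z0_def)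
  moreover have "homeomorphism {(y, v::complex). y \<in> UNIV - {0::complex} \<and> v \<noteq> - z0 \<and> (v = 0 \<or> y \<in> {y0})}
     {(y, z). y \<noteq> 0 \<and> z \<noteq> 0 \<and> (y = y0 \<or> z = z0)} (\<lambda>p. (fst p, snd p + z0)) (\<lambda>p. (fst p, snd p - z0))"
    by (intro homeomorphismI) (auto intro!: continuous_intros simp: add_eq_0_iff2)
  ultimately show ?thesis unfolding eq using True euler_homeomorphism by fastforce
next
  case False
  have "homeomorphism (UNIV - {0, - a / b, - c / d})
    {(y, z). y \<noteq> 0 \<and> z \<noteq> 0 \<and> a + b * y + z * (c + d * y) = 0}
    (\<lambda>y. (y, - (a + b * y) / (c + d * y))) fst"
  proof (intro homeomorphismI)
    have z1: "a + b * y = 0 \<longleftrightarrow> y = - a / b" and z2: "c + d * y = 0 \<longleftrightarrow> y = - c / d" for y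
      using nz by (auto simp: field_simps eq_neg_iff_add_eq_0 add.commute)
    have ne: "- a / b \<noteq> - c / d" using False nz by (simp add: field_simps)
    show "continuous_on (UNIV - {0, - a / b, - c / d}) (\<lambda>y. (y, - (a + b * y) / (c + d * y)))"
      by (intro continuous_intros) (use z2 in auto)
    show "(\<lambda>y. (y, - (a + b * y) / (c + d * y))) ` (UNIV - {0, - a / b, - c / d}) \<subseteq>
      {(y, z). y \<noteq> 0 \<and> z \<noteq> 0 \<and> a + b * y + z * (c + d * y) = 0}"
      using z1 z2 by (auto simp del: minus_add_distrib)
    have *: "c + d * y \<noteq> 0 \<and> a + b * y \<noteq> 0" if "z \<noteq> 0" "a + b * y + z * (c + d * y) = 0" for y z
    proof -
      have "c + d * y \<noteq> 0"
      proof
        assume "c + d * y = 0"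
        with that have "a + b * y = 0" by simp
        with \<open>c + d * y = 0\<close> z1[of y] z2[of y] ne show False by metis
      qed
      with that show ?thesis by auto
    qed
    then show "fst ` {(y, z). y \<noteq> 0 \<and> z \<noteq> 0 \<and> a + b * y + z * (c + d * y) = 0} \<subseteq> UNIV - {0, - a / b, - c / d}"
      using z1 z2 by fastforce
    show "(fst p, - (a + b * fst p) / (c + d * fst p)) = p"
      if "p \<in> {(y, z). y \<noteq> 0 \<and> z \<noteq> 0 \<and> a + b * y + z * (c + d * y) = 0}" for p
    proof -
      obtain y z where p: "p = (y, z)" by (cases p)
      have "z \<noteq> 0" "a + b * y + z * (c + d * y) = 0" using that p by auto
      from *[OF this] have "c + d * y \<noteq> 0" by blast
      moreover from \<open>a + b * y + z * (c + d * y) = 0\<close> have "z * (c + d * y) = - (a + b * y)"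
        by (simp only: add_eq_0_iff)
      ultimately have "- (a + b * y) / (c + d * y) = z"
        by (metis nonzero_mult_div_cancel_right)
      then show ?thesis by (simp only: p fst_conv snd_conv)
    qed
  qed (auto intro!: continuous_intros)
  moreover have "card {0, - a / b, - c / d} = 3" using False nz by (auto simp: field_simps)
  then have "euler (UNIV - {0, - a / b, - c / d}) (-2)"
    using euler_Diff_finite[of "{0, - a / b, - c / d}"] by simp
  ultimately show ?thesis using False euler_homeomorphism by fastforce
qed

context torus_weights
begin

text \<open>All four linear forms are multiples of \<open>x - ra\<close>, so the surface is a
  two-dimensional torus at x = ra together with a bilinear curve times the punctured x-axis.
  \<open>euler_two_components\<close> applies with v = x - ra, where the excluded value
  \<open>- ra\<close> is x = 0.\<close>

theorem euler_Y1_split: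
  assumes z: "minor2 0 W = 0" "minor2 1 W = 0" "minor3 0 W = 0" "minor3 1 W = 0"
  shows "euler (Y1 W) (if minor1 0 W = 0 then 1 else 2)"
proof -
  have eq: "rb = ra" "rc = ra" "rd = ra" using z r_eq_iff by auto
  define M where "M = {(y, z). y \<noteq> 0 \<and> z \<noteq> 0 \<and>
    W 1 0 0 + W 1 1 0 * y + z * (W 1 0 1 + W 1 1 1 * y) = 0}"
  have lin: "fa x = W 1 0 0 * (x - ra)" "fb x = W 1 1 0 * (x - ra)"
    "fc x = W 1 0 1 * (x - ra)" "fd x = W 1 1 1 * (x - ra)" for x
    using eq by (auto simp: fa_def fb_def fc_def fd_def ra_def rb_def rc_def rd_def field_simps)
  have fac: "fa x + fb x * y + z * (fc x + fd x * y) =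
      (x - ra) * (W 1 0 0 + W 1 1 0 * y + z * (W 1 0 1 + W 1 1 1 * y))" for x y z
    unfolding lin by (simp add: algebra_simps)
  \<comment> \<open>\<open>minor1 0 W\<close> is \<open>ra\<^sup>2\<close> times the determinant of
    the bilinear curve, hence decides whether that curve splits.\<close>
  have m: "W 1 0 0 * W 1 1 1 = W 1 1 0 * W 1 0 1 \<longleftrightarrow> minor1 0 W = 0"
  proof -
    have "W 0 0 0 = - ra * W 1 0 0" "W 0 1 0 = - ra * W 1 1 0" "W 0 0 1 = - ra * W 1 0 1"
      "W 0 1 1 = - ra * W 1 1 1"
      using lin[of 0] by (simp_all add: fa_def fb_def fc_def fd_def)
    then have "minor1 0 W = ra\<^sup>2 * (W 1 0 0 * W 1 1 1 - W 1 1 0 * W 1 0 1)"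
      by (simp add: minor1_def algebra_simps power2_eq_square)
    then show ?thesis using r_nz by simp
  qed
  have eM: "euler M (if minor1 0 W = 0 then -1 else -2)"
    using euler_bilinear_curve[of "W 1 0 0" "W 1 1 0" "W 1 0 1" "W 1 1 1"] unfolding m M_def by simp
  define Q where "Q = (UNIV - {0::complex}) \<times> (UNIV - {0::complex})"
  have "euler Q 0" unfolding Q_def
    using euler_Diff_finite[of "{0}"] by (intro euler_Times_punctured_plane) simp
  moreover have "M \<subseteq> Q" by (auto simp: M_def Q_def)
  moreover have "- ra \<noteq> 0" using r_nz by simp
  ultimately have e: "euler {(y, v::complex). y \<in> Q \<and> v \<noteq> - ra \<and> (v = 0 \<or> y \<in> M)}
      (0 - (if minor1 0 W = 0 then -1 else -2))"
    using eM by (intro euler_two_components)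
  have "homeomorphism {(y, v::complex). y \<in> Q \<and> v \<noteq> - ra \<and> (v = 0 \<or> y \<in> M)} (total (UNIV - {0}))
    (\<lambda>p. (snd p + ra, fst (fst p), snd (fst p))) (\<lambda>p. (snd p, fst p - ra))"
    by (intro homeomorphismI)
      (auto simp: total_def fac Q_def M_def add_eq_0_iff2 intro!: continuous_intros)
  from euler_homeomorphism[OF this e] show ?thesis by (simp add: Y1_eq split: if_splits)
qed

end

section \<open>Symmetries and sample points\<close>

lemma euler_Y1_change:
  assumes "\<And>p. p \<in> Y1 W' \<longleftrightarrow> m p \<in> Y1 W" "\<And>p. m (m p) = p"
    "continuous_on (Y1 W) m" "continuous_on (Y1 W') m" "euler (Y1 W) c"
  shows "euler (Y1 W') c"
proof -
  have "homeomorphism (Y1 W) (Y1 W') m m"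
  proof (intro homeomorphismI)
    show "m ` Y1 W \<subseteq> Y1 W'"
    proof (rule image_subsetI)
      fix q assume "q \<in> Y1 W"
      then show "m q \<in> Y1 W'" using assms(1)[of "m q"] assms(2)[of q] by simp
    qed
    show "m ` Y1 W' \<subseteq> Y1 W" using assms(1) by blast
  qed (simp_all add: assms)
  then show ?thesis using assms(5) by (rule euler_homeomorphism)
qed

definition swap12 :: "weights \<Rightarrow> weights" where "swap12 W = (\<lambda>i j k. W j i k)"
definition swap13 :: "weights \<Rightarrow> weights" where "swap13 W = (\<lambda>i j k. W k j i)"
text \<open>\<open>1 - j\<close> exchanges the two indices; on the surface this is y -> 1 / y, up to
  a monomial factor. Likewise \<open>flip3\<close> is z -> 1 / z.\<close>

definition flip2 :: "weights \<Rightarrow> weights" where "flip2 W = (\<lambda>i j k. W i (1 - j) k)"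
definition flip3 :: "weights \<Rightarrow> weights" where "flip3 W = (\<lambda>i j k. W i j (1 - k))"

lemma weight_torus_symmetries:
  assumes "W \<in> weight_torus"
  shows "swap12 W \<in> weight_torus" "swap13 W \<in> weight_torus"
    "flip2 W \<in> weight_torus" "flip3 W \<in> weight_torus"
  using assms by (auto simp: weight_torus_def swap12_def swap13_def flip2_def flip3_def)

lemma swap12_factors [simp]:
  "minor1 i (swap12 W) = minor2 i W" "minor2 i (swap12 W) = minor1 i W"
  "minor3 k (swap12 W) = minor3 k W" "hyperdet (swap12 W) = hyperdet W"
  by (simp_all add: swap12_def minor1_def minor2_def minor3_def hyperdet_def algebra_simps power2_eq_square)

lemma swap13_factors [simp]:
  "minor1 i (swap13 W) = minor3 i W" "minor3 i (swap13 W) = minor1 i W"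
  "minor2 j (swap13 W) = minor2 j W" "hyperdet (swap13 W) = hyperdet W"
  by (simp_all add: swap13_def minor1_def minor2_def minor3_def hyperdet_def algebra_simps power2_eq_square)

lemma flip2_factors [simp]:
  "minor1 i (flip2 W) = - minor1 i W" "minor2 j (flip2 W) = minor2 (1 - j) W"
  "minor3 k (flip2 W) = - minor3 k W" "hyperdet (flip2 W) = hyperdet W"
  by (simp_all add: flip2_def minor1_def minor2_def minor3_def hyperdet_def algebra_simps power2_eq_square)

lemma flip3_factors [simp]:
  "minor1 i (flip3 W) = - minor1 i W" "minor2 j (flip3 W) = - minor2 j W"
  "minor3 k (flip3 W) = minor3 (1 - k) W" "hyperdet (flip3 W) = hyperdet W"
  by (simp_all add: flip3_def minor1_def minor2_def minor3_def hyperdet_def algebra_simps power2_eq_square)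

lemma euler_swap12:
  assumes "euler (Y1 (swap12 W)) c"
  shows "euler (Y1 W) c"
proof (rule euler_Y1_change[OF _ _ _ _ assms, where m = "\<lambda>p. (fst (snd p), fst p, snd (snd p))"])
  have f: "f_pol (swap12 W) k x y = f_pol W k y x" for k x y
    by (simp add: f_pol_def swap12_def algebra_simps)
  show "p \<in> Y1 W \<longleftrightarrow> (fst (snd p), fst p, snd (snd p)) \<in> Y1 (swap12 W)" for p
    by (cases p) (auto simp: Y1_def f)
qed (auto intro!: continuous_intros)

lemma euler_swap13:
  assumes "euler (Y1 (swap13 W)) c"
  shows "euler (Y1 W) c"
proof (rule euler_Y1_change[OF _ _ _ _ assms, where m = "\<lambda>p. (snd (snd p), fst (snd p), fst p)"])
  have f: "f_pol (swap13 W) 0 x y + z * f_pol (swap13 W) 1 x y = f_pol W 0 z y + x * f_pol W 1 z y" for x y z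
    by (simp add: f_pol_def swap13_def algebra_simps)
  show "p \<in> Y1 W \<longleftrightarrow> (snd (snd p), fst (snd p), fst p) \<in> Y1 (swap13 W)" for p
    by (cases p) (auto simp: Y1_def f)
qed (auto intro!: continuous_intros)

lemma euler_flip2:
  assumes "euler (Y1 (flip2 W)) c"
  shows "euler (Y1 W) c"
proof (rule euler_Y1_change[OF _ _ _ _ assms, where m = "\<lambda>p. (fst p, inverse (fst (snd p)), snd (snd p))"])
  have f: "f_pol (flip2 W) k x (inverse y) * y = f_pol W k x y" if "y \<noteq> 0" for k x y
    using that by (simp add: f_pol_def flip2_def field_simps)
  have "f_pol W 0 x y + z * f_pol W 1 x y = 0 \<longleftrightarrow>
      f_pol (flip2 W) 0 x (inverse y) + z * f_pol (flip2 W) 1 x (inverse y) = 0" if "y \<noteq> 0" for x y z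
  proof -
    have "f_pol W 0 x y + z * f_pol W 1 x y =
        (f_pol (flip2 W) 0 x (inverse y) + z * f_pol (flip2 W) 1 x (inverse y)) * y"
      unfolding f[OF that, symmetric] by (simp add: algebra_simps)
    then show ?thesis using that by (metis mult_eq_0_iff)
  qed
  then show "p \<in> Y1 W \<longleftrightarrow> (fst p, inverse (fst (snd p)), snd (snd p)) \<in> Y1 (flip2 W)" for p
    by (cases p) (auto simp: Y1_def)
  show "continuous_on (Y1 V) (\<lambda>p. (fst p, inverse (fst (snd p)), snd (snd p)))" for V
    by (intro continuous_intros) (auto simp: Y1_def)
  then show "continuous_on (Y1 V) (\<lambda>p. (fst p, inverse (fst (snd p)), snd (snd p)))" for V .
qed auto

lemma euler_flip3:
  assumes "euler (Y1 (flip3 W)) c"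
  shows "euler (Y1 W) c"
proof (rule euler_Y1_change[OF _ _ _ _ assms, where m = "\<lambda>p. (fst p, fst (snd p), inverse (snd (snd p)))"])
  have f: "f_pol (flip3 W) k x y = f_pol W (1 - k) x y" for k x y
    by (simp add: f_pol_def flip3_def)
  have "f_pol W 0 x y + z * f_pol W 1 x y = 0 \<longleftrightarrow>
      f_pol (flip3 W) 0 x y + inverse z * f_pol (flip3 W) 1 x y = 0" if "z \<noteq> 0" for x y z
  proof -
    have "f_pol W 0 x y + z * f_pol W 1 x y =
        (f_pol (flip3 W) 0 x y + inverse z * f_pol (flip3 W) 1 x y) * z"
      using that by (simp add: f algebra_simps)
    then show ?thesis using that by (metis mult_eq_0_iff)
  qed
  then show "p \<in> Y1 W \<longleftrightarrow> (fst p, fst (snd p), inverse (snd (snd p))) \<in> Y1 (flip3 W)" for p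
    by (cases p) (auto simp: Y1_def)
  show "continuous_on (Y1 V) (\<lambda>p. (fst p, fst (snd p), inverse (snd (snd p))))" for V
    by (intro continuous_intros) (auto simp: Y1_def)
  then show "continuous_on (Y1 V) (\<lambda>p. (fst p, fst (snd p), inverse (snd (snd p))))" for V .
qed auto

section \<open>Vanishing sets and sample points\<close>

definition vanishing :: "weights \<Rightarrow> (weights \<Rightarrow> complex) set" where
  "vanishing W = {F \<in> EA_factors. F W = 0}"

text \<open>Strata are the fibres of \<open>vanishing\<close>, so finding the nonempty ones means
  finding its values on the torus.\<close>

lemma stratum_iff: "S \<subseteq> EA_factors \<Longrightarrow> W \<in> stratum S \<longleftrightarrow> W \<in> weight_torus \<and> S = vanishing W"
  by (auto simp: stratum_def vanishing_def)

text \<open>\<open>tensor w\<^sub>0\<^sub>0\<^sub>0 w\<^sub>0\<^sub>0\<^sub>1 w\<^sub>0\<^sub>1\<^sub>0 \<dots> w\<^sub>1\<^sub>1\<^sub>1\<close>, in lexicographic order of the indices.\<close>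

definition tensor :: "complex \<Rightarrow> complex \<Rightarrow> complex \<Rightarrow> complex \<Rightarrow> complex \<Rightarrow> complex \<Rightarrow> complex \<Rightarrow> complex \<Rightarrow> weights" where
  "tensor a b c d e f g h = (\<lambda>i j k.
     if i = 0 then if j = 0 then if k = 0 then a else b else if k = 0 then c else d
     else if j = 0 then if k = 0 then e else f else if k = 0 then g else h)"

lemma tensor_factors:
  "minor1 0 (tensor a b c d e f g h) = a * d - c * b"
  "minor1 1 (tensor a b c d e f g h) = e * h - g * f"
  "minor2 0 (tensor a b c d e f g h) = a * f - e * b"
  "minor2 1 (tensor a b c d e f g h) = c * h - g * d"
  "minor3 0 (tensor a b c d e f g h) = a * g - c * e"
  "minor3 1 (tensor a b c d e f g h) = b * h - d * f"
  "hyperdet (tensor a b c d e f g h) = ((a * h - b * g) - (c * f - d * e))\<^sup>2 - 4 * (a * d - c * b) * (e * h - g * f)"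
  by (simp_all add: tensor_def minor1_def minor2_def minor3_def hyperdet_def)

lemma EA_distinct: "distinct [minor1 0, minor1 1, minor2 0, minor2 1, minor3 0, minor3 1, hyperdet]"
proof -
  \<comment> \<open>At this tensor the seven factors take the values 0, -1, -2, 3, -3, 2 and
    25.\<close>
  have "distinct (map (\<lambda>F. F (tensor 1 1 1 1 1 (-1) (-2) 1))
      [minor1 0, minor1 1, minor2 0, minor2 1, minor3 0, minor3 1, hyperdet])"
    by (simp add: tensor_factors)
  then show ?thesis using distinct_map by blast
qed

lemma factors_neq [simp]:
  "minor1 a \<noteq> minor2 b" "minor2 b \<noteq> minor1 a" "minor1 a \<noteq> minor3 c" "minor3 c \<noteq> minor1 a"
  "minor2 b \<noteq> minor3 c" "minor3 c \<noteq> minor2 b" "minor1 a \<noteq> hyperdet" "hyperdet \<noteq> minor1 a"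
  "minor2 b \<noteq> hyperdet" "hyperdet \<noteq> minor2 b" "minor3 c \<noteq> hyperdet" "hyperdet \<noteq> minor3 c"
proof -
  note [simp] = EA_distinct[simplified]
  show *: "minor1 a \<noteq> minor2 b" "minor1 a \<noteq> minor3 c" "minor2 b \<noteq> minor3 c"
    using two_cases[of a] two_cases[of b] two_cases[of c] by (elim disjE; simp)+
  show **: "minor1 a \<noteq> hyperdet" "minor2 b \<noteq> hyperdet" "minor3 c \<noteq> hyperdet"
    using two_cases[of a] two_cases[of b] two_cases[of c] by (elim disjE; simp)+
  show "minor2 b \<noteq> minor1 a" "minor3 c \<noteq> minor1 a" "minor3 c \<noteq> minor2 b"
    "hyperdet \<noteq> minor1 a" "hyperdet \<noteq> minor2 b" "hyperdet \<noteq> minor3 c"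
    using * ** by (auto dest: sym)
qed

lemma factors_inj [simp]:
  "minor1 a = minor1 a' \<longleftrightarrow> a = a'" "minor2 a = minor2 a' \<longleftrightarrow> a = a'" "minor3 a = minor3 a' \<longleftrightarrow> a = a'"
proof -
  have "minor1 0 \<noteq> minor1 1" "minor2 0 \<noteq> minor2 1" "minor3 0 \<noteq> minor3 1"
    using EA_distinct by simp_all
  then show "minor1 a = minor1 a' \<longleftrightarrow> a = a'" "minor2 a = minor2 a' \<longleftrightarrow> a = a'"
    "minor3 a = minor3 a' \<longleftrightarrow> a = a'"
    by (metis two_cases)+
qed

lemma finite_EA [simp]: "finite EA_factors"
  by (simp add: EA_factors_def)

lemma card_EA: "card EA_factors = 7"
  by (simp add: EA_factors_def)

lemma EA_eq: "EA_factors = range minor1 \<union> range minor2 \<union> range minor3 \<union> {hyperdet}"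
  by (auto simp: EA_factors_def UNIV_2)

lemma vanishing_subset: "vanishing W \<subseteq> EA_factors"
  by (auto simp: vanishing_def)

lemma mem_vanishing [simp]:
  "minor1 i \<in> vanishing W \<longleftrightarrow> minor1 i W = 0" "minor2 i \<in> vanishing W \<longleftrightarrow> minor2 i W = 0"
  "minor3 i \<in> vanishing W \<longleftrightarrow> minor3 i W = 0" "hyperdet \<in> vanishing W \<longleftrightarrow> hyperdet W = 0"
  by (auto simp: vanishing_def EA_eq)

lemma card_vanishing:
  "int (card (vanishing W)) = of_bool (minor1 0 W = 0) + of_bool (minor1 1 W = 0) +
     of_bool (minor2 0 W = 0) + of_bool (minor2 1 W = 0) + of_bool (minor3 0 W = 0) +
     of_bool (minor3 1 W = 0) + of_bool (hyperdet W = 0)"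
proof -
  have "int (card (vanishing W)) = (\<Sum>F\<in>EA_factors. of_bool (F W = 0))"
    by (simp add: sum_of_bool_eq vanishing_def Int_def)
  also have "\<dots> = of_bool (minor1 0 W = 0) + of_bool (minor1 1 W = 0) +
     of_bool (minor2 0 W = 0) + of_bool (minor2 1 W = 0) + of_bool (minor3 0 W = 0) +
     of_bool (minor3 1 W = 0) + of_bool (hyperdet W = 0)"
    by (simp add: EA_factors_def)
  finally show ?thesis .
qed

text \<open>As a union of conditional singletons, the vanishing set of a concrete tensor can be
  evaluated by simplification.\<close>

lemma vanishing_eq:
  "vanishing W =
     (if minor1 0 W = 0 then {minor1 0} else {}) \<union> (if minor1 1 W = 0 then {minor1 1} else {}) \<union>
     (if minor2 0 W = 0 then {minor2 0} else {}) \<union> (if minor2 1 W = 0 then {minor2 1} else {}) \<union>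
     (if minor3 0 W = 0 then {minor3 0} else {}) \<union> (if minor3 1 W = 0 then {minor3 1} else {}) \<union>
     (if hyperdet W = 0 then {hyperdet} else {})"
proof -
  have "{F \<in> insert x A. P F} = (if P x then {x} else {}) \<union> {F \<in> A. P F}"
    for x :: "weights \<Rightarrow> complex" and A P by auto
  note ins = this
  show ?thesis unfolding vanishing_def EA_factors_def ins by (simp only: Un_assoc) simp
qed

lemmas vanishing_tensor = vanishing_eq[of "tensor a b c d e f g h" for a b c d e f g h, unfolded tensor_factors]

lemma stratum_tensor_nonempty:
  assumes "a \<noteq> 0" "b \<noteq> 0" "c \<noteq> 0" "d \<noteq> 0" "e \<noteq> 0" "f \<noteq> 0" "g \<noteq> 0" "h \<noteq> 0"
  shows "stratum (vanishing (tensor a b c d e f g h)) \<noteq> {}"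
proof -
  have "tensor a b c d e f g h \<in> weight_torus"
    using assms by (simp add: weight_torus_def tensor_def)
  then show ?thesis using stratum_iff[OF vanishing_subset] by blast
qed

lemma stratum_singleton_nonempty:
  shows
    "stratum {minor1 0} \<noteq> {}"
    "stratum {minor1 1} \<noteq> {}"
    "stratum {minor2 0} \<noteq> {}"
    "stratum {minor2 1} \<noteq> {}"
    "stratum {minor3 0} \<noteq> {}"
    "stratum {minor3 1} \<noteq> {}"
    "stratum {hyperdet} \<noteq> {}"
  subgoal using stratum_tensor_nonempty[of 1 1 1 1 1 2 "-1" 1] by (simp add: vanishing_tensor insert_commute)
  subgoal using stratum_tensor_nonempty[of 1 2 "-1" 1 1 1 1 1] by (simp add: vanishing_tensor insert_commute)
  subgoal using stratum_tensor_nonempty[of 1 1 1 2 1 1 "-1" 1] by (simp add: vanishing_tensor insert_commute)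
  subgoal using stratum_tensor_nonempty[of 1 2 1 1 "-1" 1 1 1] by (simp add: vanishing_tensor insert_commute)
  subgoal using stratum_tensor_nonempty[of 1 1 1 2 1 "-1" 1 1] by (simp add: vanishing_tensor insert_commute)
  subgoal using stratum_tensor_nonempty[of 1 1 2 1 "-1" 1 1 1] by (simp add: vanishing_tensor insert_commute)
  \<comment> \<open>Both minors with the first index fixed are 4, and the square is 64 = 4 * 4 *
    4.\<close>
  subgoal using stratum_tensor_nonempty[of 1 1 "-1" 3 3 "-1" 1 1] by (simp add: vanishing_tensor insert_commute)
  done

lemma stratum_pair_nonempty:
  shows
    "stratum {minor1 0, minor1 1} \<noteq> {}"
    "stratum {minor1 0, minor2 0} \<noteq> {}"
    "stratum {minor1 0, minor2 1} \<noteq> {}"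
    "stratum {minor1 0, minor3 0} \<noteq> {}"
    "stratum {minor1 0, minor3 1} \<noteq> {}"
    "stratum {minor1 0, hyperdet} \<noteq> {}"
    "stratum {minor1 1, minor2 0} \<noteq> {}"
    "stratum {minor1 1, minor2 1} \<noteq> {}"
    "stratum {minor1 1, minor3 0} \<noteq> {}"
    "stratum {minor1 1, minor3 1} \<noteq> {}"
    "stratum {minor1 1, hyperdet} \<noteq> {}"
    "stratum {minor2 0, minor2 1} \<noteq> {}"
    "stratum {minor2 0, minor3 0} \<noteq> {}"
    "stratum {minor2 0, minor3 1} \<noteq> {}"
    "stratum {minor2 0, hyperdet} \<noteq> {}"
    "stratum {minor2 1, minor3 0} \<noteq> {}"
    "stratum {minor2 1, minor3 1} \<noteq> {}"
    "stratum {minor2 1, hyperdet} \<noteq> {}"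
    "stratum {minor3 0, minor3 1} \<noteq> {}"
    "stratum {minor3 0, hyperdet} \<noteq> {}"
    "stratum {minor3 1, hyperdet} \<noteq> {}"
  subgoal using stratum_tensor_nonempty[of 1 1 1 1 1 "-1" "-1" 1] by (simp add: vanishing_tensor insert_commute)
  subgoal using stratum_tensor_nonempty[of 1 1 1 1 1 1 2 "-1"] by (simp add: vanishing_tensor insert_commute)
  subgoal using stratum_tensor_nonempty[of 1 1 1 1 2 "-1" 1 1] by (simp add: vanishing_tensor insert_commute)
  subgoal using stratum_tensor_nonempty[of 1 1 1 1 1 2 1 "-1"] by (simp add: vanishing_tensor insert_commute)
  subgoal using stratum_tensor_nonempty[of 1 1 1 1 2 1 "-1" 1] by (simp add: vanishing_tensor insert_commute)
  subgoal using stratum_tensor_nonempty[of 1 1 1 1 1 "-1" 3 1] by (simp add: vanishing_tensor insert_commute)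
  subgoal using stratum_tensor_nonempty[of 1 1 2 "-1" 1 1 1 1] by (simp add: vanishing_tensor insert_commute)
  subgoal using stratum_tensor_nonempty[of 1 2 1 1 1 1 "-1" "-1"] by (simp add: vanishing_tensor insert_commute)
  subgoal using stratum_tensor_nonempty[of 1 2 1 "-1" 1 1 1 1] by (simp add: vanishing_tensor insert_commute)
  subgoal using stratum_tensor_nonempty[of 1 1 2 1 1 "-1" 1 "-1"] by (simp add: vanishing_tensor insert_commute)
  subgoal using stratum_tensor_nonempty[of 1 "-1" 3 1 1 1 1 1] by (simp add: vanishing_tensor insert_commute)
  subgoal using stratum_tensor_nonempty[of 1 1 1 "-1" 1 1 "-1" 1] by (simp add: vanishing_tensor insert_commute)
  subgoal using stratum_tensor_nonempty[of 1 1 1 2 1 1 1 "-1"] by (simp add: vanishing_tensor insert_commute)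
  subgoal using stratum_tensor_nonempty[of 1 1 2 1 1 1 "-1" 1] by (simp add: vanishing_tensor insert_commute)
  subgoal using stratum_tensor_nonempty[of 1 1 1 "-1" 1 1 3 1] by (simp add: vanishing_tensor insert_commute)
  subgoal using stratum_tensor_nonempty[of 1 2 1 1 1 "-1" 1 1] by (simp add: vanishing_tensor insert_commute)
  subgoal using stratum_tensor_nonempty[of 1 1 1 "-1" 2 1 1 "-1"] by (simp add: vanishing_tensor insert_commute)
  subgoal using stratum_tensor_nonempty[of 1 "-1" 1 1 3 1 1 1] by (simp add: vanishing_tensor insert_commute)
  subgoal using stratum_tensor_nonempty[of 1 1 1 "-1" 1 "-1" 1 1] by (simp add: vanishing_tensor insert_commute)
  subgoal using stratum_tensor_nonempty[of 1 1 1 "-1" 1 3 1 1] by (simp add: vanishing_tensor insert_commute)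
  subgoal using stratum_tensor_nonempty[of 1 1 "-1" 1 3 1 1 1] by (simp add: vanishing_tensor insert_commute)
  done

text \<open>The witnesses for the five-element sets are an invertible 2 by 2 matrix in two of the
  indices, constant in the third. The all-ones tensor has rank one.\<close>

lemma stratum_special_nonempty:
  shows
    "stratum {} \<noteq> {}"
    "stratum {minor1 0, minor1 1, minor2 0, minor2 1, hyperdet} \<noteq> {}"
    "stratum {minor1 0, minor1 1, minor3 0, minor3 1, hyperdet} \<noteq> {}"
    "stratum {minor2 0, minor2 1, minor3 0, minor3 1, hyperdet} \<noteq> {}"
    "stratum {minor1 0, minor1 1, minor2 0, minor2 1, minor3 0, minor3 1, hyperdet} \<noteq> {}"
  subgoal using stratum_tensor_nonempty[of 1 1 1 "-1" "-1" 1 1 1] by (simp add: vanishing_tensor insert_commute)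
  subgoal using stratum_tensor_nonempty[of 1 1 1 1 1 1 "-1" "-1"] by (simp add: vanishing_tensor insert_commute)
  subgoal using stratum_tensor_nonempty[of 1 1 1 1 1 "-1" 1 "-1"] by (simp add: vanishing_tensor insert_commute)
  subgoal using stratum_tensor_nonempty[of 1 1 1 "-1" 1 1 1 "-1"] by (simp add: vanishing_tensor insert_commute)
  subgoal using stratum_tensor_nonempty[of 1 1 1 1 1 1 1 1] by (simp add: vanishing_tensor insert_commute)
  done

text \<open>The only entry -1 sits at the corner opposite to (a, b, c). The three faces through (a,
  b, c) are constant, and each of the other three contains the exceptional corner.\<close>

lemma stratum_triple_nonempty: "stratum {minor1 a, minor2 b, minor3 c} \<noteq> {}"
proof -
  define W :: weights where "W = (\<lambda>i j k. if i = 1 - a \<and> j = 1 - b \<and> k = 1 - c then -1 else 1)"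
  have "W \<in> weight_torus" by (simp add: W_def weight_torus_def)
  moreover have "{minor1 a, minor2 b, minor3 c} = vanishing W"
    using two_cases[of a] two_cases[of b] two_cases[of c]
    by (auto simp: vanishing_def EA_factors_def W_def minor1_def minor2_def minor3_def hyperdet_def)
  ultimately show ?thesis using stratum_iff[OF vanishing_subset] by (metis empty_iff)
qed

section \<open>Relations between the factors\<close>

context torus_weights
begin

text \<open>Each of these minors is a coincidence between a zero of a d and a zero of b c, which is
  a nonzero root of the discriminant.\<close>

lemma disc_common_root:
  assumes "minor2 0 W = 0 \<or> minor2 1 W = 0 \<or> minor3 0 W = 0 \<or> minor3 1 W = 0"
  obtains x where "x \<noteq> 0" "disc x = 0"
proof -
  have "disc ra = 0 \<or> disc rb = 0 \<or> disc rc = 0"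
    using assms zero_iff[of ra] zero_iff[of rb] zero_iff[of rc] unfolding r_eq_iff[symmetric] disc_zero_iff by auto
  then show ?thesis using that r_nz by blast
qed

text \<open>With one outer coefficient zero, \<open>hyperdet W = 0\<close> forces
  \<open>mid = 0\<close>. The quadratic is then a monomial with a nonzero root, hence zero.\<close>

lemma hyperdet_pair:
  assumes "hyperdet W = 0" "minor1 0 W = 0 \<or> minor1 1 W = 0"
    and "minor2 0 W = 0 \<or> minor2 1 W = 0 \<or> minor3 0 W = 0 \<or> minor3 1 W = 0"
  shows "minor1 0 W = 0" "minor1 1 W = 0"
proof -
  obtain x where x: "x \<noteq> 0" "disc x = 0" using disc_common_root[OF assms(3)] .
  have "mid = 0" using assms(1,2) by (auto simp: hyperdet_eq)
  with x assms(2) show "minor1 0 W = 0" "minor1 1 W = 0" by (auto simp: disc_eq)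
qed

lemma pair_hyperdet:
  assumes "minor1 0 W = 0" "minor1 1 W = 0"
    and "minor2 0 W = 0 \<or> minor2 1 W = 0 \<or> minor3 0 W = 0 \<or> minor3 1 W = 0"
  shows "hyperdet W = 0"
proof -
  obtain x where x: "x \<noteq> 0" "disc x = 0" using disc_common_root[OF assms(3)] .
  then have "mid = 0" using assms(1,2) by (auto simp: disc_eq)
  with assms show ?thesis by (simp add: hyperdet_eq)
qed

text \<open>Here a d = b c as polynomials in x. Comparing zeros gives {ra, rd} = {rb, rc}, and the
  two ways of matching are the two cases.\<close>

lemma pair_hyperdet_degenerate:
  assumes "minor1 0 W = 0" "minor1 1 W = 0" "hyperdet W = 0"
  shows "(minor2 0 W = 0 \<and> minor2 1 W = 0) \<or> (minor3 0 W = 0 \<and> minor3 1 W = 0)"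
proof -
  have "mid = 0" using assms by (auto simp: hyperdet_eq)
  then have "disc x = 0" for x using assms by (simp add: disc_eq)
  then have "fa x = 0 \<or> fd x = 0 \<longleftrightarrow> fb x = 0 \<or> fc x = 0" for x
    by (metis disc_zero_iff mult_eq_0_iff)
  then have "x = ra \<or> x = rd \<longleftrightarrow> x = rb \<or> x = rc" for x
    unfolding zero_iff .
  then show ?thesis using r_eq_iff by metis
qed

text \<open>\<open>euler_Y1_empty_fibre\<close> has the vanishing minors at index 0 in both
  directions; inverting y or z moves the other positions there.\<close>

lemma euler_Y1_empty_fibre_flip:
  assumes "minor2 0 W = 0 \<longleftrightarrow> minor2 1 W \<noteq> 0" "minor3 0 W = 0 \<longleftrightarrow> minor3 1 W \<noteq> 0"
    and n: "\<not> (minor1 0 W = 0 \<and> minor1 1 W = 0 \<and> hyperdet W = 0)"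
  shows "euler (Y1 W) (4 - of_bool (minor1 0 W = 0) - of_bool (minor1 1 W = 0) - of_bool (hyperdet W = 0))"
proof -
  have *: "euler (Y1 V) (4 - of_bool (minor1 0 V = 0) - of_bool (minor1 1 V = 0) - of_bool (hyperdet V = 0))"
    if "V \<in> weight_torus" "minor2 0 V = 0" "minor2 1 V \<noteq> 0" "minor3 0 V = 0 \<longleftrightarrow> minor3 1 V \<noteq> 0"
      "\<not> (minor1 0 V = 0 \<and> minor1 1 V = 0 \<and> hyperdet V = 0)" for V
  proof (cases "minor3 0 V = 0")
    case True
    then show ?thesis using that by (intro torus_weights.euler_Y1_empty_fibre torus_weights.intro) auto
  next
    case False
    then have "euler (Y1 (flip3 V)) (4 - of_bool (minor1 0 (flip3 V) = 0) -
        of_bool (minor1 1 (flip3 V) = 0) - of_bool (hyperdet (flip3 V) = 0))"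
      using that by (intro torus_weights.euler_Y1_empty_fibre torus_weights.intro weight_torus_symmetries) auto
    from euler_flip3[OF this] show ?thesis by simp
  qed
  show ?thesis
  proof (cases "minor2 0 W = 0")
    case True
    then show ?thesis using assms W by (intro *) auto
  next
    case False
    then have "euler (Y1 (flip2 W)) (4 - of_bool (minor1 0 (flip2 W) = 0) -
        of_bool (minor1 1 (flip2 W) = 0) - of_bool (hyperdet (flip2 W) = 0))"
      using assms W by (intro * weight_torus_symmetries) auto
    from euler_flip2[OF this] show ?thesis by simp
  qed
qed

text \<open>Describes when projection to the x-axis works: the discriminant is not the zero
  polynomial, and every root is a node, apart from one root with empty fibre in the second
  alternative.\<close>

definition balanced :: bool where
  "balanced \<longleftrightarrow> \<not> (minor1 0 W = 0 \<and> minor1 1 W = 0 \<and> hyperdet W = 0) \<and>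
    ((minor2 0 W \<noteq> 0 \<and> minor2 1 W \<noteq> 0 \<and> minor3 0 W \<noteq> 0 \<and> minor3 1 W \<noteq> 0) \<or>
     ((minor2 0 W = 0 \<longleftrightarrow> minor2 1 W \<noteq> 0) \<and> (minor3 0 W = 0 \<longleftrightarrow> minor3 1 W \<noteq> 0)))"

lemma euler_balanced:
  assumes balanced
  shows "euler (Y1 W) (6 - int (card (vanishing W)))"
proof (cases "minor2 0 W \<noteq> 0 \<and> minor2 1 W \<noteq> 0 \<and> minor3 0 W \<noteq> 0 \<and> minor3 1 W \<noteq> 0")
  case True
  then have "6 - int (card (vanishing W)) =
      6 - of_bool (minor1 0 W = 0) - of_bool (minor1 1 W = 0) - of_bool (hyperdet W = 0)"
    by (simp add: card_vanishing)
  moreover have "\<not> (minor1 0 W = 0 \<and> minor1 1 W = 0 \<and> hyperdet W = 0)"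
    using assms by (simp add: balanced_def)
  ultimately show ?thesis using euler_Y1_nodal_fibres True by metis
next
  case False
  then have b: "minor2 0 W = 0 \<longleftrightarrow> minor2 1 W \<noteq> 0" "minor3 0 W = 0 \<longleftrightarrow> minor3 1 W \<noteq> 0"
    "\<not> (minor1 0 W = 0 \<and> minor1 1 W = 0 \<and> hyperdet W = 0)"
    using assms unfolding balanced_def by blast+
  have "6 - int (card (vanishing W)) =
      4 - of_bool (minor1 0 W = 0) - of_bool (minor1 1 W = 0) - of_bool (hyperdet W = 0)"
    using b(1,2) by (auto simp: card_vanishing)
  then show ?thesis using euler_Y1_empty_fibre_flip[OF b] by metis
qed

end

lemma card_vanishing_swap:
  "card (vanishing (swap12 W)) = card (vanishing W)" "card (vanishing (swap13 W)) = card (vanishing W)"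
proof -
  have "int (card (vanishing (swap12 W))) = int (card (vanishing W))"
    "int (card (vanishing (swap13 W))) = int (card (vanishing W))"
    by (simp_all add: card_vanishing)
  then show "card (vanishing (swap12 W)) = card (vanishing W)" "card (vanishing (swap13 W)) = card (vanishing W)"
    by simp_all
qed

lemma euler_some_balanced:
  assumes W: "W \<in> weight_torus"
    and "torus_weights.balanced W \<or> torus_weights.balanced (swap12 W) \<or> torus_weights.balanced (swap13 W)"
  shows "euler (Y1 W) (6 - int (card (vanishing W)))"
  using assms(2)
proof (elim disjE)
  assume "torus_weights.balanced W"
  then show ?thesis using W by (intro torus_weights.euler_balanced torus_weights.intro)
next
  assume "torus_weights.balanced (swap12 W)"
  then have "euler (Y1 (swap12 W)) (6 - int (card (vanishing (swap12 W))))"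
    using W by (intro torus_weights.euler_balanced torus_weights.intro weight_torus_symmetries)
  from euler_swap12[OF this] show ?thesis by (simp add: card_vanishing_swap)
next
  assume "torus_weights.balanced (swap13 W)"
  then have "euler (Y1 (swap13 W)) (6 - int (card (vanishing (swap13 W))))"
    using W by (intro torus_weights.euler_balanced torus_weights.intro weight_torus_symmetries)
  from euler_swap13[OF this] show ?thesis by (simp add: card_vanishing_swap)
qed

section \<open>The strata\<close>

lemma all_2: "(\<forall>j::2. P j) \<longleftrightarrow> P 0 \<and> P 1"
  by (metis two_cases)

text \<open>Three relations singling out the first index, carried to the other two indices by the
  swaps.\<close>

lemma factor_relations:
  assumes W: "W \<in> weight_torus"
  shows "hyperdet W = 0 \<Longrightarrow> minor1 i W = 0 \<Longrightarrow> minor2 j W = 0 \<or> minor3 j W = 0 \<Longrightarrow> minor1 i' W = 0"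
    "hyperdet W = 0 \<Longrightarrow> minor2 i W = 0 \<Longrightarrow> minor1 j W = 0 \<or> minor3 j W = 0 \<Longrightarrow> minor2 i' W = 0"
    "hyperdet W = 0 \<Longrightarrow> minor3 i W = 0 \<Longrightarrow> minor1 j W = 0 \<or> minor2 j W = 0 \<Longrightarrow> minor3 i' W = 0"
    "minor1 0 W = 0 \<Longrightarrow> minor1 1 W = 0 \<Longrightarrow> minor2 j W = 0 \<or> minor3 j W = 0 \<Longrightarrow> hyperdet W = 0"
    "minor2 0 W = 0 \<Longrightarrow> minor2 1 W = 0 \<Longrightarrow> minor1 j W = 0 \<or> minor3 j W = 0 \<Longrightarrow> hyperdet W = 0"
    "minor3 0 W = 0 \<Longrightarrow> minor3 1 W = 0 \<Longrightarrow> minor1 j W = 0 \<or> minor2 j W = 0 \<Longrightarrow> hyperdet W = 0"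
    "minor1 0 W = 0 \<Longrightarrow> minor1 1 W = 0 \<Longrightarrow> hyperdet W = 0 \<Longrightarrow> (\<forall>j. minor2 j W = 0) \<or> (\<forall>j. minor3 j W = 0)"
    "minor2 0 W = 0 \<Longrightarrow> minor2 1 W = 0 \<Longrightarrow> hyperdet W = 0 \<Longrightarrow> (\<forall>j. minor1 j W = 0) \<or> (\<forall>j. minor3 j W = 0)"
    "minor3 0 W = 0 \<Longrightarrow> minor3 1 W = 0 \<Longrightarrow> hyperdet W = 0 \<Longrightarrow> (\<forall>j. minor1 j W = 0) \<or> (\<forall>j. minor2 j W = 0)"
proof -
  have 1: "minor1 i' V = 0" if "V \<in> weight_torus" "hyperdet V = 0" "minor1 i V = 0" "minor2 j V = 0 \<or> minor3 j V = 0" for V i i' j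
  proof -
    have "minor1 0 V = 0 \<or> minor1 1 V = 0" using that(3) two_cases[of i] by (elim disjE) simp_all
    moreover have "minor2 0 V = 0 \<or> minor2 1 V = 0 \<or> minor3 0 V = 0 \<or> minor3 1 V = 0"
      using that(4) two_cases[of j] by (elim disjE) simp_all
    ultimately have "minor1 0 V = 0" "minor1 1 V = 0"
      using torus_weights.hyperdet_pair[OF torus_weights.intro[OF that(1)] that(2)] by blast+
    then show ?thesis using two_cases[of i'] by (elim disjE) simp_all
  qed
  have 2: "hyperdet V = 0" if "V \<in> weight_torus" "minor1 0 V = 0" "minor1 1 V = 0" "minor2 j V = 0 \<or> minor3 j V = 0" for V j
  proof -
    have "minor2 0 V = 0 \<or> minor2 1 V = 0 \<or> minor3 0 V = 0 \<or> minor3 1 V = 0"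
      using that(4) two_cases[of j] by (elim disjE) simp_all
    then show ?thesis
      by (rule torus_weights.pair_hyperdet[OF torus_weights.intro[OF that(1)] that(2,3)])
  qed
  have 3: "(\<forall>j. minor2 j V = 0) \<or> (\<forall>j. minor3 j V = 0)"
    if "V \<in> weight_torus" "minor1 0 V = 0" "minor1 1 V = 0" "hyperdet V = 0" for V
    using torus_weights.pair_hyperdet_degenerate[OF torus_weights.intro, of V] that by (simp add: all_2)
  note s = weight_torus_symmetries(1,2)[OF W]
  show "hyperdet W = 0 \<Longrightarrow> minor1 i W = 0 \<Longrightarrow> minor2 j W = 0 \<or> minor3 j W = 0 \<Longrightarrow> minor1 i' W = 0"
    using 1[OF W] .
  show "hyperdet W = 0 \<Longrightarrow> minor2 i W = 0 \<Longrightarrow> minor1 j W = 0 \<or> minor3 j W = 0 \<Longrightarrow> minor2 i' W = 0"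
    using 1[OF s(1), of i j i'] by simp
  show "hyperdet W = 0 \<Longrightarrow> minor3 i W = 0 \<Longrightarrow> minor1 j W = 0 \<or> minor2 j W = 0 \<Longrightarrow> minor3 i' W = 0"
    using 1[OF s(2), of i j i'] by auto
  show "minor1 0 W = 0 \<Longrightarrow> minor1 1 W = 0 \<Longrightarrow> minor2 j W = 0 \<or> minor3 j W = 0 \<Longrightarrow> hyperdet W = 0"
    using 2[OF W] .
  show "minor2 0 W = 0 \<Longrightarrow> minor2 1 W = 0 \<Longrightarrow> minor1 j W = 0 \<or> minor3 j W = 0 \<Longrightarrow> hyperdet W = 0"
    using 2[OF s(1), of j] by simp
  show "minor3 0 W = 0 \<Longrightarrow> minor3 1 W = 0 \<Longrightarrow> minor1 j W = 0 \<or> minor2 j W = 0 \<Longrightarrow> hyperdet W = 0"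
    using 2[OF s(2), of j] by auto
  show "minor1 0 W = 0 \<Longrightarrow> minor1 1 W = 0 \<Longrightarrow> hyperdet W = 0 \<Longrightarrow> (\<forall>j. minor2 j W = 0) \<or> (\<forall>j. minor3 j W = 0)"
    using 3[OF W] .
  show "minor2 0 W = 0 \<Longrightarrow> minor2 1 W = 0 \<Longrightarrow> hyperdet W = 0 \<Longrightarrow> (\<forall>j. minor1 j W = 0) \<or> (\<forall>j. minor3 j W = 0)"
    using 3[OF s(1)] by simp
  show "minor3 0 W = 0 \<Longrightarrow> minor3 1 W = 0 \<Longrightarrow> hyperdet W = 0 \<Longrightarrow> (\<forall>j. minor1 j W = 0) \<or> (\<forall>j. minor2 j W = 0)"
    using 3[OF s(2)] by auto
qed

text \<open>The letters stand for the vanishing of the three parallel pairs, the summand 1 for the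
  hyperdeterminant. The first three conditions complete a pair as soon as another direction is
  involved; the next three rule out a single complete pair.\<close>

lemma paired_pattern:
  assumes "(A0 \<or> A1) \<and> (B0 \<or> B1 \<or> C0 \<or> C1) \<longrightarrow> A0 \<and> A1"
    "(B0 \<or> B1) \<and> (A0 \<or> A1 \<or> C0 \<or> C1) \<longrightarrow> B0 \<and> B1"
    "(C0 \<or> C1) \<and> (A0 \<or> A1 \<or> B0 \<or> B1) \<longrightarrow> C0 \<and> C1"
    "A0 \<and> A1 \<longrightarrow> B0 \<and> B1 \<or> C0 \<and> C1" "B0 \<and> B1 \<longrightarrow> A0 \<and> A1 \<or> C0 \<and> C1"
    "C0 \<and> C1 \<longrightarrow> A0 \<and> A1 \<or> B0 \<and> B1"
    "3 \<le> (of_bool A0 + of_bool A1 + of_bool B0 + of_bool B1 + of_bool C0 + of_bool C1 + 1 :: int)"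
  shows "A0 = A1 \<and> B0 = B1 \<and> C0 = C1 \<and> (A0 \<and> B0 \<or> A0 \<and> C0 \<or> B0 \<and> C0)"
  using assms by (cases A0; cases A1; cases B0; cases B1; cases C0; cases C1) simp_all

lemma vanishing_cases:
  assumes W: "W \<in> weight_torus"
  obtains "card (vanishing W) \<le> 2"
    | a b c where "vanishing W = {minor1 a, minor2 b, minor3 c}"
    | "vanishing W = {hyperdet, minor1 0, minor1 1, minor2 0, minor2 1}"
    | "vanishing W = {hyperdet, minor1 0, minor1 1, minor3 0, minor3 1}"
    | "vanishing W = {hyperdet, minor2 0, minor2 1, minor3 0, minor3 1}"
    | "vanishing W = EA_factors"
proof (cases "card (vanishing W) \<le> 2")
  case False
  then have N: "int (card (vanishing W)) \<ge> 3" by simp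
  note rel = factor_relations[OF W]
  show ?thesis
  proof (cases "hyperdet W = 0")
    case True
    have "(minor1 0 W = 0 \<or> minor1 1 W = 0) \<and> (minor2 0 W = 0 \<or> minor2 1 W = 0 \<or> minor3 0 W = 0 \<or> minor3 1 W = 0)
        \<longrightarrow> minor1 0 W = 0 \<and> minor1 1 W = 0"
      "(minor2 0 W = 0 \<or> minor2 1 W = 0) \<and> (minor1 0 W = 0 \<or> minor1 1 W = 0 \<or> minor3 0 W = 0 \<or> minor3 1 W = 0)
        \<longrightarrow> minor2 0 W = 0 \<and> minor2 1 W = 0"
      "(minor3 0 W = 0 \<or> minor3 1 W = 0) \<and> (minor1 0 W = 0 \<or> minor1 1 W = 0 \<or> minor2 0 W = 0 \<or> minor2 1 W = 0)
        \<longrightarrow> minor3 0 W = 0 \<and> minor3 1 W = 0"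
      using rel(1-3)[OF True] by blast+
    moreover have "minor1 0 W = 0 \<and> minor1 1 W = 0 \<longrightarrow>
        minor2 0 W = 0 \<and> minor2 1 W = 0 \<or> minor3 0 W = 0 \<and> minor3 1 W = 0"
      "minor2 0 W = 0 \<and> minor2 1 W = 0 \<longrightarrow>
        minor1 0 W = 0 \<and> minor1 1 W = 0 \<or> minor3 0 W = 0 \<and> minor3 1 W = 0"
      "minor3 0 W = 0 \<and> minor3 1 W = 0 \<longrightarrow>
        minor1 0 W = 0 \<and> minor1 1 W = 0 \<or> minor2 0 W = 0 \<and> minor2 1 W = 0"
      using rel(7-9)[OF _ _ True] by blast+
    moreover have "3 \<le> (of_bool (minor1 0 W = 0) + of_bool (minor1 1 W = 0) +
        of_bool (minor2 0 W = 0) + of_bool (minor2 1 W = 0) + of_bool (minor3 0 W = 0) +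
        of_bool (minor3 1 W = 0) + 1 :: int)"
      using N True by (simp add: card_vanishing)
    ultimately have "(minor1 0 W = 0) = (minor1 1 W = 0) \<and> (minor2 0 W = 0) = (minor2 1 W = 0) \<and>
        (minor3 0 W = 0) = (minor3 1 W = 0) \<and>
        (minor1 0 W = 0 \<and> minor2 0 W = 0 \<or> minor1 0 W = 0 \<and> minor3 0 W = 0 \<or> minor2 0 W = 0 \<and> minor3 0 W = 0)"
      by (rule paired_pattern)
    then consider "minor1 0 W = 0" "minor1 1 W = 0" "minor2 0 W = 0" "minor2 1 W = 0" "minor3 0 W \<noteq> 0" "minor3 1 W \<noteq> 0"
      | "minor1 0 W = 0" "minor1 1 W = 0" "minor2 0 W \<noteq> 0" "minor2 1 W \<noteq> 0" "minor3 0 W = 0" "minor3 1 W = 0"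
      | "minor1 0 W \<noteq> 0" "minor1 1 W \<noteq> 0" "minor2 0 W = 0" "minor2 1 W = 0" "minor3 0 W = 0" "minor3 1 W = 0"
      | "minor1 0 W = 0" "minor1 1 W = 0" "minor2 0 W = 0" "minor2 1 W = 0" "minor3 0 W = 0" "minor3 1 W = 0"
      by blast
    then show ?thesis
    proof cases
      case 1 then show ?thesis using True by (intro that(3)) (auto simp: vanishing_eq)
    next
      case 2 then show ?thesis using True by (intro that(4)) (auto simp: vanishing_eq)
    next
      case 3 then show ?thesis using True by (intro that(5)) (auto simp: vanishing_eq)
    next
      case 4 then show ?thesis using True by (intro that(6)) (auto simp: vanishing_eq EA_factors_def)
    qed
  next
    case H: False
    \<comment> \<open>While the hyperdeterminant is nonzero, a complete pair excludes all minors of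
      other directions, so three vanishing factors need exactly one minor from each pair.\<close>
    then have r: "\<forall>j. \<not> (minor1 0 W = 0 \<and> minor1 1 W = 0 \<and> (minor2 j W = 0 \<or> minor3 j W = 0))"
      "\<forall>j. \<not> (minor2 0 W = 0 \<and> minor2 1 W = 0 \<and> (minor1 j W = 0 \<or> minor3 j W = 0))"
      "\<forall>j. \<not> (minor3 0 W = 0 \<and> minor3 1 W = 0 \<and> (minor1 j W = 0 \<or> minor2 j W = 0))"
      using rel(4-6) by blast+
    have "(minor1 0 W = 0 \<longleftrightarrow> minor1 1 W \<noteq> 0) \<and> (minor2 0 W = 0 \<longleftrightarrow> minor2 1 W \<noteq> 0) \<and>
        (minor3 0 W = 0 \<longleftrightarrow> minor3 1 W \<noteq> 0)"
      using N H r unfolding card_vanishing all_2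
      by (cases "minor1 0 W = 0"; cases "minor1 1 W = 0"; cases "minor2 0 W = 0";
        cases "minor2 1 W = 0"; cases "minor3 0 W = 0"; cases "minor3 1 W = 0"; simp)
    then obtain a b c :: 2 where "minor1 a W = 0" "minor1 (1 - a) W \<noteq> 0" "minor2 b W = 0"
      "minor2 (1 - b) W \<noteq> 0" "minor3 c W = 0" "minor3 (1 - c) W \<noteq> 0"
      by (metis diff_zero diff_self)
    with H have "vanishing W = {minor1 a, minor2 b, minor3 c}"
      using two_cases[of a] two_cases[of b] two_cases[of c] by (elim disjE) (simp_all add: vanishing_eq insert_commute)
    then show ?thesis by (rule that(2))
  qed
qed (rule that(1))

lemma strata_class_4:
  "strata_class 4 = {{hyperdet, minor1 0, minor1 1, minor2 0, minor2 1},
     {hyperdet, minor1 0, minor1 1, minor3 0, minor3 1},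
     {hyperdet, minor2 0, minor2 1, minor3 0, minor3 1}}"
  (is "_ = ?R")
proof (intro subset_antisym subsetI)
  fix S assume "S \<in> strata_class 4"
  then obtain P Q where PQ: "P \<in> parallel_pairs" "Q \<in> parallel_pairs" "P \<noteq> Q"
    "S = insert hyperdet (P \<union> Q)" by (auto simp: strata_class_def)
  from PQ(1,2,3) show "S \<in> ?R"
    unfolding parallel_pairs_def PQ(4) by (elim insertE emptyE) (simp_all add: insert_commute)
next
  have ne: "{minor1 0, minor1 1} \<noteq> {minor2 0, minor2 1}" "{minor1 0, minor1 1} \<noteq> {minor3 0, minor3 1}"
    "{minor2 0, minor2 1} \<noteq> {minor3 0, minor3 1}" by (auto simp: doubleton_eq_iff)
  have mem: "insert hyperdet (P \<union> Q) \<in> strata_class 4"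
    if "P \<in> parallel_pairs" "Q \<in> parallel_pairs" "P \<noteq> Q" for P Q
    using that by (auto simp: strata_class_def)
  fix S assume "S \<in> ?R"
  then show "S \<in> strata_class 4"
    using mem[OF _ _ ne(1)] mem[OF _ _ ne(2)] mem[OF _ _ ne(3)]
    by (elim insertE emptyE) (simp_all add: parallel_pairs_def insert_commute)
qed

lemma strata_class_simps:
  "strata_class 0 = {{}}" "strata_class (Suc 0) = {S. S \<subseteq> EA_factors \<and> card S = 1}"
  "strata_class 1 = {S. S \<subseteq> EA_factors \<and> card S = 1}"
  "strata_class 2 = {S. S \<subseteq> EA_factors \<and> card S = 2}"
  "strata_class 3 = {{minor1 a, minor2 b, minor3 c} | a b c. True}"
  "strata_class 5 = {EA_factors}"
  by (simp_all add: strata_class_def)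

lemma UN_atMost_5: "(\<Union>n\<le>5. strata_class n) = strata_class 0 \<union> strata_class 1 \<union> strata_class 2 \<union>
    strata_class 3 \<union> strata_class 4 \<union> strata_class 5"
proof -
  have "{..5::nat} = {0, 1, 2, 3, 4, 5}" by auto
  then show ?thesis by auto
qed

lemma stratum_small_nonempty:
  assumes "S \<subseteq> EA_factors" "card S \<le> 2"
  shows "stratum S \<noteq> {}"
proof -
  have fin: "finite S" by (rule finite_subset[OF assms(1) finite_EA])
  consider "card S = 0" | "card S = 1" | "card S = 2" using assms(2) by linarith
  then show ?thesis
  proof cases
    case 1
    then show ?thesis using fin stratum_special_nonempty by simp
  next
    case 2
    then obtain F where "S = {F}" by (auto simp: card_1_singleton_iff)
    with assms(1) show ?thesis using stratum_singleton_nonempty by (auto simp: EA_factors_def)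
  next
    case 3
    then obtain F G where FG: "S = {F, G}" "F \<noteq> G" by (auto simp: card_2_iff)
    with assms(1) have "F \<in> EA_factors" "G \<in> EA_factors" by auto
    then show ?thesis
      using FG(2) stratum_pair_nonempty stratum_pair_nonempty[unfolded insert_commute[of _ _ "{}"]] unfolding FG(1) EA_factors_def
      by (elim insertE emptyE) (simp_all add: insert_commute)
  qed
qed

lemma nonempty_strata:
  "{S. S \<subseteq> EA_factors \<and> stratum S \<noteq> {}} = (\<Union>n\<le>5. strata_class n)"
proof (intro subset_antisym subsetI)
  fix S assume "S \<in> {S. S \<subseteq> EA_factors \<and> stratum S \<noteq> {}}"
  then obtain W where S: "S \<subseteq> EA_factors" and "W \<in> stratum S" by auto
  then have W: "W \<in> weight_torus" and SW: "S = vanishing W" by (auto simp: stratum_iff)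
  from W show "S \<in> (\<Union>n\<le>5. strata_class n)"
  proof (cases W rule: vanishing_cases)
    case 1
    then consider "card S = 0" | "card S = 1" | "card S = 2" unfolding SW by linarith
    moreover have "finite S" by (rule finite_subset[OF S finite_EA])
    ultimately show ?thesis using S unfolding UN_atMost_5 strata_class_simps by cases auto
  next
    case (2 a b c)
    then show ?thesis unfolding UN_atMost_5 strata_class_simps SW by blast
  qed (simp_all add: UN_atMost_5 strata_class_simps strata_class_4 SW)
next
  fix S assume "S \<in> (\<Union>n\<le>5. strata_class n)"
  then consider "S \<subseteq> EA_factors" "card S \<le> 2" | "S \<in> strata_class 3" | "S \<in> strata_class 4" | "S = EA_factors"
    unfolding UN_atMost_5 strata_class_simps by auto
  then show "S \<in> {S. S \<subseteq> EA_factors \<and> stratum S \<noteq> {}}"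
  proof cases
    case 1
    then show ?thesis using stratum_small_nonempty by simp
  next
    case 2
    then show ?thesis using stratum_triple_nonempty by (auto simp: strata_class_simps EA_eq)
  next
    case 3
    then show ?thesis using stratum_special_nonempty
      unfolding strata_class_4 by (elim insertE emptyE) (simp_all add: EA_factors_def insert_commute)
  next
    case 4
    then show ?thesis using stratum_special_nonempty by (simp add: EA_factors_def)
  qed
qed

lemma card_strata_classes:
  "card (strata_class 0) = 1" "card (strata_class 1) = 7" "card (strata_class 2) = 7 choose 2"
  "card (strata_class 3) = 8" "card (strata_class 4) = 3" "card (strata_class 5) = 1"
proof -
  show "card (strata_class 1) = 7" "card (strata_class 2) = 7 choose 2"
    by (simp_all add: strata_class_simps n_subsets card_EA choose_one del: One_nat_def)
  have "strata_class 3 = (\<lambda>(a, b, c). {minor1 a, minor2 b, minor3 c}) ` UNIV"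
    by (auto simp: strata_class_simps image_def)
  moreover have "inj (\<lambda>(a, b, c). {minor1 a, minor2 b, minor3 c})"
  proof (rule injI)
    fix p q :: "2 \<times> 2 \<times> 2"
    obtain a b c a' b' c' where pq: "p = (a, b, c)" "q = (a', b', c')" by (metis prod_cases3)
    assume "(case p of (a, b, c) \<Rightarrow> {minor1 a, minor2 b, minor3 c}) =
      (case q of (a, b, c) \<Rightarrow> {minor1 a, minor2 b, minor3 c})"
    then have eq: "{minor1 a, minor2 b, minor3 c} = {minor1 a', minor2 b', minor3 c'}"
      by (simp add: pq)
    have "minor1 a \<in> {minor1 a', minor2 b', minor3 c'}" "minor2 b \<in> {minor1 a', minor2 b', minor3 c'}"
      "minor3 c \<in> {minor1 a', minor2 b', minor3 c'}" unfolding eq[symmetric] by auto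
    then show "p = q" by (simp add: pq)
  qed
  ultimately have "card (strata_class 3) = card (UNIV :: (2 \<times> 2 \<times> 2) set)"
    by (simp only: card_image)
  then show "card (strata_class 3) = 8" by (simp add: card_UNIV_def)
  have "{hyperdet, minor1 0, minor1 1, minor2 0, minor2 1} \<noteq> {hyperdet, minor1 0, minor1 1, minor3 0, minor3 1}"
    "{hyperdet, minor1 0, minor1 1, minor2 0, minor2 1} \<noteq> {hyperdet, minor2 0, minor2 1, minor3 0, minor3 1}"
    "{hyperdet, minor1 0, minor1 1, minor3 0, minor3 1} \<noteq> {hyperdet, minor2 0, minor2 1, minor3 0, minor3 1}"
    by (metis factors_neq(1,3,5,7) insert_iff singleton_iff)+
  then show "card (strata_class 4) = 3" by (simp add: strata_class_4)
qed (simp_all add: strata_class_simps)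

lemma card_in_strata_class:
  "S \<in> strata_class 0 \<Longrightarrow> card S = 0" "S \<in> strata_class 1 \<Longrightarrow> card S = 1"
  "S \<in> strata_class 2 \<Longrightarrow> card S = 2" "S \<in> strata_class 3 \<Longrightarrow> card S = 3"
  "S \<in> strata_class 4 \<Longrightarrow> card S = 5" "S \<in> strata_class 5 \<Longrightarrow> card S = 7"
  using card_EA by (auto simp: strata_class_simps strata_class_4)

text \<open>The classes are disjoint because their members have sizes 0, 1, 2, 3, 5 and 7; the count
  is 1 + 7 + 21 + 8 + 3 + 1.\<close>

lemma card_all_strata: "card (\<Union>n\<le>5. strata_class n) = 41"
proof -
  have fin: "finite (strata_class n)" if "n \<le> 5" for n
  proof (rule finite_subset)
    show "strata_class n \<subseteq> Pow EA_factors"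
      using nonempty_strata that by blast
  qed simp
  define k :: "nat \<Rightarrow> nat" where "k n = (if n \<le> 3 then n else if n = 4 then 5 else 7)" for n
  have five: "{..5::nat} = {0, 1, 2, 3, 4, 5}" by auto
  have "card S = k n" if "S \<in> strata_class n" "n \<le> 5" for S n
  proof -
    have "n = 0 \<or> n = 1 \<or> n = 2 \<or> n = 3 \<or> n = 4 \<or> n = 5" using that(2) by linarith
    then show ?thesis using that(1) card_in_strata_class[of S] by (elim disjE) (simp_all add: k_def)
  qed
  moreover have "inj_on k {..5}" unfolding five by (auto simp: k_def)
  ultimately have "disjoint_family_on strata_class {..5}"
    by (auto simp: disjoint_family_on_def) (metis atMost_iff inj_onD)
  then have "card (\<Union>n\<le>5. strata_class n) = (\<Sum>n\<le>5. card (strata_class n))"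
    using fin by (intro card_UN_disjoint') auto
  also have "\<dots> = 41"
    unfolding five using card_strata_classes by (simp add: choose_two del: One_nat_def)
  finally show ?thesis .
qed

text \<open>If the vanishing minors lie in one direction, that direction becomes the first index; if
  they lie in two, the third direction does. Two factors allow nothing else.\<close>

lemma balanced_of_card:
  assumes W: "W \<in> weight_torus" and "card (vanishing W) \<le> 2"
  shows "torus_weights.balanced W \<or> torus_weights.balanced (swap12 W) \<or> torus_weights.balanced (swap13 W)"
proof -
  have t: "torus_weights W" "torus_weights (swap12 W)" "torus_weights (swap13 W)"
    using W weight_torus_symmetries by (auto simp: torus_weights_def)
  have "int (card (vanishing W)) \<le> 2" using assms(2) by simp
  then show ?thesis
    unfolding t[THEN torus_weights.balanced_def] swap12_factors swap13_factors card_vanishing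
    by (cases "minor1 0 W = 0"; cases "minor1 1 W = 0"; cases "minor2 0 W = 0";
        cases "minor2 1 W = 0"; cases "minor3 0 W = 0"; cases "minor3 1 W = 0"; cases "hyperdet W = 0"; simp)
qed

section \<open>Euler characteristic on each class\<close>

lemma euler_small_stratum:
  assumes "S \<subseteq> EA_factors" "card S \<le> 2" "W \<in> stratum S"
  shows "euler (Y1 W) (6 - int (card S))"
  using assms balanced_of_card euler_some_balanced by (auto simp: stratum_iff)

lemma euler_class_3:
  assumes "S \<in> strata_class 3" "W \<in> stratum S"
  shows "euler (Y1 W) 3"
proof -
  obtain a b c where S: "S = {minor1 a, minor2 b, minor3 c}" using assms by (auto simp: strata_class_simps)
  then have "S \<subseteq> EA_factors" by (auto simp: EA_eq)
  then have W: "W \<in> weight_torus" and SW: "S = vanishing W" using assms by (auto simp: stratum_iff)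
  have v: "minor1 i W = 0 \<longleftrightarrow> i = a" "minor2 i W = 0 \<longleftrightarrow> i = b" "minor3 i W = 0 \<longleftrightarrow> i = c"
    "hyperdet W \<noteq> 0" for i
    by (simp_all add: S flip: mem_vanishing SW)
  \<comment> \<open>One minor of each pair vanishes, which is the empty-fibre alternative without a
    change of coordinates.\<close>
  have "torus_weights.balanced W"
    unfolding torus_weights.balanced_def[OF torus_weights.intro[OF W]] v
    using v(4) two_cases[of b] two_cases[of c] by (elim disjE) simp_all
  moreover have "card (vanishing W) = 3" unfolding SW[symmetric] S by simp
  ultimately show ?thesis using euler_some_balanced[OF W] by simp
qed

lemma euler_class_4:
  assumes "S \<in> strata_class 4" "W \<in> stratum S"
  shows "euler (Y1 W) 2"
proof -
  have "S \<subseteq> EA_factors" using assms(1) unfolding strata_class_4 EA_factors_def by auto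
  then have W: "W \<in> weight_torus" and SW: "S = vanishing W" using assms by (auto simp: stratum_iff)
  have C: "euler (Y1 V) 2" if "V \<in> weight_torus" "minor2 0 V = 0" "minor2 1 V = 0"
    "minor3 0 V = 0" "minor3 1 V = 0" "minor1 0 V \<noteq> 0" for V
    using torus_weights.euler_Y1_split[OF torus_weights.intro, of V] that by simp
  note s = weight_torus_symmetries(1,2)[OF W]
  \<comment> \<open>In each case the pair that does not vanish is moved to the first index, where
    the four linear forms become proportional.\<close>
  from assms(1) consider
    "S = {hyperdet, minor1 0, minor1 1, minor2 0, minor2 1}" |
    "S = {hyperdet, minor1 0, minor1 1, minor3 0, minor3 1}" |
    "S = {hyperdet, minor2 0, minor2 1, minor3 0, minor3 1}" unfolding strata_class_4 by blast
  then show ?thesis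
  proof cases
    case 1
    then have "euler (Y1 (swap13 W)) 2" using s(2) by (intro C) (simp_all flip: mem_vanishing SW)
    then show ?thesis by (rule euler_swap13)
  next
    case 2
    then have "euler (Y1 (swap12 W)) 2" using s(1) by (intro C) (simp_all flip: mem_vanishing SW)
    then show ?thesis by (rule euler_swap12)
  next
    case 3
    then show ?thesis using W by (intro C) (simp_all flip: mem_vanishing SW)
  qed
qed

lemma euler_class_5:
  assumes "W \<in> stratum EA_factors"
  shows "euler (Y1 W) 1"
proof -
  have "W \<in> weight_torus" "minor1 0 W = 0" "minor2 0 W = 0" "minor2 1 W = 0" "minor3 0 W = 0" "minor3 1 W = 0"
    using assms by (auto simp: stratum_def EA_factors_def)
  then show ?thesis using torus_weights.euler_Y1_split[OF torus_weights.intro, of W] by simp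
qed

theorem theorem1p7:
  "card EA_factors = 7 \<and>
   {S. S \<subseteq> EA_factors \<and> stratum S \<noteq> {}} = (\<Union>n\<le>5. strata_class n) \<and>
   card (\<Union>n\<le>5. strata_class n) = 41 \<and>
   card (strata_class 0) = 1 \<and>
   card (strata_class 1) = 7 \<and>
   card (strata_class 2) = 7 choose 2 \<and>
   card (strata_class 3) = 8 \<and>
   card (strata_class 4) = 3 \<and>
   card (strata_class 5) = 1 \<and>
   (\<forall>S\<in>strata_class 0. \<forall>W\<in>stratum S. has_euler_characteristic (top_of_set (Y1 W)) 6) \<and>
   (\<forall>S\<in>strata_class 1. \<forall>W\<in>stratum S. has_euler_characteristic (top_of_set (Y1 W)) 5) \<and>
   (\<forall>S\<in>strata_class 2. \<forall>W\<in>stratum S. has_euler_characteristic (top_of_set (Y1 W)) 4) \<and>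
   (\<forall>S\<in>strata_class 3. \<forall>W\<in>stratum S. has_euler_characteristic (top_of_set (Y1 W)) 3) \<and>
   (\<forall>S\<in>strata_class 4. \<forall>W\<in>stratum S. has_euler_characteristic (top_of_set (Y1 W)) 2) \<and>
   (\<forall>S\<in>strata_class 5. \<forall>W\<in>stratum S. has_euler_characteristic (top_of_set (Y1 W)) 1)"
proof (intro conjI ballI)
  fix S W assume W: "W \<in> stratum S"
  show "euler (Y1 W) 6" if "S \<in> strata_class 0"
    using euler_small_stratum[of S W] that W by (simp add: strata_class_simps)
  show "euler (Y1 W) 5" if "S \<in> strata_class 1"
    using euler_small_stratum[of S W] that W by (simp add: strata_class_simps)
  show "euler (Y1 W) 4" if "S \<in> strata_class 2"
    using euler_small_stratum[of S W] that W by (simp add: strata_class_simps)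
  show "euler (Y1 W) 1" if "S \<in> strata_class 5"
    using euler_class_5 that W by (simp add: strata_class_simps)
qed (use card_EA nonempty_strata card_all_strata card_strata_classes euler_class_3 euler_class_4 in auto)

end
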